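(* For every formula $A$ of the language of ZFU (Zermelo–Fraenkel set theory with urelements, formulated with $\in$, $=$ and a unary predicate $S$ for "is a set"), let $A^{q}$ be its translation into the language of quasi-set theory $\mathcal{Q}$ defined in the context. Then $\vdash_{ZFU}A$ if and only if $\vdash_{\mathcal{Q}}A^{q}$.
   Context: Quasi-set theory $\mathcal{Q}$ is a first-order theory in classical logic with no primitive equality symbol. Primitive symbols: unary predicates $m$ ("$x$ is an $m$-atom"), $M$ ("$x$ is an $M$-atom"), $Z$ ("$x$ is a set"); binary predicates $\equiv$ (indistinguishability) and $\in$; a unary function symbol $qc$ (quasi-cardinal). Abbreviations: $Q(x):=\neg(m(x)\vee M(x))$ ("$x$ is a qset"); $D(x):=M(x)\vee Z(x)$; $E(x):=Q(x)\wedge\forall y(y\in x\Rightarrow Q(y))$; $x=_E y:=(Q(x)\wedge Q(y)\wedge\forall z(z\in x\Leftrightarrow z\in y))\vee(M(x)\wedge M(y)\wedge\forall z(Q(z)\Rightarrow(x\in z\Leftrightarrow y\in z)))$ (extensional identity), $x\neq_E y:=\neg(x=_E y)$; $x\subseteq y:=\forall z(z\in x\Rightarrow z\in y)$; $x\subset y:=x\subseteq y\wedge x\neq_E y$; $\forall_Q,\exists_Q,\forall_D$ are quantifiers relativized to $Q$, $D$. Axioms of $\mathcal{Q}$: (Q1)–(Q3) $\equiv$ is reflexive, symmetric and transitive. (Q4) $\forall x\forall y(x=_E y\Rightarrow(A(x,x)\Rightarrow A(x,y)))$ for every formula $A$, with $A(x,y)$ obtained by replacing some free occurrences of $x$ by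 $y$, $y$ free for $x$. (Q5) $\forall x\,\neg(m(x)\wedge M(x))$. (Q6) $\forall x\forall y(x\in y\Rightarrow Q(y))$. (Q7) $\forall x(Z(x)\Rightarrow Q(x))$. (Q8) $\forall_Q x(\forall y(y\in x\Rightarrow D(y))\Leftrightarrow Z(x))$. (Q9) $\forall x\forall y(m(x)\wedge x\equiv y\Rightarrow m(y))$, $\forall x\forall y(x=_E y\wedge M(x)\Rightarrow M(y))$, $\forall x\forall y(x=_E y\wedge Z(x)\Rightarrow Z(y))$. (Q10) $\exists_Q x\forall y\,\neg(y\in x)$; such a qset is written $\emptyset$. (Q11) $\forall_D x\forall_D y(x\equiv y\Rightarrow x=_E y)$. (Q12) $\forall x\forall y\exists_Q z\forall t(t\in z\Leftrightarrow t\equiv x\vee t\equiv y)$; this qset is written $[x,y]$, and $[x]:=[x,x]$. (Q13) Separation: for each formula $A(t)$ without $y$ free, $\forall_Q x\exists_Q y\forall t(t\in y\Leftrightarrow t\in x\wedge A(t))$; written $[t\in x:A(t)]$. (Q14) $\forall_Q x(E(x)\Rightarrow\exists_Q y\forall z(z\in y\Leftrightarrow\exists t(z\in t\wedge t\in x)))$; written $\bigcup_{t\in x}t$. For qsets $x,y$, $x\cup y$, $x\cap y$, $x-y$ denote the qsets whose elements are exactly the objects in $x$ or in $y$, in both, in $x$ but not in $y$, respectively. (Q15) $\forall_Q x\exists_Q y\forall t(t\in y\Leftrightarrow t\subseteq x)$; written $\mathcal{P}(x)$. Also $\langle x,y\rangle:=[[x],[x,y]]$. (Q16) $\exists_Q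 x(\emptyset\in x\wedge\forall y(y\in x\wedge Q(y)\Rightarrow y\cup[y]\in x))$. (Q17) $\forall_Q x(E(x)\wedge x\neq_E\emptyset\Rightarrow\exists_Q y(y\in x\wedge y\cap x=_E\emptyset))$. The objects satisfying $D$ (with $\in$ and $=_E$) form a copy of ZFU set theory inside $\mathcal{Q}$; in it cardinals, natural numbers ($0,1,\dots$), cardinal arithmetic ($+,\le,<,2^\kappa$) and the cardinal $card(x)$ of a set are defined as usual; $Fin(x)$ means $qc(x)$ is a natural number. (Q18) $\forall x(\neg Q(x)\Rightarrow qc(x)=_E 0)$. (Q19) for every qset $x$, $qc(x)$ is a cardinal, and if $Z(x)$ then $qc(x)=_E card(x)$. (Q20) $\forall_Q x(x\neq_E\emptyset\Rightarrow qc(x)\neq_E 0)$. (Q21) for every qset $x$ and cardinal $\beta\le qc(x)$ there is a qset $y\subseteq x$ with $qc(y)=_E\beta$. (Q22) for qsets $y\subseteq x$, $qc(y)\le qc(x)$. (Q23) for qsets, $Fin(x)\wedge x\subset y\Rightarrow qc(x)<qc(y)$. (Q24) for qsets $x,y$ with no common element, $qc(x\cup y)=_E qc(x)+qc(y)$. (Q25) $\forall_Q x(qc(\mathcal{P}(x))=_E 2^{qc(x)})$. For nonempty qsets: $Sim(x,y):=\forall z\forall t(z\in x\wedge t\in y\Rightarrow z\equiv t)$, $QSim(x,y):=Sim(x,y)\wedge qc(x)=_E qc(y)$; $x/{\equiv}$ denotes the qset of the classes $[t\in x: t\equiv s]$ for $s\in x$. (Q26) Weak extensionality: $\forall_Q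 x\forall_Q y\big((\forall z(z\in x/{\equiv}\Rightarrow\exists t(t\in y/{\equiv}\wedge QSim(z,t)))\wedge\forall t(t\in y/{\equiv}\Rightarrow\exists z(z\in x/{\equiv}\wedge QSim(t,z))))\Rightarrow x\equiv y\big)$. (Q27) Replacement: for each formula $A(x,y)$, if $\forall x\exists y A(x,y)\wedge\forall x\forall x'\forall y\forall y'(A(x,y)\wedge A(x',y')\wedge x\equiv x'\Rightarrow y\equiv y')$, then $\forall_Q u\exists_Q v\forall z(z\in v\Rightarrow\exists w(w\in u\wedge A(w,z)))$. (Q28) Choice: $\forall_Q x\big(E(x)\wedge\forall y\forall z(y\in x\wedge z\in x\Rightarrow y\cap z=_E\emptyset\wedge y\neq_E\emptyset)\Rightarrow\exists_Q u\forall y\forall v(y\in x\wedge v\in y\Rightarrow\exists_Q w(w\subseteq[v]\wedge qc(w)=_E1\wedge w\cap y\equiv w\cap u))\big)$. Translation $A\mapsto A^q$, defined recursively: if $A$ is $S(x)$ then $A^q$ is $Z(x)$; if $A$ is $x=y$ then $A^q$ is $((M(x)\wedge M(y))\vee(Z(x)\wedge Z(y)))\wedge x=_E y$; if $A$ is $x\in y$ then $A^q$ is $(M(x)\vee Z(x))\wedge Z(y)\wedge x\in y$; $(\neg B)^q$ is $\neg B^q$; $(B\vee C)^q$ is $B^q\vee C^q$; $(\forall x B)^q$ is $\forall x(M(x)\vee Z(x)\Rightarrow B^q)$.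
   Formalization: Formulas with free variables are universally closed before translating; ZFU includes choice; in Q15 P(x) contains only the qsets t ⊆ x; in Q27 v is exactly the image of u (⇔ instead of ⇒). As literally stated the equivalence fails. *)

theory Defs
  imports Main
begin

section \<open>First-order syntax and provability\<close>

text \<open>
  Formulas use de Bruijn indices. They are parameterised by a type of terms with substitution, so
  that the language of ZFU (whose only terms are variables) and the language of quasi-set theory
  (with the function symbol \<open>qc\<close>) share one notion of formula and one calculus. All predicate
  symbols are unary or binary. Equality is not a logical symbol.
\<close>

class fo_term =
  fixes var :: "nat \<Rightarrow> 'a"
    and tsubst :: "(nat \<Rightarrow> 'a) \<Rightarrow> 'a \<Rightarrow> 'a"
  assumes tsubst_var: "tsubst \<sigma> (var n) = \<sigma> n"
    and tsubst_id: "tsubst var t = t"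
    and tsubst_comp: "tsubst \<sigma> (tsubst \<tau> t) = tsubst (\<lambda>n. tsubst \<sigma> (\<tau> n)) t"
    and tsubst_fin: "\<exists>n. \<forall>\<sigma> \<tau>. (\<forall>i<n. \<sigma> i = \<tau> i) \<longrightarrow> tsubst \<sigma> t = tsubst \<tau> t"

datatype ('t, 'p, 'r) fm =
    Pr1 'p 't
  | Pr2 'r 't 't
  | Neg "('t, 'p, 'r) fm"
  | Or "('t, 'p, 'r) fm" "('t, 'p, 'r) fm"
  | All "('t, 'p, 'r) fm"

abbreviation And :: "('t, 'p, 'r) fm \<Rightarrow> ('t, 'p, 'r) fm \<Rightarrow> ('t, 'p, 'r) fm" where
  "And A B \<equiv> Neg (Or (Neg A) (Neg B))"

abbreviation Imp :: "('t, 'p, 'r) fm \<Rightarrow> ('t, 'p, 'r) fm \<Rightarrow> ('t, 'p, 'r) fm" where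
  "Imp A B \<equiv> Or (Neg A) B"

definition push :: "(nat \<Rightarrow> 't::fo_term) \<Rightarrow> nat \<Rightarrow> 't" where
  "push \<sigma> \<equiv> case_nat (var 0) (\<lambda>n. tsubst (\<lambda>i. var (Suc i)) (\<sigma> n))"

primrec subst :: "(nat \<Rightarrow> 't::fo_term) \<Rightarrow> ('t, 'p, 'r) fm \<Rightarrow> ('t, 'p, 'r) fm" where
  "subst \<sigma> (Pr1 p t) = Pr1 p (tsubst \<sigma> t)"
| "subst \<sigma> (Pr2 r s t) = Pr2 r (tsubst \<sigma> s) (tsubst \<sigma> t)"
| "subst \<sigma> (Neg A) = Neg (subst \<sigma> A)"
| "subst \<sigma> (Or A B) = Or (subst \<sigma> A) (subst \<sigma> B)"
| "subst \<sigma> (All A) = All (subst (push \<sigma>) A)"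

text \<open>
  The Hilbert--Ackermann calculus over \<open>\<not>\<close>, \<open>\<or>\<close>, \<open>\<forall>\<close>, with the elements of \<open>T\<close> as
  nonlogical axioms. Generalisation is unrestricted, so free variables of axioms and of theorems are
  read as universally quantified. In \<open>all_distr\<close> the shift of \<open>A\<close> expresses that the
  quantified variable is not free in \<open>A\<close>.
\<close>

inductive provable :: "('t::fo_term, 'p, 'r) fm set \<Rightarrow> ('t, 'p, 'r) fm \<Rightarrow> bool"
    (infix "\<turnstile>" 50) for T where
  ax: "A \<in> T \<Longrightarrow> T \<turnstile> A"
| taut: "T \<turnstile> Imp (Or A A) A"
| add: "T \<turnstile> Imp A (Or A B)"
| perm: "T \<turnstile> Imp (Or A B) (Or B A)"
| summ: "T \<turnstile> Imp (Imp B C) (Imp (Or A B) (Or A C))"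
| all_inst: "T \<turnstile> Imp (All A) (subst (case_nat t var) A)"
| all_distr: "T \<turnstile> Imp (All (Imp (subst (\<lambda>i. var (Suc i)) A) B)) (Imp A (All B))"
| mp: "T \<turnstile> A \<Longrightarrow> T \<turnstile> Imp A B \<Longrightarrow> T \<turnstile> B"
| gen: "T \<turnstile> A \<Longrightarrow> T \<turnstile> All A"


section \<open>Writing formulas with named bound variables\<close>

text \<open>
  To write axioms with named variables, a formula is presented as a function of the number
  \<open>d\<close> of quantifiers above it, and likewise for terms. The variable bound at depth \<open>d\<close> has
  index \<open>e - Suc d\<close> at depth \<open>e\<close>; the free variable \<open>i\<close> has index \<open>e + i\<close>. The de Bruijn
  formula denoted by \<open>F\<close> is \<open>F 0\<close>.
\<close>

type_synonym 't dtm = "nat \<Rightarrow> 't"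
type_synonym ('t, 'p, 'r) dfm = "nat \<Rightarrow> ('t, 'p, 'r) fm"

definition fv :: "nat \<Rightarrow> 't::fo_term dtm" where
  "fv i \<equiv> (\<lambda>d. var (d + i))"

definition pr1 :: "'p \<Rightarrow> 't dtm \<Rightarrow> ('t, 'p, 'r) dfm" where
  "pr1 p t \<equiv> (\<lambda>d. Pr1 p (t d))"

definition pr2 :: "'r \<Rightarrow> 't dtm \<Rightarrow> 't dtm \<Rightarrow> ('t, 'p, 'r) dfm" where
  "pr2 r s t \<equiv> (\<lambda>d. Pr2 r (s d) (t d))"

definition dNot :: "('t, 'p, 'r) dfm \<Rightarrow> ('t, 'p, 'r) dfm" ("\<^bold>\<not> _" [40] 40) where
  "\<^bold>\<not> F \<equiv> (\<lambda>d. Neg (F d))"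

definition dOr :: "('t, 'p, 'r) dfm \<Rightarrow> ('t, 'p, 'r) dfm \<Rightarrow> ('t, 'p, 'r) dfm" (infixr "\<^bold>\<or>" 30) where
  "F \<^bold>\<or> G \<equiv> (\<lambda>d. Or (F d) (G d))"

definition dAnd :: "('t, 'p, 'r) dfm \<Rightarrow> ('t, 'p, 'r) dfm \<Rightarrow> ('t, 'p, 'r) dfm" (infixr "\<^bold>\<and>" 35) where
  "F \<^bold>\<and> G \<equiv> (\<lambda>d. And (F d) (G d))"

definition dImp :: "('t, 'p, 'r) dfm \<Rightarrow> ('t, 'p, 'r) dfm \<Rightarrow> ('t, 'p, 'r) dfm" (infixr "\<^bold>\<longrightarrow>" 25) where
  "F \<^bold>\<longrightarrow> G \<equiv> (\<lambda>d. Imp (F d) (G d))"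

definition dIff :: "('t, 'p, 'r) dfm \<Rightarrow> ('t, 'p, 'r) dfm \<Rightarrow> ('t, 'p, 'r) dfm" (infixr "\<^bold>\<longleftrightarrow>" 25) where
  "F \<^bold>\<longleftrightarrow> G \<equiv> (F \<^bold>\<longrightarrow> G) \<^bold>\<and> (G \<^bold>\<longrightarrow> F)"

definition dAll :: "('t::fo_term dtm \<Rightarrow> ('t, 'p, 'r) dfm) \<Rightarrow> ('t, 'p, 'r) dfm"
    (binder "\<^bold>\<forall>" 10) where
  "(\<^bold>\<forall>x. F x) \<equiv> (\<lambda>d. All (F (\<lambda>e. var (e - Suc d)) (Suc d)))"

definition dEx :: "('t::fo_term dtm \<Rightarrow> ('t, 'p, 'r) dfm) \<Rightarrow> ('t, 'p, 'r) dfm"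
    (binder "\<^bold>\<exists>" 10) where
  "(\<^bold>\<exists>x. F x) \<equiv> (\<^bold>\<not> (\<^bold>\<forall>x. \<^bold>\<not> F x))"

text \<open>
  \<open>inst A [t\<^sub>0, \<dots>, t\<^sub>k]\<close> substitutes \<open>t\<^sub>0, \<dots>, t\<^sub>k\<close> for the variables \<open>0, \<dots>, k\<close>
  of the de Bruijn formula \<open>A\<close>; its remaining free variables become the free variables
  \<open>0, 1, \<dots>\<close> of the result. In the axiom schemas these are the parameters of \<open>A\<close>.
\<close>

definition inst :: "('t::fo_term, 'p, 'r) fm \<Rightarrow> 't dtm list \<Rightarrow> ('t, 'p, 'r) dfm" where
  "inst A ts \<equiv> (\<lambda>d. subst (\<lambda>i. if i < length ts then (ts ! i) d else fv (i - length ts) d) A)"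


section \<open>The theory ZFU\<close>

instantiation nat :: fo_term
begin
definition var_nat :: "nat \<Rightarrow> nat" where "var_nat n \<equiv> n"
definition tsubst_nat :: "(nat \<Rightarrow> nat) \<Rightarrow> nat \<Rightarrow> nat" where "tsubst_nat \<sigma> n \<equiv> \<sigma> n"
instance by standard (auto simp: var_nat_def tsubst_nat_def)
end

datatype zpred1 = SetU
datatype zpred2 = EqU | MemU

type_synonym zfm = "(nat, zpred1, zpred2) fm"
type_synonym zdtm = "nat dtm"
type_synonym zdfm = "(nat, zpred1, zpred2) dfm"

definition S :: "zdtm \<Rightarrow> zdfm" where "S \<equiv> pr1 SetU"
definition equ :: "zdtm \<Rightarrow> zdtm \<Rightarrow> zdfm" (infix "=\<^sub>U" 50) where "equ \<equiv> pr2 EqU"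
definition memu :: "zdtm \<Rightarrow> zdtm \<Rightarrow> zdfm" (infix "\<in>\<^sub>U" 50) where "memu \<equiv> pr2 MemU"

text \<open>
  ZFU includes the axiom of choice. It neither asserts nor denies that urelements exist or that they
  form a set. The first two rules make \<open>=\<^sub>U\<close> the equality of first-order logic with equality:
  in \<open>eq_subst\<close>, variable \<open>1\<close> of \<open>A\<close> marks the occurrences of \<open>x\<close> to be replaced.
\<close>

inductive_set ZFU :: "zfm set" where
  eq_refl: "(\<^bold>\<forall>x. x =\<^sub>U x) 0 \<in> ZFU"
| eq_subst: "(\<^bold>\<forall>x. \<^bold>\<forall>y. x =\<^sub>U y \<^bold>\<longrightarrow> (inst A [x, x] \<^bold>\<longrightarrow> inst A [x, y])) 0 \<in> ZFU"
| atoms: "(\<^bold>\<forall>x. \<^bold>\<forall>y. x \<in>\<^sub>U y \<^bold>\<longrightarrow> S y) 0 \<in> ZFU"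
| extensionality:
    "(\<^bold>\<forall>x. \<^bold>\<forall>y. S x \<^bold>\<and> S y \<^bold>\<and> (\<^bold>\<forall>z. z \<in>\<^sub>U x \<^bold>\<longleftrightarrow> z \<in>\<^sub>U y) \<^bold>\<longrightarrow> x =\<^sub>U y) 0 \<in> ZFU"
| pairing: "(\<^bold>\<forall>x. \<^bold>\<forall>y. \<^bold>\<exists>z. S z \<^bold>\<and> (\<^bold>\<forall>t. t \<in>\<^sub>U z \<^bold>\<longleftrightarrow> t =\<^sub>U x \<^bold>\<or> t =\<^sub>U y)) 0 \<in> ZFU"
| union:
    "(\<^bold>\<forall>x. S x \<^bold>\<longrightarrow> (\<^bold>\<exists>y. S y \<^bold>\<and> (\<^bold>\<forall>z. z \<in>\<^sub>U y \<^bold>\<longleftrightarrow> (\<^bold>\<exists>t. z \<in>\<^sub>U t \<^bold>\<and> t \<in>\<^sub>U x)))) 0 \<in> ZFU"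
| power:
    "(\<^bold>\<forall>x. S x \<^bold>\<longrightarrow> (\<^bold>\<exists>y. S y \<^bold>\<and>
        (\<^bold>\<forall>t. t \<in>\<^sub>U y \<^bold>\<longleftrightarrow> S t \<^bold>\<and> (\<^bold>\<forall>z. z \<in>\<^sub>U t \<^bold>\<longrightarrow> z \<in>\<^sub>U x)))) 0 \<in> ZFU"
| infinity:
    "(\<^bold>\<exists>x. S x \<^bold>\<and> (\<^bold>\<exists>e. S e \<^bold>\<and> (\<^bold>\<forall>t. \<^bold>\<not> t \<in>\<^sub>U e) \<^bold>\<and> e \<in>\<^sub>U x) \<^bold>\<and>
        (\<^bold>\<forall>y. y \<in>\<^sub>U x \<^bold>\<and> S y \<^bold>\<longrightarrow>
          (\<^bold>\<exists>w. S w \<^bold>\<and> (\<^bold>\<forall>t. t \<in>\<^sub>U w \<^bold>\<longleftrightarrow> t \<in>\<^sub>U y \<^bold>\<or> t =\<^sub>U y) \<^bold>\<and> w \<in>\<^sub>U x))) 0 \<in> ZFU"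
| separation:
    "(\<^bold>\<forall>x. S x \<^bold>\<longrightarrow> (\<^bold>\<exists>y. S y \<^bold>\<and> (\<^bold>\<forall>t. t \<in>\<^sub>U y \<^bold>\<longleftrightarrow> t \<in>\<^sub>U x \<^bold>\<and> inst A [t, x]))) 0 \<in> ZFU"
| replacement:
    "(\<^bold>\<forall>u. S u \<^bold>\<and>
        (\<^bold>\<forall>x. \<^bold>\<forall>y. \<^bold>\<forall>y'. x \<in>\<^sub>U u \<^bold>\<and> inst A [x, y, u] \<^bold>\<and> inst A [x, y', u] \<^bold>\<longrightarrow> y =\<^sub>U y') \<^bold>\<longrightarrow>
        (\<^bold>\<exists>v. S v \<^bold>\<and> (\<^bold>\<forall>y. y \<in>\<^sub>U v \<^bold>\<longleftrightarrow> (\<^bold>\<exists>x. x \<in>\<^sub>U u \<^bold>\<and> inst A [x, y, u])))) 0 \<in> ZFU"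
| foundation:
    "(\<^bold>\<forall>x. S x \<^bold>\<and> (\<^bold>\<exists>y. y \<in>\<^sub>U x) \<^bold>\<longrightarrow>
        (\<^bold>\<exists>y. y \<in>\<^sub>U x \<^bold>\<and> \<^bold>\<not> (\<^bold>\<exists>z. z \<in>\<^sub>U y \<^bold>\<and> z \<in>\<^sub>U x))) 0 \<in> ZFU"
| choice:
    "(\<^bold>\<forall>x. S x \<^bold>\<and> (\<^bold>\<forall>y. y \<in>\<^sub>U x \<^bold>\<longrightarrow> S y \<^bold>\<and> (\<^bold>\<exists>t. t \<in>\<^sub>U y)) \<^bold>\<and>
        (\<^bold>\<forall>y. \<^bold>\<forall>z. y \<in>\<^sub>U x \<^bold>\<and> z \<in>\<^sub>U x \<^bold>\<and> (\<^bold>\<exists>t. t \<in>\<^sub>U y \<^bold>\<and> t \<in>\<^sub>U z) \<^bold>\<longrightarrow> y =\<^sub>U z) \<^bold>\<longrightarrow>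
        (\<^bold>\<exists>u. S u \<^bold>\<and> (\<^bold>\<forall>y. y \<in>\<^sub>U x \<^bold>\<longrightarrow>
          (\<^bold>\<exists>v. \<^bold>\<forall>t. t \<in>\<^sub>U y \<^bold>\<and> t \<in>\<^sub>U u \<^bold>\<longleftrightarrow> t =\<^sub>U v)))) 0 \<in> ZFU"

text \<open>\<open>fvb A\<close> is the least \<open>n\<close> such that all free variables of \<open>A\<close> are below \<open>n\<close>.\<close>

primrec fvb :: "zfm \<Rightarrow> nat" where
  "fvb (Pr1 p x) = Suc x"
| "fvb (Pr2 r x y) = max (Suc x) (Suc y)"
| "fvb (Neg A) = fvb A"
| "fvb (Or A B) = max (fvb A) (fvb B)"
| "fvb (All A) = fvb A - 1"

definition uclose :: "zfm \<Rightarrow> zfm" where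
  "uclose A \<equiv> (All ^^ fvb A) A"

lemma uclose_sentence: "fvb A = 0 \<Longrightarrow> uclose A = A"
  by (simp add: uclose_def)


section \<open>Ordinals and cardinals in ZFU\<close>

definition emptyu :: "zdtm \<Rightarrow> zdfm" where
  "emptyu e \<equiv> S e \<^bold>\<and> (\<^bold>\<forall>t. \<^bold>\<not> t \<in>\<^sub>U e)"

definition oneu :: "zdtm \<Rightarrow> zdfm" where
  "oneu x \<equiv> S x \<^bold>\<and> (\<^bold>\<forall>t. t \<in>\<^sub>U x \<^bold>\<longleftrightarrow> emptyu t)"

definition succu :: "zdtm \<Rightarrow> zdtm \<Rightarrow> zdfm" where
  "succu w y \<equiv> S w \<^bold>\<and> (\<^bold>\<forall>t. t \<in>\<^sub>U w \<^bold>\<longleftrightarrow> t \<in>\<^sub>U y \<^bold>\<or> t =\<^sub>U y)"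

definition upairu :: "zdtm \<Rightarrow> zdtm \<Rightarrow> zdtm \<Rightarrow> zdfm" where
  "upairu p x y \<equiv> S p \<^bold>\<and> (\<^bold>\<forall>t. t \<in>\<^sub>U p \<^bold>\<longleftrightarrow> t =\<^sub>U x \<^bold>\<or> t =\<^sub>U y)"

definition opairu :: "zdtm \<Rightarrow> zdtm \<Rightarrow> zdtm \<Rightarrow> zdfm" where
  "opairu p x y \<equiv> S p \<^bold>\<and> (\<^bold>\<forall>t. t \<in>\<^sub>U p \<^bold>\<longleftrightarrow> upairu t x x \<^bold>\<or> upairu t x y)"

definition appu :: "zdtm \<Rightarrow> zdtm \<Rightarrow> zdtm \<Rightarrow> zdfm" where
  "appu f x y \<equiv> (\<^bold>\<exists>p. opairu p x y \<^bold>\<and> p \<in>\<^sub>U f)"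

definition funu :: "zdtm \<Rightarrow> zdtm \<Rightarrow> zdtm \<Rightarrow> zdfm" where
  "funu f a b \<equiv> S f \<^bold>\<and>
     (\<^bold>\<forall>p. p \<in>\<^sub>U f \<^bold>\<longrightarrow> (\<^bold>\<exists>x. \<^bold>\<exists>y. x \<in>\<^sub>U a \<^bold>\<and> y \<in>\<^sub>U b \<^bold>\<and> opairu p x y)) \<^bold>\<and>
     (\<^bold>\<forall>x. x \<in>\<^sub>U a \<^bold>\<longrightarrow> (\<^bold>\<exists>y. \<^bold>\<forall>z. appu f x z \<^bold>\<longleftrightarrow> z =\<^sub>U y))"

definition bijectionu :: "zdtm \<Rightarrow> zdtm \<Rightarrow> zdtm \<Rightarrow> zdfm" where
  "bijectionu f a b \<equiv> funu f a b \<^bold>\<and>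
     (\<^bold>\<forall>y. y \<in>\<^sub>U b \<^bold>\<longrightarrow> (\<^bold>\<exists>x. \<^bold>\<forall>z. appu f z y \<^bold>\<longleftrightarrow> z =\<^sub>U x))"

definition eqpollu :: "zdtm \<Rightarrow> zdtm \<Rightarrow> zdfm" where
  "eqpollu a b \<equiv> S a \<^bold>\<and> S b \<^bold>\<and> (\<^bold>\<exists>f. bijectionu f a b)"

text \<open>Von Neumann ordinals; well-foundedness of \<open>\<in>\<close> comes from the axiom of foundation.\<close>

definition ordu :: "zdtm \<Rightarrow> zdfm" where
  "ordu x \<equiv> S x \<^bold>\<and>
     (\<^bold>\<forall>y. y \<in>\<^sub>U x \<^bold>\<longrightarrow> S y \<^bold>\<and> (\<^bold>\<forall>z. z \<in>\<^sub>U y \<^bold>\<longrightarrow> z \<in>\<^sub>U x)) \<^bold>\<and>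
     (\<^bold>\<forall>y. \<^bold>\<forall>z. y \<in>\<^sub>U x \<^bold>\<and> z \<in>\<^sub>U x \<^bold>\<longrightarrow> y \<in>\<^sub>U z \<^bold>\<or> y =\<^sub>U z \<^bold>\<or> z \<in>\<^sub>U y)"

text \<open>A natural number is an ordinal which is zero or a successor, and so are all its elements.\<close>

definition natu :: "zdtm \<Rightarrow> zdfm" where
  "natu n \<equiv> ordu n \<^bold>\<and>
     (\<^bold>\<forall>m. m \<in>\<^sub>U n \<^bold>\<or> m =\<^sub>U n \<^bold>\<longrightarrow> emptyu m \<^bold>\<or> (\<^bold>\<exists>k. succu m k))"

text \<open>Cardinals are initial ordinals, ordered as ordinals. The formula \<open>cardofu x k\<close> says that
  \<open>k\<close> is the cardinal of \<open>x\<close>, \<open>addu k l m\<close> that \<open>m\<close> is \<open>k + l\<close>, and \<open>pow2u k m\<close>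
  that \<open>m\<close> is \<open>2\<^sup>k\<close>, i.e. the cardinal of the set of functions from \<open>k\<close> to \<open>2\<close>.\<close>

definition cardu :: "zdtm \<Rightarrow> zdfm" where
  "cardu k \<equiv> ordu k \<^bold>\<and> \<^bold>\<not> (\<^bold>\<exists>a. a \<in>\<^sub>U k \<^bold>\<and> eqpollu a k)"

definition cardofu :: "zdtm \<Rightarrow> zdtm \<Rightarrow> zdfm" where
  "cardofu x k \<equiv> cardu k \<^bold>\<and> eqpollu x k"

definition leu :: "zdtm \<Rightarrow> zdtm \<Rightarrow> zdfm" where
  "leu k l \<equiv> (k \<in>\<^sub>U l \<^bold>\<or> k =\<^sub>U l)"

definition lessu :: "zdtm \<Rightarrow> zdtm \<Rightarrow> zdfm" where
  "lessu k l \<equiv> k \<in>\<^sub>U l"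

definition addu :: "zdtm \<Rightarrow> zdtm \<Rightarrow> zdtm \<Rightarrow> zdfm" where
  "addu k l m \<equiv> (\<^bold>\<exists>a. \<^bold>\<exists>b. \<^bold>\<exists>c. eqpollu a k \<^bold>\<and> eqpollu b l \<^bold>\<and>
     \<^bold>\<not> (\<^bold>\<exists>t. t \<in>\<^sub>U a \<^bold>\<and> t \<in>\<^sub>U b) \<^bold>\<and>
     S c \<^bold>\<and> (\<^bold>\<forall>t. t \<in>\<^sub>U c \<^bold>\<longleftrightarrow> t \<in>\<^sub>U a \<^bold>\<or> t \<in>\<^sub>U b) \<^bold>\<and> cardofu c m)"

definition pow2u :: "zdtm \<Rightarrow> zdtm \<Rightarrow> zdfm" where
  "pow2u k m \<equiv> (\<^bold>\<exists>i. \<^bold>\<exists>j. \<^bold>\<exists>p. oneu i \<^bold>\<and> succu j i \<^bold>\<and>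
     S p \<^bold>\<and> (\<^bold>\<forall>f. f \<in>\<^sub>U p \<^bold>\<longleftrightarrow> funu f k j) \<^bold>\<and> cardofu p m)"


section \<open>The language of quasi-set theory\<close>

datatype qtm = QVar nat | QC qtm

primrec qsubst :: "(nat \<Rightarrow> qtm) \<Rightarrow> qtm \<Rightarrow> qtm" where
  "qsubst \<sigma> (QVar n) = \<sigma> n"
| "qsubst \<sigma> (QC t) = QC (qsubst \<sigma> t)"

instantiation qtm :: fo_term
begin
definition var_qtm :: "nat \<Rightarrow> qtm" where "var_qtm \<equiv> QVar"
definition tsubst_qtm :: "(nat \<Rightarrow> qtm) \<Rightarrow> qtm \<Rightarrow> qtm" where "tsubst_qtm \<equiv> qsubst"
instance
proof
  fix \<sigma> \<tau> :: "nat \<Rightarrow> qtm" and n :: nat and t :: qtm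
  show "tsubst \<sigma> (var n) = \<sigma> n" by (simp add: var_qtm_def tsubst_qtm_def)
  show "tsubst var t = t" by (induction t) (simp_all add: var_qtm_def tsubst_qtm_def)
  show "tsubst \<sigma> (tsubst \<tau> t) = tsubst (\<lambda>n. tsubst \<sigma> (\<tau> n)) t"
    by (induction t) (simp_all add: tsubst_qtm_def)
  show "\<exists>n. \<forall>\<sigma> \<tau>. (\<forall>i<n. \<sigma> i = \<tau> i) \<longrightarrow> tsubst \<sigma> t = tsubst \<tau> t"
    by (induction t) (auto simp: tsubst_qtm_def)
qed
end

datatype qpred1 = Micro | Macro | SetQ
datatype qpred2 = Indist | MemQ

type_synonym qfm = "(qtm, qpred1, qpred2) fm"
type_synonym qdtm = "qtm dtm"
type_synonym qdfm = "(qtm, qpred1, qpred2) dfm"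

definition m :: "qdtm \<Rightarrow> qdfm" where "m \<equiv> pr1 Micro"
definition M :: "qdtm \<Rightarrow> qdfm" where "M \<equiv> pr1 Macro"
definition Z :: "qdtm \<Rightarrow> qdfm" where "Z \<equiv> pr1 SetQ"
definition indist :: "qdtm \<Rightarrow> qdtm \<Rightarrow> qdfm" (infix "\<^bold>\<equiv>" 50) where "indist \<equiv> pr2 Indist"
definition memq :: "qdtm \<Rightarrow> qdtm \<Rightarrow> qdfm" (infix "\<^bold>\<in>" 50) where "memq \<equiv> pr2 MemQ"
definition qc :: "qdtm \<Rightarrow> qdtm" where "qc t \<equiv> (\<lambda>d. QC (t d))"

definition Q :: "qdtm \<Rightarrow> qdfm" where "Q x \<equiv> \<^bold>\<not> (m x \<^bold>\<or> M x)"
definition D :: "qdtm \<Rightarrow> qdfm" where "D x \<equiv> (M x \<^bold>\<or> Z x)"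

definition AllQ :: "(qdtm \<Rightarrow> qdfm) \<Rightarrow> qdfm" (binder "\<^bold>\<forall>\<^sub>Q" 10) where
  "(\<^bold>\<forall>\<^sub>Q x. F x) \<equiv> (\<^bold>\<forall>x. Q x \<^bold>\<longrightarrow> F x)"
definition ExQ :: "(qdtm \<Rightarrow> qdfm) \<Rightarrow> qdfm" (binder "\<^bold>\<exists>\<^sub>Q" 10) where
  "(\<^bold>\<exists>\<^sub>Q x. F x) \<equiv> (\<^bold>\<exists>x. Q x \<^bold>\<and> F x)"
definition AllD :: "(qdtm \<Rightarrow> qdfm) \<Rightarrow> qdfm" (binder "\<^bold>\<forall>\<^sub>D" 10) where
  "(\<^bold>\<forall>\<^sub>D x. F x) \<equiv> (\<^bold>\<forall>x. D x \<^bold>\<longrightarrow> F x)"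

definition E :: "qdtm \<Rightarrow> qdfm" where
  "E x \<equiv> Q x \<^bold>\<and> (\<^bold>\<forall>y. y \<^bold>\<in> x \<^bold>\<longrightarrow> Q y)"

definition eqE :: "qdtm \<Rightarrow> qdtm \<Rightarrow> qdfm" (infix "=\<^sub>E" 50) where
  "x =\<^sub>E y \<equiv> (Q x \<^bold>\<and> Q y \<^bold>\<and> (\<^bold>\<forall>z. z \<^bold>\<in> x \<^bold>\<longleftrightarrow> z \<^bold>\<in> y) \<^bold>\<or>
              M x \<^bold>\<and> M y \<^bold>\<and> (\<^bold>\<forall>z. Q z \<^bold>\<longrightarrow> (x \<^bold>\<in> z \<^bold>\<longleftrightarrow> y \<^bold>\<in> z)))"

definition neqE :: "qdtm \<Rightarrow> qdtm \<Rightarrow> qdfm" (infix "\<noteq>\<^sub>E" 50) where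
  "x \<noteq>\<^sub>E y \<equiv> \<^bold>\<not> (x =\<^sub>E y)"

definition subq :: "qdtm \<Rightarrow> qdtm \<Rightarrow> qdfm" (infix "\<^bold>\<subseteq>" 50) where
  "x \<^bold>\<subseteq> y \<equiv> (\<^bold>\<forall>z. z \<^bold>\<in> x \<^bold>\<longrightarrow> z \<^bold>\<in> y)"

definition psubq :: "qdtm \<Rightarrow> qdtm \<Rightarrow> qdfm" (infix "\<^bold>\<subset>" 50) where
  "x \<^bold>\<subset> y \<equiv> (x \<^bold>\<subseteq> y \<^bold>\<and> x \<noteq>\<^sub>E y)"


section \<open>The translation of ZFU into quasi-set theory\<close>

primrec tr :: "zfm \<Rightarrow> qfm" where
  "tr (Pr1 p x) = (case p of SetU \<Rightarrow> Z (fv x) 0)"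
| "tr (Pr2 r x y) = (case r of
      EqU \<Rightarrow> ((M (fv x) \<^bold>\<and> M (fv y) \<^bold>\<or> Z (fv x) \<^bold>\<and> Z (fv y)) \<^bold>\<and> fv x =\<^sub>E fv y) 0
    | MemU \<Rightarrow> ((M (fv x) \<^bold>\<or> Z (fv x)) \<^bold>\<and> Z (fv y) \<^bold>\<and> fv x \<^bold>\<in> fv y) 0)"
| "tr (Neg A) = Neg (tr A)"
| "tr (Or A B) = Or (tr A) (tr B)"
| "tr (All A) = All (Imp ((M (fv 0) \<^bold>\<or> Z (fv 0)) 0) (tr A))"


section \<open>The axioms of quasi-set theory\<close>

text \<open>
  A defined operation is represented by the formula stating that its first argument is a value of
  the operation; a defined term is then eliminated by an existential quantifier. Its values exist and
  are unique up to \<open>=\<^sub>E\<close>.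
\<close>

definition emptyq :: "qdtm \<Rightarrow> qdfm" where
  "emptyq e \<equiv> Q e \<^bold>\<and> (\<^bold>\<forall>t. \<^bold>\<not> t \<^bold>\<in> e)"

definition pairq :: "qdtm \<Rightarrow> qdtm \<Rightarrow> qdtm \<Rightarrow> qdfm" where
  "pairq w x y \<equiv> Q w \<^bold>\<and> (\<^bold>\<forall>t. t \<^bold>\<in> w \<^bold>\<longleftrightarrow> t \<^bold>\<equiv> x \<^bold>\<or> t \<^bold>\<equiv> y)"

definition unq :: "qdtm \<Rightarrow> qdtm \<Rightarrow> qdtm \<Rightarrow> qdfm" where
  "unq w x y \<equiv> Q w \<^bold>\<and> (\<^bold>\<forall>t. t \<^bold>\<in> w \<^bold>\<longleftrightarrow> t \<^bold>\<in> x \<^bold>\<or> t \<^bold>\<in> y)"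

definition interq :: "qdtm \<Rightarrow> qdtm \<Rightarrow> qdtm \<Rightarrow> qdfm" where
  "interq w x y \<equiv> Q w \<^bold>\<and> (\<^bold>\<forall>t. t \<^bold>\<in> w \<^bold>\<longleftrightarrow> t \<^bold>\<in> x \<^bold>\<and> t \<^bold>\<in> y)"

text \<open>
  The elements of a power qset are subqsets. Without the conjunct \<open>Q t\<close>, every atom, having no
  elements, would belong to every power qset, which together with \<open>Q23\<close> and \<open>Q25\<close> below
  would refute the existence of atoms.
\<close>

definition powq :: "qdtm \<Rightarrow> qdtm \<Rightarrow> qdfm" where
  "powq w x \<equiv> Q w \<^bold>\<and> (\<^bold>\<forall>t. t \<^bold>\<in> w \<^bold>\<longleftrightarrow> Q t \<^bold>\<and> t \<^bold>\<subseteq> x)"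

definition quotq :: "qdtm \<Rightarrow> qdtm \<Rightarrow> qdfm" where
  "quotq w x \<equiv> Q w \<^bold>\<and> (\<^bold>\<forall>z. z \<^bold>\<in> w \<^bold>\<longleftrightarrow>
     Q z \<^bold>\<and> (\<^bold>\<exists>s. s \<^bold>\<in> x \<^bold>\<and> (\<^bold>\<forall>t. t \<^bold>\<in> z \<^bold>\<longleftrightarrow> t \<^bold>\<in> x \<^bold>\<and> t \<^bold>\<equiv> s)))"

definition Sim :: "qdtm \<Rightarrow> qdtm \<Rightarrow> qdfm" where
  "Sim x y \<equiv> (\<^bold>\<forall>z. \<^bold>\<forall>t. z \<^bold>\<in> x \<^bold>\<and> t \<^bold>\<in> y \<^bold>\<longrightarrow> z \<^bold>\<equiv> t)"

definition QSim :: "qdtm \<Rightarrow> qdtm \<Rightarrow> qdfm" where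
  "QSim x y \<equiv> Sim x y \<^bold>\<and> qc x =\<^sub>E qc y"

text \<open>
  Cardinal notions in the axioms below are those of the copy of ZFU formed by the objects satisfying
  \<open>D\<close>, i.e. the translations of the corresponding notions of ZFU.
\<close>

definition inD1 :: "(zdtm \<Rightarrow> zdfm) \<Rightarrow> qdtm \<Rightarrow> qdfm" where
  "inD1 F x \<equiv> inst (tr (F (fv 0) 0)) [x]"

definition inD2 :: "(zdtm \<Rightarrow> zdtm \<Rightarrow> zdfm) \<Rightarrow> qdtm \<Rightarrow> qdtm \<Rightarrow> qdfm" where
  "inD2 F x y \<equiv> inst (tr (F (fv 0) (fv 1) 0)) [x, y]"

definition inD3 :: "(zdtm \<Rightarrow> zdtm \<Rightarrow> zdtm \<Rightarrow> zdfm) \<Rightarrow> qdtm \<Rightarrow> qdtm \<Rightarrow> qdtm \<Rightarrow> qdfm" where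
  "inD3 F x y z \<equiv> inst (tr (F (fv 0) (fv 1) (fv 2) 0)) [x, y, z]"

definition Fin :: "qdtm \<Rightarrow> qdfm" where
  "Fin x \<equiv> inD1 natu (qc x)"

text \<open>
  In \<open>Q4\<close>, variable \<open>1\<close> of \<open>A\<close> marks the occurrences of \<open>x\<close> to be replaced. The conclusion
  of \<open>Q27\<close> says that the elements of \<open>v\<close> are exactly the images of the elements of \<open>u\<close>; with
  the implication from left to right alone it would be witnessed by the empty qset.
\<close>

inductive_set QST :: "qfm set" where
  Q1: "(\<^bold>\<forall>x. x \<^bold>\<equiv> x) 0 \<in> QST"
| Q2: "(\<^bold>\<forall>x. \<^bold>\<forall>y. x \<^bold>\<equiv> y \<^bold>\<longrightarrow> y \<^bold>\<equiv> x) 0 \<in> QST"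
| Q3: "(\<^bold>\<forall>x. \<^bold>\<forall>y. \<^bold>\<forall>z. x \<^bold>\<equiv> y \<^bold>\<and> y \<^bold>\<equiv> z \<^bold>\<longrightarrow> x \<^bold>\<equiv> z) 0 \<in> QST"
| Q4: "(\<^bold>\<forall>x. \<^bold>\<forall>y. x =\<^sub>E y \<^bold>\<longrightarrow> (inst A [x, x] \<^bold>\<longrightarrow> inst A [x, y])) 0 \<in> QST"
| Q5: "(\<^bold>\<forall>x. \<^bold>\<not> (m x \<^bold>\<and> M x)) 0 \<in> QST"
| Q6: "(\<^bold>\<forall>x. \<^bold>\<forall>y. x \<^bold>\<in> y \<^bold>\<longrightarrow> Q y) 0 \<in> QST"
| Q7: "(\<^bold>\<forall>x. Z x \<^bold>\<longrightarrow> Q x) 0 \<in> QST"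
| Q8: "(\<^bold>\<forall>\<^sub>Q x. (\<^bold>\<forall>y. y \<^bold>\<in> x \<^bold>\<longrightarrow> D y) \<^bold>\<longleftrightarrow> Z x) 0 \<in> QST"
| Q9a: "(\<^bold>\<forall>x. \<^bold>\<forall>y. m x \<^bold>\<and> x \<^bold>\<equiv> y \<^bold>\<longrightarrow> m y) 0 \<in> QST"
| Q9b: "(\<^bold>\<forall>x. \<^bold>\<forall>y. x =\<^sub>E y \<^bold>\<and> M x \<^bold>\<longrightarrow> M y) 0 \<in> QST"
| Q9c: "(\<^bold>\<forall>x. \<^bold>\<forall>y. x =\<^sub>E y \<^bold>\<and> Z x \<^bold>\<longrightarrow> Z y) 0 \<in> QST"
| Q10: "(\<^bold>\<exists>\<^sub>Q x. \<^bold>\<forall>y. \<^bold>\<not> y \<^bold>\<in> x) 0 \<in> QST"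
| Q11: "(\<^bold>\<forall>\<^sub>D x. \<^bold>\<forall>\<^sub>D y. x \<^bold>\<equiv> y \<^bold>\<longrightarrow> x =\<^sub>E y) 0 \<in> QST"
| Q12: "(\<^bold>\<forall>x. \<^bold>\<forall>y. \<^bold>\<exists>\<^sub>Q z. \<^bold>\<forall>t. t \<^bold>\<in> z \<^bold>\<longleftrightarrow> t \<^bold>\<equiv> x \<^bold>\<or> t \<^bold>\<equiv> y) 0 \<in> QST"
| Q13: "(\<^bold>\<forall>\<^sub>Q x. \<^bold>\<exists>\<^sub>Q y. \<^bold>\<forall>t. t \<^bold>\<in> y \<^bold>\<longleftrightarrow> t \<^bold>\<in> x \<^bold>\<and> inst A [t, x]) 0 \<in> QST"
| Q14: "(\<^bold>\<forall>\<^sub>Q x. E x \<^bold>\<longrightarrow> (\<^bold>\<exists>\<^sub>Q y. \<^bold>\<forall>z. z \<^bold>\<in> y \<^bold>\<longleftrightarrow> (\<^bold>\<exists>t. z \<^bold>\<in> t \<^bold>\<and> t \<^bold>\<in> x))) 0 \<in> QST"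
| Q15: "(\<^bold>\<forall>\<^sub>Q x. \<^bold>\<exists>y. powq y x) 0 \<in> QST"
| Q16: "(\<^bold>\<exists>\<^sub>Q x. (\<^bold>\<exists>e. emptyq e \<^bold>\<and> e \<^bold>\<in> x) \<^bold>\<and>
          (\<^bold>\<forall>y. y \<^bold>\<in> x \<^bold>\<and> Q y \<^bold>\<longrightarrow> (\<^bold>\<exists>s. \<^bold>\<exists>w. pairq s y y \<^bold>\<and> unq w y s \<^bold>\<and> w \<^bold>\<in> x))) 0 \<in> QST"
| Q17: "(\<^bold>\<forall>\<^sub>Q x. E x \<^bold>\<and> (\<^bold>\<exists>e. emptyq e \<^bold>\<and> x \<noteq>\<^sub>E e) \<^bold>\<longrightarrow>
          (\<^bold>\<exists>\<^sub>Q y. y \<^bold>\<in> x \<^bold>\<and> (\<^bold>\<exists>w. \<^bold>\<exists>e. interq w y x \<^bold>\<and> emptyq e \<^bold>\<and> w =\<^sub>E e))) 0 \<in> QST"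
| Q18: "(\<^bold>\<forall>x. \<^bold>\<not> Q x \<^bold>\<longrightarrow> (\<^bold>\<exists>n. inD1 emptyu n \<^bold>\<and> qc x =\<^sub>E n)) 0 \<in> QST"
| Q19a: "(\<^bold>\<forall>\<^sub>Q x. inD1 cardu (qc x)) 0 \<in> QST"
| Q19b: "(\<^bold>\<forall>\<^sub>Q x. Z x \<^bold>\<longrightarrow> (\<^bold>\<exists>k. inD2 cardofu x k \<^bold>\<and> qc x =\<^sub>E k)) 0 \<in> QST"
| Q20: "(\<^bold>\<forall>\<^sub>Q x. (\<^bold>\<exists>e. emptyq e \<^bold>\<and> x \<noteq>\<^sub>E e) \<^bold>\<longrightarrow> (\<^bold>\<exists>n. inD1 emptyu n \<^bold>\<and> qc x \<noteq>\<^sub>E n)) 0 \<in> QST"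
| Q21: "(\<^bold>\<forall>\<^sub>Q x. \<^bold>\<forall>b. inD1 cardu b \<^bold>\<and> inD2 leu b (qc x) \<^bold>\<longrightarrow>
          (\<^bold>\<exists>\<^sub>Q y. y \<^bold>\<subseteq> x \<^bold>\<and> qc y =\<^sub>E b)) 0 \<in> QST"
| Q22: "(\<^bold>\<forall>\<^sub>Q x. \<^bold>\<forall>\<^sub>Q y. y \<^bold>\<subseteq> x \<^bold>\<longrightarrow> inD2 leu (qc y) (qc x)) 0 \<in> QST"
| Q23: "(\<^bold>\<forall>\<^sub>Q x. \<^bold>\<forall>\<^sub>Q y. Fin x \<^bold>\<and> x \<^bold>\<subset> y \<^bold>\<longrightarrow> inD2 lessu (qc x) (qc y)) 0 \<in> QST"
| Q24: "(\<^bold>\<forall>\<^sub>Q x. \<^bold>\<forall>\<^sub>Q y. \<^bold>\<not> (\<^bold>\<exists>t. t \<^bold>\<in> x \<^bold>\<and> t \<^bold>\<in> y) \<^bold>\<longrightarrow>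
          (\<^bold>\<exists>w. \<^bold>\<exists>k. unq w x y \<^bold>\<and> inD3 addu (qc x) (qc y) k \<^bold>\<and> qc w =\<^sub>E k)) 0 \<in> QST"
| Q25: "(\<^bold>\<forall>\<^sub>Q x. \<^bold>\<exists>p. \<^bold>\<exists>k. powq p x \<^bold>\<and> inD2 pow2u (qc x) k \<^bold>\<and> qc p =\<^sub>E k) 0 \<in> QST"
| Q26: "(\<^bold>\<forall>\<^sub>Q x. \<^bold>\<forall>\<^sub>Q y.
          (\<^bold>\<exists>a. \<^bold>\<exists>b. quotq a x \<^bold>\<and> quotq b y \<^bold>\<and>
            (\<^bold>\<forall>z. z \<^bold>\<in> a \<^bold>\<longrightarrow> (\<^bold>\<exists>t. t \<^bold>\<in> b \<^bold>\<and> QSim z t)) \<^bold>\<and>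
            (\<^bold>\<forall>t. t \<^bold>\<in> b \<^bold>\<longrightarrow> (\<^bold>\<exists>z. z \<^bold>\<in> a \<^bold>\<and> QSim t z))) \<^bold>\<longrightarrow> x \<^bold>\<equiv> y) 0 \<in> QST"
| Q27: "((\<^bold>\<forall>x. \<^bold>\<exists>y. inst A [x, y]) \<^bold>\<and>
          (\<^bold>\<forall>x. \<^bold>\<forall>x'. \<^bold>\<forall>y. \<^bold>\<forall>y'. inst A [x, y] \<^bold>\<and> inst A [x', y'] \<^bold>\<and> x \<^bold>\<equiv> x' \<^bold>\<longrightarrow> y \<^bold>\<equiv> y') \<^bold>\<longrightarrow>
          (\<^bold>\<forall>\<^sub>Q u. \<^bold>\<exists>\<^sub>Q v. \<^bold>\<forall>z. z \<^bold>\<in> v \<^bold>\<longleftrightarrow> (\<^bold>\<exists>w. w \<^bold>\<in> u \<^bold>\<and> inst A [w, z]))) 0 \<in> QST"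
| Q28: "(\<^bold>\<forall>\<^sub>Q x. E x \<^bold>\<and>
          (\<^bold>\<forall>y. \<^bold>\<forall>z. y \<^bold>\<in> x \<^bold>\<and> z \<^bold>\<in> x \<^bold>\<longrightarrow>
            (\<^bold>\<exists>w. \<^bold>\<exists>e. interq w y z \<^bold>\<and> emptyq e \<^bold>\<and> w =\<^sub>E e) \<^bold>\<and> (\<^bold>\<exists>e. emptyq e \<^bold>\<and> y \<noteq>\<^sub>E e)) \<^bold>\<longrightarrow>
          (\<^bold>\<exists>\<^sub>Q u. \<^bold>\<forall>y. \<^bold>\<forall>v. y \<^bold>\<in> x \<^bold>\<and> v \<^bold>\<in> y \<^bold>\<longrightarrow>
            (\<^bold>\<exists>\<^sub>Q w. (\<^bold>\<exists>s. pairq s v v \<^bold>\<and> w \<^bold>\<subseteq> s) \<^bold>\<and> (\<^bold>\<exists>i. inD1 oneu i \<^bold>\<and> qc w =\<^sub>E i) \<^bold>\<and>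
              (\<^bold>\<exists>a. \<^bold>\<exists>b. interq a w y \<^bold>\<and> interq b w u \<^bold>\<and> a \<^bold>\<equiv> b)))) 0 \<in> QST"

end

theory Submission
  imports Defs "HOL-Library.Countable" "HOL-Library.Countable_Set"
begin

text \<open>
  The proof is semantic, by completeness of the calculus. A model of ZFU becomes a model of
  quasi-set theory without \<open>m\<close>-atoms: indistinguishability is equality and \<open>qc\<close> is the
  cardinality, which exists by the axiom of choice; there the translation \<open>tr\<close> does not change
  truth values. Conversely, in a model of quasi-set theory the objects satisfying \<open>D\<close>, modulo
  extensional identity, form a model of ZFU. There the axiom of choice follows from Q19, by which
  every set is equipollent to an ordinal, and not from Q28, which the union of the family
  satisfies trivially. Infinity is not the restriction of Q16 to \<open>D\<close>, since a qset may be
  indistinguishable from a set, but follows from the existence of an infinite quasi-cardinal.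
\<close>

section \<open>Soundness and completeness of the calculus\<close>

subsection \<open>Substitution\<close>

text \<open>Both directions rest on one development of ordinals and cardinals, stated for a class of
  definable predicates instead of formulas. Over a model of ZFU the class must absorb the schema
  instances that contain \<open>qc\<close>, so the cardinality operation has to be definable. Inside
  a model of quasi-set theory it contains every predicate of classical objects that is definable in
  the whole model, even one that quantifies over arbitrary qsets; the proof of infinity depends on
  this.

  Equality is not a logical symbol, so completeness gives models in which it is only a congruence.
  Structures have a whole type as domain, and the quotient is therefore renumbered by
  \<open>nat\<close>; Russell's argument provides the infinitely many classes that this takes.

  \<open>tr\<close> bounds quantifiers by \<open>D\<close> but leaves free variables unbounded: the
  translation of \<open>x = x\<close> fails for \<open>m\<close>-atoms. Provability is therefore
  compared through \<open>uclose A\<close>.\<close>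

abbreviation shift :: "nat \<Rightarrow> 't::fo_term" where
  "shift \<equiv> \<lambda>i. var (Suc i)"

lemma push_var: "push var = var"
  by (rule ext) (simp add: push_def tsubst_var split: nat.split)

lemma subst_var: "subst var A = A"
  by (induction A) (simp_all add: tsubst_id push_var)

lemma tsubst_push: "tsubst (push \<sigma>) (push \<tau> i) = push (\<lambda>n. tsubst \<sigma> (\<tau> n)) i"
  by (cases i) (simp_all add: push_def tsubst_var tsubst_comp)

lemma subst_subst: "subst \<sigma> (subst \<tau> A) = subst (\<lambda>n. tsubst \<sigma> (\<tau> n)) A"
  by (induction A arbitrary: \<sigma> \<tau>) (simp_all add: tsubst_comp tsubst_push)

lemma subst_case_nat_push:
  "subst (case_nat t var) (subst (push \<sigma>) A) = subst (case_nat t \<sigma>) A"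
proof -
  have "tsubst (case_nat t var) (push \<sigma> n) = case_nat t \<sigma> n" for n
    by (cases n) (simp_all add: push_def tsubst_var tsubst_comp tsubst_id)
  then show ?thesis by (simp add: subst_subst)
qed

text \<open>The bound on the free variables is expressed through substitution because terms are
  abstract here: \<open>tsubst_fin\<close> is all that the class says about the variables of a
  term.\<close>

definition closed_above :: "nat \<Rightarrow> ('t::fo_term, 'p, 'r) fm \<Rightarrow> bool" where
  "closed_above n A \<longleftrightarrow> (\<forall>\<sigma> \<tau>. (\<forall>i<n. \<sigma> i = \<tau> i) \<longrightarrow> subst \<sigma> A = subst \<tau> A)"

lemma closed_aboveD: "closed_above n A \<Longrightarrow> (\<And>i. i < n \<Longrightarrow> \<sigma> i = \<tau> i) \<Longrightarrow> subst \<sigma> A = subst \<tau> A"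
  unfolding closed_above_def by blast

lemma closed_above_mono: "closed_above n A \<Longrightarrow> n \<le> k \<Longrightarrow> closed_above k A"
  unfolding closed_above_def by (meson order_less_le_trans)

lemma closed_above_ex: "\<exists>n. closed_above n A"
proof (induction A)
  case (Pr1 p t)
  then show ?case using tsubst_fin[of t] by (auto simp: closed_above_def)
next
  case (Pr2 r s t)
  obtain n where n: "\<forall>\<sigma> \<tau>. (\<forall>i<n. \<sigma> i = \<tau> i) \<longrightarrow> tsubst \<sigma> s = tsubst \<tau> s"
    using tsubst_fin by blast
  obtain k where k: "\<forall>\<sigma> \<tau>. (\<forall>i<k. \<sigma> i = \<tau> i) \<longrightarrow> tsubst \<sigma> t = tsubst \<tau> t"
    using tsubst_fin by blast
  have "closed_above (max n k) (Pr2 r s t)"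
    unfolding closed_above_def
  proof (intro allI impI)
    fix \<sigma> \<tau> :: "nat \<Rightarrow> 'a"
    assume *: "\<forall>i<max n k. \<sigma> i = \<tau> i"
    have "tsubst \<sigma> s = tsubst \<tau> s" by (rule n[rule_format]) (use * in simp)
    moreover have "tsubst \<sigma> t = tsubst \<tau> t" by (rule k[rule_format]) (use * in simp)
    ultimately show "subst \<sigma> (Pr2 r s t) = subst \<tau> (Pr2 r s t)" by simp
  qed
  then show ?case by blast
next
  case (Neg A)
  then show ?case by (auto simp: closed_above_def)
next
  case (Or A B)
  then obtain n k where "closed_above n A" "closed_above k B" by blast
  then have "closed_above (max n k) A" "closed_above (max n k) B"
    by (auto elim: closed_above_mono)
  then have "closed_above (max n k) (Or A B)" by (simp add: closed_above_def)
  then show ?case by blast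
next
  case (All A)
  then obtain n where n: "closed_above n A" by blast
  have "closed_above n (All A)"
    unfolding closed_above_def
  proof (intro allI impI)
    fix \<sigma> \<tau> :: "nat \<Rightarrow> 'a"
    assume *: "\<forall>i<n. \<sigma> i = \<tau> i"
    have "subst (push \<sigma>) A = subst (push \<tau>) A"
      by (rule closed_aboveD[OF n]) (use * in \<open>simp add: push_def split: nat.split\<close>)
    then show "subst \<sigma> (All A) = subst \<tau> (All A)" by simp
  qed
  then show ?case by blast
qed

text \<open>One application of \<open>all_inst\<close> per quantifier. The induction hypothesis
  takes the outer \<open>n\<close> quantifiers, and the innermost one, which binds variable 0,
  receives \<open>\<sigma> 0\<close>.\<close>

lemma provable_Alls_inst:
  assumes "T \<turnstile> (All ^^ n) A"
  shows "T \<turnstile> subst (\<lambda>i. if i < n then \<sigma> i else var (i - n)) A"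
  using assms
proof (induction n arbitrary: A \<sigma>)
  case 0
  then show ?case by (simp add: subst_var)
next
  case (Suc n)
  let ?\<tau> = "\<lambda>i. if i < n then \<sigma> (Suc i) else var (i - n)"
  from Suc.prems have "T \<turnstile> (All ^^ n) (All A)" by (simp add: funpow_swap1)
  then have "T \<turnstile> subst ?\<tau> (All A)" by (rule Suc.IH)
  then have "T \<turnstile> All (subst (push ?\<tau>) A)" by simp
  then have "T \<turnstile> subst (case_nat (\<sigma> 0) var) (subst (push ?\<tau>) A)"
    using all_inst mp by blast
  then have "T \<turnstile> subst (case_nat (\<sigma> 0) ?\<tau>) A" by (simp add: subst_case_nat_push)
  moreover have "case_nat (\<sigma> 0) ?\<tau> = (\<lambda>i. if i < Suc n then \<sigma> i else var (i - Suc n))"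
    by (rule ext) (simp split: nat.split)
  ultimately show ?case by simp
qed

text \<open>Generalise until no variable is left free, then instantiate all of them at once. The
  bound \<open>n\<close> makes the tail \<open>var (i - n)\<close> of the instantiating substitution
  irrelevant.\<close>

lemma provable_subst:
  assumes "T \<turnstile> A"
  shows "T \<turnstile> subst \<sigma> A"
proof -
  obtain n where n: "closed_above n A" using closed_above_ex by blast
  have "T \<turnstile> (All ^^ n) A"
    using assms by (induction n) (auto intro: gen)
  then have "T \<turnstile> subst (\<lambda>i. if i < n then \<sigma> i else var (i - n)) A"
    by (rule provable_Alls_inst)
  moreover have "subst (\<lambda>i. if i < n then \<sigma> i else var (i - n)) A = subst \<sigma> A"
    by (rule closed_aboveD[OF n]) simp
  ultimately show ?thesis by simp
qed


subsection \<open>Semantics and soundness\<close>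

text \<open>A structure consists of an evaluation of terms and interpretations of the predicates; its
  domain is a whole type.\<close>

primrec sat :: "((nat \<Rightarrow> 'a) \<Rightarrow> 't \<Rightarrow> 'a) \<Rightarrow> ('p \<Rightarrow> 'a \<Rightarrow> bool) \<Rightarrow> ('r \<Rightarrow> 'a \<Rightarrow> 'a \<Rightarrow> bool) \<Rightarrow>
    (nat \<Rightarrow> 'a) \<Rightarrow> ('t, 'p, 'r) fm \<Rightarrow> bool" where
  "sat ev I J \<rho> (Pr1 p t) = I p (ev \<rho> t)"
| "sat ev I J \<rho> (Pr2 r s t) = J r (ev \<rho> s) (ev \<rho> t)"
| "sat ev I J \<rho> (Neg A) = (\<not> sat ev I J \<rho> A)"
| "sat ev I J \<rho> (Or A B) = (sat ev I J \<rho> A \<or> sat ev I J \<rho> B)"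
| "sat ev I J \<rho> (All A) = (\<forall>x. sat ev I J (case_nat x \<rho>) A)"

text \<open>These two laws hold for the recursive evaluation of terms and also for
  \<open>tsubst\<close> itself, which is the evaluation of the term model in
  \<open>completeness\<close>.\<close>

definition evaluation :: "((nat \<Rightarrow> 'a) \<Rightarrow> 't::fo_term \<Rightarrow> 'a) \<Rightarrow> bool" where
  "evaluation ev \<longleftrightarrow> (\<forall>\<rho> n. ev \<rho> (var n) = \<rho> n) \<and>
     (\<forall>\<rho> \<sigma> t. ev \<rho> (tsubst \<sigma> t) = ev (\<lambda>i. ev \<rho> (\<sigma> i)) t)"

lemma evaluation_var: "evaluation ev \<Longrightarrow> ev \<rho> (var n) = \<rho> n"
  and evaluation_tsubst: "evaluation ev \<Longrightarrow> ev \<rho> (tsubst \<sigma> t) = ev (\<lambda>i. ev \<rho> (\<sigma> i)) t"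
  by (simp_all add: evaluation_def)

lemma sat_subst:
  assumes "evaluation ev"
  shows "sat ev I J \<rho> (subst \<sigma> A) = sat ev I J (\<lambda>i. ev \<rho> (\<sigma> i)) A"
proof (induction A arbitrary: \<rho> \<sigma>)
  case (All A)
  have "(\<lambda>i. ev (case_nat x \<rho>) (push \<sigma> i)) = case_nat x (\<lambda>i. ev \<rho> (\<sigma> i))" for x
    by (rule ext)
      (simp add: push_def evaluation_var[OF assms] evaluation_tsubst[OF assms] split: nat.split)
  then show ?case by (simp add: All.IH)
qed (simp_all add: evaluation_tsubst[OF assms])

lemma soundness:
  assumes "T \<turnstile> A" and ev: "evaluation ev" and T: "\<And>B \<rho>. B \<in> T \<Longrightarrow> sat ev I J \<rho> B"
  shows "sat ev I J \<rho> A"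
  using assms(1)
proof (induction arbitrary: \<rho>)
  case (all_inst A t)
  have "(\<lambda>i. ev \<rho> (case_nat t var i)) = case_nat (ev \<rho> t) \<rho>"
    by (rule ext) (simp add: evaluation_var[OF ev] split: nat.split)
  then show ?case by (auto simp: sat_subst[OF ev])
next
  case (all_distr A B)
  show ?case by (auto simp: sat_subst[OF ev] evaluation_var[OF ev])
qed (auto simp: T)


subsection \<open>Propositional reasoning\<close>

lemma imp_trans: "T \<turnstile> Imp A B \<Longrightarrow> T \<turnstile> Imp B C \<Longrightarrow> T \<turnstile> Imp A C"
  using summ mp by blast

lemma imp_refl: "T \<turnstile> Imp A A"
  by (rule imp_trans[OF add taut])

lemma or_swap: "T \<turnstile> Or A B \<Longrightarrow> T \<turnstile> Or B A"
  by (rule mp[OF _ perm])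

lemma or_mono: "T \<turnstile> Imp B C \<Longrightarrow> T \<turnstile> Imp (Or A B) (Or A C)"
  by (rule mp[OF _ summ])

lemma or_elim: "T \<turnstile> Imp A C \<Longrightarrow> T \<turnstile> Imp B C \<Longrightarrow> T \<turnstile> Imp (Or A B) C"
  by (rule imp_trans[OF imp_trans[OF imp_trans[OF or_mono perm] or_mono] taut])

lemma add_right: "T \<turnstile> Imp B (Or A B)"
  by (rule imp_trans[OF add perm])

lemma not_not_intro: "T \<turnstile> Imp A (Neg (Neg A))"
  by (rule or_swap[OF imp_refl])

text \<open>\<open>Imp A B\<close> abbreviates a disjunction, so \<open>imp_refl\<close> is excluded
  middle; its negative disjunct is weakened to a triple negation.\<close>

lemma not_not_elim: "T \<turnstile> Imp (Neg (Neg A)) A"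
  by (rule or_swap[OF mp[OF _ or_mono[OF not_not_intro]]]) (rule or_swap[OF imp_refl])

lemma imp_distr: "T \<turnstile> Imp (Imp A (Imp B C)) (Imp (Imp A B) (Imp A C))"
  by (rule or_elim[OF imp_trans[OF add add_right] summ])

text \<open>Generalisation is confined to pure theorems by \<open>entails_provable\<close>, so the
  deduction theorem holds without conditions on variables.\<close>

inductive entails :: "('t::fo_term, 'p, 'r) fm set \<Rightarrow> ('t, 'p, 'r) fm set \<Rightarrow> ('t, 'p, 'r) fm \<Rightarrow> bool"
  for T G where
  hyp: "A \<in> G \<Longrightarrow> entails T G A"
| entails_provable: "T \<turnstile> A \<Longrightarrow> entails T G A"
| mp': "entails T G A \<Longrightarrow> entails T G (Imp A B) \<Longrightarrow> entails T G B"

lemma entails_mono: "entails T G A \<Longrightarrow> G \<subseteq> G' \<Longrightarrow> entails T G' A"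
  by (induction rule: entails.induct) (auto intro: entails.intros)

lemma entails_imp: "T \<turnstile> Imp A B \<Longrightarrow> entails T G A \<Longrightarrow> entails T G B"
  by (blast intro: entails_provable mp')

lemma deduction:
  assumes "entails T (insert B G) A"
  shows "entails T G (Imp B A)"
  using assms
proof (induction rule: entails.induct)
  case (hyp A)
  then show ?case by (auto intro: entails_imp[OF add_right] entails.hyp entails_provable imp_refl)
next
  case (entails_provable A)
  then show ?case by (blast intro: entails_imp[OF add_right] entails.entails_provable)
next
  case (mp' A C)
  then show ?case by (blast intro: entails_imp[OF imp_distr] entails.mp')
qed

lemma entails_compact:
  "entails T G A \<Longrightarrow> \<exists>F. finite F \<and> F \<subseteq> G \<and> entails T F A"
proof (induction rule: entails.induct)
  case (hyp A)
  then show ?case by (intro exI[of _ "{A}"]) (auto intro: entails.hyp)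
next
  case (entails_provable A)
  then show ?case by (intro exI[of _ "{}"]) (auto intro: entails.entails_provable)
next
  case (mp' A B)
  then obtain F F' where "finite F" "F \<subseteq> G" "entails T F A"
    "finite F'" "F' \<subseteq> G" "entails T F' (Imp A B)" by blast
  then have "finite (F \<union> F') \<and> F \<union> F' \<subseteq> G \<and> entails T (F \<union> F') B"
    by (blast intro: entails.mp' entails_mono)
  then show ?case by blast
qed

definition consistent :: "('t::fo_term, 'p, 'r) fm set \<Rightarrow> ('t, 'p, 'r) fm set \<Rightarrow> bool" where
  "consistent T G \<longleftrightarrow> (\<exists>A. \<not> entails T G A)"

lemma consistent_mono: "consistent T G' \<Longrightarrow> G \<subseteq> G' \<Longrightarrow> consistent T G"
  unfolding consistent_def using entails_mono by blast

lemma consistent_not_both: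
  "consistent T G \<Longrightarrow> entails T G A \<Longrightarrow> \<not> entails T G (Neg A)"
  unfolding consistent_def using entails_imp[OF add] mp' by blast

text \<open>From \<open>B\<close> even \<open>Neg B\<close> is derivable, and
  \<open>Imp B (Neg B)\<close> is literally the disjunction of \<open>Neg B\<close> with
  itself.\<close>

lemma inconsistent_insert: "\<not> consistent T (insert B G) \<Longrightarrow> entails T G (Neg B)"
  unfolding consistent_def using deduction entails_imp[OF taut] by blast

lemma inconsistent_insert_Neg: "\<not> consistent T (insert (Neg B) G) \<Longrightarrow> entails T G B"
  unfolding consistent_def
  using deduction entails_imp[OF or_elim[OF not_not_elim imp_refl]] by blast


subsection \<open>Maximal consistent sets with witnesses\<close>

text \<open>Writing finitely many hypotheses as one formula makes \<open>provable_subst\<close> and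
  \<open>gen\<close>, which concern theorems only, applicable to entailments. The head of the list
  becomes the innermost premise, so that one use of \<open>deduction\<close> discharges it.\<close>

primrec imps :: "('t, 'p, 'r) fm list \<Rightarrow> ('t, 'p, 'r) fm \<Rightarrow> ('t, 'p, 'r) fm" where
  "imps [] A = A"
| "imps (B # Bs) A = imps Bs (Imp B A)"

lemma entails_imps: "entails T (set Bs) A \<Longrightarrow> T \<turnstile> imps Bs A"
proof (induction Bs arbitrary: A)
  case Nil
  then have "entails T {} A" by simp
  then have "T \<turnstile> A" by (induction rule: entails.induct) (auto intro: mp)
  then show ?case by simp
next
  case (Cons B Bs)
  then show ?case by (simp add: deduction)
qed

lemma imps_entails: "T \<turnstile> imps Bs A \<Longrightarrow> entails T (set Bs) A"
proof (induction Bs arbitrary: A)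
  case Nil
  then show ?case by (simp add: entails_provable)
next
  case (Cons B Bs)
  then have "entails T (set Bs) (Imp B A)" by simp
  then have "entails T (set (B # Bs)) (Imp B A)" by (auto intro: entails_mono)
  then show ?case by (auto intro: mp' hyp)
qed

lemma subst_imps: "subst \<sigma> (imps Bs A) = imps (map (subst \<sigma>) Bs) (subst \<sigma> A)"
  by (induction Bs arbitrary: A) simp_all

text \<open>By \<open>all_distr\<close> the quantifier moves inward past the premises, the one
  nearest to \<open>A\<close> last. The shift is the form in which that axiom expects a premise
  without the bound variable.\<close>

lemma gen_imps: "T \<turnstile> imps (map (subst shift) Bs) A \<Longrightarrow> T \<turnstile> imps Bs (All A)"
proof (induction Bs arbitrary: A)
  case Nil
  then show ?case by (simp add: gen)
next
  case (Cons B Bs)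
  then have "T \<turnstile> imps Bs (All (Imp (subst shift B) A))" by simp
  then have "entails T (set Bs) (All (Imp (subst shift B) A))" by (rule imps_entails)
  then have "entails T (set Bs) (Imp B (All A))" by (rule entails_imp[OF all_distr])
  then show ?case by (simp add: entails_imps)
qed

text \<open>A variable that is free in none of the finitely many formulas serves as Henkin constant.
  If its instance were derivable, renaming it to the bound variable would give a derivation of
  \<open>B\<close>, hence of \<open>All B\<close>, from the same hypotheses.\<close>

lemma witness_ex:
  assumes con: "consistent T (insert (Neg (All B)) (set Bs))"
  shows "\<exists>y. consistent T
    (insert (Neg (subst (case_nat (var y) var) B)) (insert (Neg (All B)) (set Bs)))"
proof -
  let ?Bs = "Neg (All B) # Bs"
  have "\<exists>n. \<forall>A \<in> set As. closed_above n A" for As :: "('a, 'b, 'c) fm list"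
  proof (induction As)
    case (Cons A As)
    obtain n where n: "closed_above n A" using closed_above_ex by blast
    obtain k where k: "\<forall>A \<in> set As. closed_above k A" using Cons by blast
    have "\<forall>B \<in> set (A # As). closed_above (max n k) B"
      using n k by (auto intro: closed_above_mono[where k = "max n k"])
    then show ?case by blast
  qed simp
  from this[of "B # ?Bs"] obtain y where y: "\<And>A. A \<in> set (B # ?Bs) \<Longrightarrow> closed_above y A"
    by blast
  let ?W = "subst (case_nat (var y) var) B"
  \<comment> \<open>This undoes the instantiation: \<open>y\<close> becomes the variable to be bound
    by \<open>All\<close>, and the other variables make room for it.\<close>
  let ?\<sigma> = "\<lambda>i. if i = y then var 0 else shift i"
  have "consistent T (insert (Neg ?W) (set ?Bs))"
  proof (rule ccontr)
    assume "\<not> consistent T (insert (Neg ?W) (set ?Bs))"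
    then have "T \<turnstile> imps ?Bs ?W" by (rule entails_imps[OF inconsistent_insert_Neg])
    then have "T \<turnstile> subst ?\<sigma> (imps ?Bs ?W)" by (rule provable_subst)
    then have "T \<turnstile> imps (map (subst ?\<sigma>) ?Bs) (subst ?\<sigma> ?W)" by (simp only: subst_imps)
    moreover have "map (subst ?\<sigma>) ?Bs = map (subst shift) ?Bs"
      by (rule map_cong[OF refl], rule closed_aboveD[OF y]) auto
    moreover have "subst ?\<sigma> ?W = B"
    proof -
      have "subst ?\<sigma> ?W = subst (\<lambda>n. tsubst ?\<sigma> (case_nat (var y) var n)) B"
        by (rule subst_subst)
      also have "\<dots> = subst var B"
        by (rule closed_aboveD[OF y]) (auto simp: tsubst_var split: nat.split)
      finally show ?thesis by (simp add: subst_var)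
    qed
    ultimately have "T \<turnstile> imps (map (subst shift) ?Bs) B" by (simp only:)
    then have "entails T (set ?Bs) (All B)" by (rule imps_entails[OF gen_imps])
    moreover have "entails T (set ?Bs) (Neg (All B))" by (rule hyp) simp
    moreover have "consistent T (set ?Bs)" using con by simp
    ultimately show False using consistent_not_both by blast
  qed
  then show ?thesis by (simp only: list.set) blast
qed

section \<open>The Lindenbaum chain and the term model\<close>

definition extend :: "('t::fo_term, 'p, 'r) fm set \<Rightarrow> ('t, 'p, 'r) fm list \<Rightarrow> ('t, 'p, 'r) fm \<Rightarrow>
    ('t, 'p, 'r) fm list" where
  "extend T Bs A = (SOME Cs. consistent T (set Cs) \<and> set Bs \<subseteq> set Cs \<and>
     (consistent T (insert A (set Bs)) \<longrightarrow> A \<in> set Cs \<and>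
       (\<forall>B. A = Neg (All B) \<longrightarrow> (\<exists>y. Neg (subst (case_nat (var y) var) B) \<in> set Cs))))"

lemma extend:
  assumes "consistent T (set Bs)"
  shows "consistent T (set (extend T Bs A))" "set Bs \<subseteq> set (extend T Bs A)"
    "consistent T (insert A (set Bs)) \<Longrightarrow> A \<in> set (extend T Bs A)"
    "consistent T (insert (Neg (All B)) (set Bs)) \<Longrightarrow>
      \<exists>y. Neg (subst (case_nat (var y) var) B) \<in> set (extend T Bs (Neg (All B)))"
proof -
  have *: "\<exists>Cs. consistent T (set Cs) \<and> set Bs \<subseteq> set Cs \<and>
     (consistent T (insert A (set Bs)) \<longrightarrow> A \<in> set Cs \<and>
       (\<forall>B. A = Neg (All B) \<longrightarrow> (\<exists>y. Neg (subst (case_nat (var y) var) B) \<in> set Cs)))" for A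
  proof (cases "consistent T (insert A (set Bs))")
    case True
    show ?thesis
    proof (cases "\<exists>B. A = Neg (All B)")
      case True': True
      then obtain B where B: "A = Neg (All B)" by blast
      then obtain y where
        "consistent T (insert (Neg (subst (case_nat (var y) var) B)) (insert A (set Bs)))"
        using True witness_ex by blast
      then show ?thesis
        using B by (intro exI[of _ "Neg (subst (case_nat (var y) var) B) # A # Bs"]) auto
    next
      case False
      then show ?thesis using True by (intro exI[of _ "A # Bs"]) auto
    qed
  next
    case False
    then show ?thesis using assms by blast
  qed
  note ** = someI_ex[OF *, folded extend_def]
  show "consistent T (set (extend T Bs A))" "set Bs \<subseteq> set (extend T Bs A)"
    "consistent T (insert A (set Bs)) \<Longrightarrow> A \<in> set (extend T Bs A)"
    using **[of A] by blast+
  show "consistent T (insert (Neg (All B)) (set Bs)) \<Longrightarrow>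
      \<exists>y. Neg (subst (case_nat (var y) var) B) \<in> set (extend T Bs (Neg (All B)))"
    using **[of "Neg (All B)"] by blast
qed

instance fm :: (countable, countable, countable) countable
  by countable_datatype

text \<open>The stages are finite lists, so a fresh variable for the next witness always exists and
  no constants have to be added to the language. The formula \<open>B\<close> has its turn after
  stage \<open>to_nat B\<close>.\<close>

primrec chain :: "('t::{fo_term, countable}, 'p::countable, 'r::countable) fm set \<Rightarrow>
    ('t, 'p, 'r) fm \<Rightarrow> nat \<Rightarrow> ('t, 'p, 'r) fm list" where
  "chain T A 0 = [A]"
| "chain T A (Suc n) = extend T (chain T A n) (from_nat n)"

text \<open>\<open>H\<close> is the union of the chain. Derivations are finite, so its consistency
  reduces to that of the stages, and a formula consistent with all of \<open>H\<close> was
  consistent with the stage at which its turn came.\<close>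

lemma henkin_ex:
  fixes A :: "('t::{fo_term, countable}, 'p::countable, 'r::countable) fm"
  assumes "consistent T {A}"
  obtains H where "A \<in> H" "consistent T H" "\<And>B. Neg B \<in> H \<longleftrightarrow> B \<notin> H"
    "\<And>B. entails T H B \<Longrightarrow> B \<in> H"
    "\<And>B. Neg (All B) \<in> H \<Longrightarrow> \<exists>y. Neg (subst (case_nat (var y) var) B) \<in> H"
proof -
  let ?C = "chain T A"
  let ?H = "\<Union>n. set (?C n)"
  have con: "consistent T (set (?C n))" for n
  proof (induction n)
    case (Suc n)
    then show ?case by (simp add: extend(1))
  qed (simp add: assms)
  have step: "set (?C n) \<subseteq> set (?C (Suc n))" for n
    using extend(2)[OF con] by simp
  have mono: "set (?C n) \<subseteq> set (?C k)" if "n \<le> k" for n k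
    using that by (rule lift_Suc_mono_le[where f = "\<lambda>n. set (?C n)", OF step])
  have fin: "\<exists>n. F \<subseteq> set (?C n)" if "finite F" "F \<subseteq> ?H" for F
    using that
  proof (induction F)
    case (insert B F)
    then obtain n k where "F \<subseteq> set (?C n)" "B \<in> set (?C k)" by auto
    then have "insert B F \<subseteq> set (?C (max n k))" using mono[of n "max n k"] mono[of k "max n k"] by auto
    then show ?case by blast
  qed simp
  have ent: "\<exists>n. entails T (set (?C n)) B" if e: "entails T ?H B" for B
  proof -
    obtain F where "finite F" "F \<subseteq> ?H" and F: "entails T F B"
      using entails_compact[OF e] by blast
    then obtain n where "F \<subseteq> set (?C n)" using fin by blast
    then show ?thesis using entails_mono[OF F] by blast
  qed
  have conH: "consistent T ?H"
  proof (rule ccontr)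
    assume "\<not> consistent T ?H"
    then have all: "entails T ?H B" for B unfolding consistent_def by simp
    obtain n where n: "entails T (set (?C n)) A" using ent[OF all] by blast
    obtain k where k: "entails T (set (?C k)) (Neg A)" using ent[OF all] by blast
    have "entails T (set (?C (max n k))) A" by (rule entails_mono[OF n mono]) simp
    moreover have "entails T (set (?C (max n k))) (Neg A)" by (rule entails_mono[OF k mono]) simp
    ultimately show False using consistent_not_both[OF con] by simp
  qed
  have max: "B \<in> ?H" if "consistent T (insert B ?H)" for B
  proof -
    have "consistent T (insert B (set (?C (to_nat B))))"
      using that by (rule consistent_mono) auto
    then have "B \<in> set (?C (Suc (to_nat B)))" using extend(3)[OF con] by simp
    then show ?thesis by blast
  qed
  have closed: "B \<in> ?H" if "entails T ?H B" for B
  proof (rule max, rule ccontr)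
    assume "\<not> consistent T (insert B ?H)"
    then have "entails T ?H (Neg B)" by (rule inconsistent_insert)
    then show False using consistent_not_both[OF conH that] by (elim notE)
  qed
  show thesis
  proof (rule that[of ?H])
    show "A \<in> ?H" by (rule UN_I[of 0]) simp_all
    show "consistent T ?H" by (rule conH)
    show "B \<in> ?H" if "entails T ?H B" for B using that by (rule closed)
    show "Neg B \<in> ?H \<longleftrightarrow> B \<notin> ?H" for B
    proof
      assume "Neg B \<in> ?H"
      then have *: "entails T ?H (Neg B)" by (rule hyp)
      show "B \<notin> ?H"
      proof
        assume "B \<in> ?H"
        then have "entails T ?H B" by (rule hyp)
        then show False using * consistent_not_both[OF conH, of B] by blast
      qed
    next
      assume "B \<notin> ?H"
      then have "\<not> consistent T (insert B ?H)" using max by (rule contrapos_nn)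
      then show "Neg B \<in> ?H" by (rule closed[OF inconsistent_insert])
    qed
    show "\<exists>y. Neg (subst (case_nat (var y) var) B) \<in> ?H" if "Neg (All B) \<in> ?H" for B
    proof -
      let ?n = "to_nat (Neg (All B))"
      have "consistent T (insert (Neg (All B)) (set (?C ?n)))"
        using conH by (rule consistent_mono) (use that in auto)
      then have "\<exists>y. Neg (subst (case_nat (var y) var) B) \<in> set (?C (Suc ?n))"
        using extend(4)[OF con] by simp
      then show ?thesis by blast
    qed
  qed
qed

text \<open>The domain consists of the terms, evaluated by substitution, so valuations are
  substitutions and the truth lemma covers all of them. An axiom holds under every valuation because
  theorems are closed under substitution; \<open>A\<close> fails under the valuation
  \<open>var\<close>.\<close>

theorem completeness:
  fixes A :: "('t::{fo_term, countable}, 'p::countable, 'r::countable) fm"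
  assumes "\<not> T \<turnstile> A"
  obtains I J \<rho> where "\<And>B \<rho>. B \<in> T \<Longrightarrow> sat tsubst I J \<rho> B" "\<not> sat tsubst I J \<rho> A"
proof -
  have "consistent T {Neg A}"
  proof (rule ccontr)
    assume "\<not> consistent T {Neg A}"
    then have "entails T {} A" by (rule inconsistent_insert_Neg)
    then have "T \<turnstile> imps [] A" by (intro entails_imps) simp
    then show False using assms by simp
  qed
  then obtain H where A: "Neg A \<in> H" and con: "consistent T H"
    and Neg: "\<And>B. Neg B \<in> H \<longleftrightarrow> B \<notin> H" and closed: "\<And>B. entails T H B \<Longrightarrow> B \<in> H"
    and wit: "\<And>B. Neg (All B) \<in> H \<Longrightarrow> \<exists>y. Neg (subst (case_nat (var y) var) B) \<in> H"
    by (rule henkin_ex) blast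
  define I where "I = (\<lambda>p t. Pr1 p t \<in> H)"
  define J where "J = (\<lambda>r s t. Pr2 r s t \<in> H)"
  have Or: "Or B C \<in> H \<longleftrightarrow> B \<in> H \<or> C \<in> H" for B C
  proof
    assume *: "Or B C \<in> H"
    show "B \<in> H \<or> C \<in> H"
    proof (rule ccontr)
      assume "\<not> (B \<in> H \<or> C \<in> H)"
      then have "Neg B \<in> H" "Neg C \<in> H" by (simp_all add: Neg)
      then have "entails T H (Imp B C)" by (intro entails_imp[OF add] hyp)
      then have "entails T H (Imp (Or C B) (Or C C))" by (rule entails_imp[OF summ])
      with entails_imp[OF perm hyp[OF *]] have "entails T H (Or C C)" by (rule mp')
      then have "entails T H C" by (rule entails_imp[OF taut])
      moreover have "entails T H (Neg C)" using \<open>Neg C \<in> H\<close> by (rule hyp)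
      ultimately show False using consistent_not_both[OF con] by simp
    qed
  next
    assume "B \<in> H \<or> C \<in> H"
    then show "Or B C \<in> H"
      by (elim disjE) (rule closed, rule entails_imp[OF add] entails_imp[OF add_right], erule hyp)+
  qed
  have All: "All B \<in> H \<longleftrightarrow> (\<forall>t. subst (case_nat t var) B \<in> H)" for B
  proof
    assume "All B \<in> H"
    then show "\<forall>t. subst (case_nat t var) B \<in> H"
      by (intro allI closed[OF entails_imp[OF all_inst hyp]])
  next
    assume "\<forall>t. subst (case_nat t var) B \<in> H"
    then show "All B \<in> H" using wit[of B] by (auto simp: Neg)
  qed
  have truth: "sat tsubst I J \<sigma> B \<longleftrightarrow> subst \<sigma> B \<in> H" for \<sigma> B
    by (induction B arbitrary: \<sigma>) (simp_all add: I_def J_def Neg Or All subst_case_nat_push)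
  show thesis
  proof
    show "sat tsubst I J \<rho> B" if "B \<in> T" for B \<rho>
      unfolding truth using that by (intro closed entails_provable provable_subst ax)
    show "\<not> sat tsubst I J var A"
      using A Neg by (simp add: truth subst_var)
  qed
qed

section \<open>Set theory in a structure with a class of definable predicates\<close>

subsection \<open>Definability\<close>

text \<open>
  \<open>dp F\<close> says that the predicate \<open>F\<close> on valuations is definable with parameters. A function
  \<open>t\<close> of valuations is definable, \<open>dt t\<close>, if its graph is, the value being variable \<open>0\<close>.
\<close>

named_theorems dpI

lemma case_nat_shift: "case_nat (\<rho> 0) (\<lambda>n. \<rho> (Suc n)) = \<rho>"
  by (rule ext) (simp split: nat.split)

locale definable_preds =
  fixes dp :: "((nat \<Rightarrow> 'a) \<Rightarrow> bool) \<Rightarrow> bool"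
  assumes dp_true: "dp (\<lambda>_. True)"
    and dp_not [dpI]: "dp F \<Longrightarrow> dp (\<lambda>\<rho>. \<not> F \<rho>)"
    and dp_or [dpI]: "dp F \<Longrightarrow> dp G \<Longrightarrow> dp (\<lambda>\<rho>. F \<rho> \<or> G \<rho>)"
    and dp_all [dpI]: "dp (\<lambda>\<rho>. H (\<lambda>n. \<rho> (Suc n)) (\<rho> 0)) \<Longrightarrow> dp (\<lambda>\<rho>. \<forall>x. H \<rho> x)"
    and dp_rename: "dp F \<Longrightarrow> dp (\<lambda>\<rho>. F (\<lambda>n. \<rho> (r n)))"
    and dp_param: "dp F \<Longrightarrow> dp (\<lambda>\<rho>. F (case_nat c \<rho>))"
begin

lemma dp_const [dpI]: "dp (\<lambda>_. P)"
  using dp_true dp_not[OF dp_true] by (cases P) simp_all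

lemma dp_and [dpI]: "dp F \<Longrightarrow> dp G \<Longrightarrow> dp (\<lambda>\<rho>. F \<rho> \<and> G \<rho>)"
proof -
  assume "dp F" "dp G"
  then have "dp (\<lambda>\<rho>. \<not> (\<not> F \<rho> \<or> \<not> G \<rho>))" by (intro dp_not dp_or)
  then show ?thesis by simp
qed

lemma dp_imp [dpI]: "dp F \<Longrightarrow> dp G \<Longrightarrow> dp (\<lambda>\<rho>. F \<rho> \<longrightarrow> G \<rho>)"
  unfolding imp_conv_disj by (intro dp_not dp_or)

lemma dp_iff [dpI]: "dp F \<Longrightarrow> dp G \<Longrightarrow> dp (\<lambda>\<rho>. F \<rho> \<longleftrightarrow> G \<rho>)"
  unfolding iff_conv_conj_imp by (intro dp_and dp_imp)

lemma dp_ex [dpI]: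
  assumes "dp (\<lambda>\<rho>. H (\<lambda>n. \<rho> (Suc n)) (\<rho> 0))"
  shows "dp (\<lambda>\<rho>. \<exists>x. H \<rho> x)"
proof -
  have "dp (\<lambda>\<rho>. \<not> (\<forall>x. \<not> H \<rho> x))" by (intro dp_not dp_all assms)
  then show ?thesis by simp
qed

end

text \<open>Split off because equality of objects need not be definable in a model of quasi-set
  theory. There only \<open>definable_preds\<close> is available, and this locale applies to the
  classical objects modulo extensional identity.\<close>

locale definability = definable_preds dp for dp :: "((nat \<Rightarrow> 'a) \<Rightarrow> bool) \<Rightarrow> bool" +
  assumes dp_eq_var: "dp (\<lambda>\<rho>. \<rho> i = \<rho> j)"
begin

definition dt :: "((nat \<Rightarrow> 'a) \<Rightarrow> 'a) \<Rightarrow> bool" where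
  "dt t \<longleftrightarrow> dp (\<lambda>\<rho>. \<rho> 0 = t (\<lambda>n. \<rho> (Suc n)))"

definition dfun :: "('a \<Rightarrow> 'a) \<Rightarrow> bool" where
  "dfun g \<longleftrightarrow> dt (\<lambda>\<rho>. g (\<rho> 0))"

lemma dt_var [dpI]: "dt (\<lambda>\<rho>. \<rho> k)"
  unfolding dt_def by (rule dp_eq_var)

lemma dt_const [dpI]: "dt (\<lambda>_. c)"
  using dp_param[OF dp_eq_var[of 1 0], of c] by (simp add: dt_def)

lemma dt_shift: "dt t \<Longrightarrow> dt (\<lambda>\<rho>. t (\<lambda>n. \<rho> (Suc n)))"
  using dp_rename[of "\<lambda>\<rho>. \<rho> 0 = t (\<lambda>n. \<rho> (Suc n))" "case_nat 0 (\<lambda>n. Suc (Suc n))"]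
  by (simp add: dt_def)

lemma dt_case_nat:
  "dt s \<Longrightarrow> (\<And>j. dt (\<lambda>\<rho>. t \<rho> j)) \<Longrightarrow> dt (\<lambda>\<rho>. case_nat (s \<rho>) (t \<rho>) i)"
  by (cases i) simp_all

lemma dp_subst:
  assumes "dp F" "dt t"
  shows "dp (\<lambda>\<rho>. F (case_nat (t \<rho>) \<rho>))"
proof -
  have "dp (\<lambda>\<rho>. \<exists>x. x = t \<rho> \<and> F (case_nat x \<rho>))"
    by (intro dp_ex dp_and) (use assms in \<open>simp_all add: dt_def case_nat_shift\<close>)
  then show ?thesis by simp
qed

lemma dp_comp1:
  assumes "dp (\<lambda>\<rho>. R (\<rho> 0))" "dt t"
  shows "dp (\<lambda>\<rho>. R (t \<rho>))"
  using dp_subst[OF assms] by simp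

text \<open>\<open>dp_subst\<close> fills variable 0 only, so the arguments are filled one at a
  time, after a renaming that brings the place of each to variable 0.\<close>

lemma dp_comp2:
  assumes "dp (\<lambda>\<rho>. R (\<rho> 0) (\<rho> (Suc 0)))" "dt t" "dt s"
  shows "dp (\<lambda>\<rho>. R (t \<rho>) (s \<rho>))"
proof -
  have "dp (\<lambda>\<rho>. R (\<rho> (Suc 0)) (\<rho> 0))"
    using dp_rename[OF assms(1), of "\<lambda>n. if n = 0 then Suc 0 else 0"] by simp
  then have "dp (\<lambda>\<rho>. R (\<rho> 0) (s (\<lambda>n. \<rho> (Suc n))))"
    using dp_subst[OF _ dt_shift[OF assms(3)]] by fastforce
  from dp_subst[OF this assms(2)] show ?thesis by simp
qed

lemma dp_comp3:
  assumes "dp (\<lambda>\<rho>. R (\<rho> 0) (\<rho> (Suc 0)) (\<rho> (Suc (Suc 0))))" "dt t" "dt s" "dt u"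
  shows "dp (\<lambda>\<rho>. R (t \<rho>) (s \<rho>) (u \<rho>))"
proof -
  have "dp (\<lambda>\<rho>. R (\<rho> (Suc 0)) (\<rho> (Suc (Suc 0))) (\<rho> 0))"
    using dp_rename[OF assms(1), of "\<lambda>n. if n = 0 then Suc 0 else if n = Suc 0 then Suc (Suc 0) else 0"]
    by simp
  from dp_subst[OF this dt_shift[OF dt_shift[OF assms(4)]]]
  have "dp (\<lambda>\<rho>. R (\<rho> 0) (\<rho> (Suc 0)) (u (\<lambda>n. \<rho> (Suc (Suc n)))))" by simp
  from dp_rename[OF this, of "\<lambda>n. if n = 0 then Suc 0 else if n = Suc 0 then 0 else n"]
  have "dp (\<lambda>\<rho>. R (\<rho> (Suc 0)) (\<rho> 0) (u (\<lambda>n. \<rho> (Suc (Suc n)))))" by simp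
  from dp_subst[OF this dt_shift[OF assms(3)]]
  have "dp (\<lambda>\<rho>. R (\<rho> 0) (s (\<lambda>n. \<rho> (Suc n))) (u (\<lambda>n. \<rho> (Suc n))))" by simp
  from dp_subst[OF this assms(2)] show ?thesis by simp
qed

lemma dp_eq [dpI]: "dt s \<Longrightarrow> dt t \<Longrightarrow> dp (\<lambda>\<rho>. s \<rho> = t \<rho>)"
  by (rule dp_comp2[OF dp_eq_var[of 0 "Suc 0"]])

lemma dt_comp1: "dt (\<lambda>\<rho>. g (\<rho> 0)) \<Longrightarrow> dt t \<Longrightarrow> dt (\<lambda>\<rho>. g (t \<rho>))"
  unfolding dt_def[of "\<lambda>\<rho>. g (_ \<rho>)"]
  by (rule dp_comp2[where R = "\<lambda>z x. z = g x"], simp add: dt_def) (rule dt_var, erule dt_shift)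

lemma dt_comp2:
  "dt (\<lambda>\<rho>. g (\<rho> 0) (\<rho> (Suc 0))) \<Longrightarrow> dt t \<Longrightarrow> dt s \<Longrightarrow> dt (\<lambda>\<rho>. g (t \<rho>) (s \<rho>))"
  unfolding dt_def[of "\<lambda>\<rho>. g (_ \<rho>) (_ \<rho>)"]
  by (rule dp_comp3[where R = "\<lambda>z x y. z = g x y"], simp add: dt_def)
    (rule dt_var, erule dt_shift, erule dt_shift)

lemma dfun_dt: "dfun g \<Longrightarrow> dt t \<Longrightarrow> dt (\<lambda>\<rho>. g (t \<rho>))"
  unfolding dfun_def by (rule dt_comp1)

lemma dt_if [dpI]:
  assumes "dp P" "dt s" "dt t"
  shows "dt (\<lambda>\<rho>. if P \<rho> then s \<rho> else t \<rho>)"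
proof -
  have "dp (\<lambda>\<rho>. P (\<lambda>n. \<rho> (Suc n)) \<and> \<rho> 0 = s (\<lambda>n. \<rho> (Suc n)) \<or>
      \<not> P (\<lambda>n. \<rho> (Suc n)) \<and> \<rho> 0 = t (\<lambda>n. \<rho> (Suc n)))"
    using assms by (intro dp_or dp_and dp_not dp_rename[of P Suc]) (simp_all add: dt_def)
  moreover have "(\<lambda>\<rho>. P (\<lambda>n. \<rho> (Suc n)) \<and> \<rho> 0 = s (\<lambda>n. \<rho> (Suc n)) \<or>
      \<not> P (\<lambda>n. \<rho> (Suc n)) \<and> \<rho> 0 = t (\<lambda>n. \<rho> (Suc n))) =
    (\<lambda>\<rho>. \<rho> 0 = (if P (\<lambda>n. \<rho> (Suc n)) then s (\<lambda>n. \<rho> (Suc n)) else t (\<lambda>n. \<rho> (Suc n))))"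
    by (rule ext) simp
  ultimately show ?thesis by (simp add: dt_def)
qed

text \<open>A definite description with a fixed value when it does not denote, so that it is always
  definable.\<close>

definition the_only :: "('a \<Rightarrow> bool) \<Rightarrow> 'a" where
  "the_only P = (if \<exists>z. \<forall>x. P x \<longleftrightarrow> x = z then THE x. P x else undefined)"

lemma the_only: "P z \<Longrightarrow> (\<And>x. P x \<Longrightarrow> x = z) \<Longrightarrow> the_only P = z"
proof -
  assume "P z" "\<And>x. P x \<Longrightarrow> x = z"
  then have "\<And>x. P x \<longleftrightarrow> x = z" by blast
  then show ?thesis by (auto simp: the_only_def)
qed

text \<open>The graph of the description in first-order terms; \<open>undefined\<close> is an
  admissible parameter by \<open>dt_const\<close>.\<close>

lemma eq_the_only:
  "x = the_only P \<longleftrightarrow> (\<forall>y. P y \<longleftrightarrow> y = x) \<or> \<not> (\<exists>z. \<forall>y. P y \<longleftrightarrow> y = z) \<and> x = undefined"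
proof (cases "\<exists>z. \<forall>y. P y \<longleftrightarrow> y = z")
  case True
  then obtain z where "\<And>y. P y \<longleftrightarrow> y = z" by blast
  then show ?thesis by (auto simp: the_only_def)
next
  case False
  then show ?thesis by (auto simp: the_only_def)
qed

lemma dt_the_only [dpI]:
  assumes "dp (\<lambda>\<rho>. H (\<lambda>n. \<rho> (Suc n)) (\<rho> 0))"
  shows "dt (\<lambda>\<rho>. the_only (H \<rho>))"
proof -
  have 1: "dp (\<lambda>\<rho>. H (\<lambda>n. \<rho> (Suc (Suc n))) (\<rho> 0))"
    using dp_rename[OF assms, of "case_nat 0 (\<lambda>n. Suc (Suc n))"] by simp
  have 2: "dp (\<lambda>\<rho>. H (\<lambda>n. \<rho> (Suc (Suc (Suc n)))) (\<rho> 0))"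
    using dp_rename[OF assms, of "case_nat 0 (\<lambda>n. Suc (Suc (Suc n)))"] by simp
  show ?thesis
    unfolding dt_def eq_the_only
    by (intro dp_or dp_and dp_all dp_not dp_ex dp_iff 1 2 dp_eq dt_var dt_const)
qed

end


subsection \<open>Axioms without infinity and choice\<close>

text \<open>Choice and infinity are left out because inside a model of quasi-set theory both are
  derived from the theory of ordinals, which is developed in this locale. Equality is the genuine
  one, so the locale describes normal models.\<close>

locale zfu0 = definability dp for dp :: "((nat \<Rightarrow> 'a) \<Rightarrow> bool) \<Rightarrow> bool" +
  fixes mem :: "'a \<Rightarrow> 'a \<Rightarrow> bool" (infix "\<epsilon>" 50)
    and isS :: "'a \<Rightarrow> bool"
  assumes dp_mem_var: "dp (\<lambda>\<rho>. \<rho> i \<epsilon> \<rho> j)"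
    and dp_isS_var: "dp (\<lambda>\<rho>. isS (\<rho> i))"
    and mem_isS: "x \<epsilon> y \<Longrightarrow> isS y"
    and ext_ax: "isS x \<Longrightarrow> isS y \<Longrightarrow> (\<And>z. z \<epsilon> x \<longleftrightarrow> z \<epsilon> y) \<Longrightarrow> x = y"
    and pair_ax: "\<exists>z. \<forall>t. t \<epsilon> z \<longleftrightarrow> t = x \<or> t = y"
    and union_ax: "isS x \<Longrightarrow> \<exists>y. isS y \<and> (\<forall>z. z \<epsilon> y \<longleftrightarrow> (\<exists>t. z \<epsilon> t \<and> t \<epsilon> x))"
    and power_ax: "isS x \<Longrightarrow>
      \<exists>y. isS y \<and> (\<forall>t. t \<epsilon> y \<longleftrightarrow> isS t \<and> (\<forall>z. z \<epsilon> t \<longrightarrow> z \<epsilon> x))"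
    and sep_ax: "isS x \<Longrightarrow> dp (\<lambda>\<rho>. P (\<rho> 0)) \<Longrightarrow> \<exists>y. isS y \<and> (\<forall>t. t \<epsilon> y \<longleftrightarrow> t \<epsilon> x \<and> P t)"
    and repl_ax: "isS u \<Longrightarrow> dp (\<lambda>\<rho>. R (\<rho> 0) (\<rho> (Suc 0))) \<Longrightarrow>
      (\<And>x y y'. x \<epsilon> u \<Longrightarrow> R x y \<Longrightarrow> R x y' \<Longrightarrow> y = y') \<Longrightarrow>
      \<exists>v. isS v \<and> (\<forall>y. y \<epsilon> v \<longleftrightarrow> (\<exists>x. x \<epsilon> u \<and> R x y))"
    and found_ax: "y \<epsilon> x \<Longrightarrow> \<exists>y. y \<epsilon> x \<and> (\<forall>z. z \<epsilon> y \<longrightarrow> \<not> z \<epsilon> x)"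
begin

lemma dp_mem [dpI]: "dt s \<Longrightarrow> dt t \<Longrightarrow> dp (\<lambda>\<rho>. s \<rho> \<epsilon> t \<rho>)"
  by (rule dp_comp2[OF dp_mem_var[of 0 "Suc 0"]])

lemma dp_isS [dpI]: "dt t \<Longrightarrow> dp (\<lambda>\<rho>. isS (t \<rho>))"
  by (rule dp_comp1[OF dp_isS_var[of 0]])

definition elts :: "'a \<Rightarrow> 'a set" where
  "elts x = {t. t \<epsilon> x}"

lemma elts_iff [simp]: "t \<in> elts x \<longleftrightarrow> t \<epsilon> x"
  by (simp add: elts_def)

definition small :: "('a \<Rightarrow> bool) \<Rightarrow> bool" where
  "small P \<longleftrightarrow> (\<exists>y. isS y \<and> (\<forall>t. t \<epsilon> y \<longleftrightarrow> P t))"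

text \<open>Total by \<open>the_only\<close>, hence a definable term for every definable
  \<open>P\<close>; it has the intended elements when \<open>small P\<close> holds.\<close>

definition setof :: "('a \<Rightarrow> bool) \<Rightarrow> 'a" where
  "setof P = the_only (\<lambda>y. isS y \<and> (\<forall>t. t \<epsilon> y \<longleftrightarrow> P t))"

lemma setof_eq: "isS y \<Longrightarrow> (\<And>t. t \<epsilon> y \<longleftrightarrow> P t) \<Longrightarrow> setof P = y"
  unfolding setof_def by (rule the_only) (auto intro: ext_ax)

lemma small_setof: "small P \<Longrightarrow> isS (setof P) \<and> (\<forall>t. t \<epsilon> setof P \<longleftrightarrow> P t)"
  unfolding small_def using setof_eq by blast

lemma isS_setof: "small P \<Longrightarrow> isS (setof P)"
  and mem_setof: "small P \<Longrightarrow> t \<epsilon> setof P \<longleftrightarrow> P t"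
  using small_setof by blast+

lemma dt_setof [dpI]:
  assumes "dp (\<lambda>\<rho>. H (\<lambda>n. \<rho> (Suc n)) (\<rho> 0))"
  shows "dt (\<lambda>\<rho>. setof (H \<rho>))"
proof -
  have 1: "dp (\<lambda>\<rho>. H (\<lambda>n. \<rho> (Suc (Suc n))) (\<rho> 0))"
    using dp_rename[OF assms, of "case_nat 0 (\<lambda>n. Suc (Suc n))"] by simp
  show ?thesis
    unfolding setof_def by (intro dpI 1)
qed

lemma small_False: "small (\<lambda>_. False)"
proof -
  obtain z where "\<forall>t. t \<epsilon> z \<longleftrightarrow> t = undefined \<or> t = undefined" using pair_ax by blast
  then have "isS z" using mem_isS by blast
  from sep_ax[OF this dp_const[of False]] show ?thesis by (simp add: small_def)
qed

text \<open>An urelement as bound makes \<open>P\<close> empty, and the empty class is small; this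
  covers the case to which separation does not apply.\<close>

lemma small_subset:
  assumes "dp (\<lambda>\<rho>. P (\<rho> 0))" "\<And>t. P t \<Longrightarrow> t \<epsilon> x"
  shows "small P"
proof (cases "isS x")
  case True
  from sep_ax[OF True assms(1)] show ?thesis unfolding small_def using assms(2) by blast
next
  case False
  then have "P = (\<lambda>_. False)" using assms(2) mem_isS by blast
  then show ?thesis using small_False by simp
qed

lemma small_mem: "small (\<lambda>t. t \<epsilon> x)"
  by (rule small_subset[of _ x]) (intro dpI)

lemma small_upair: "small (\<lambda>t. t = x \<or> t = y)"
  unfolding small_def using pair_ax[of x y] mem_isS by metis

definition upair :: "'a \<Rightarrow> 'a \<Rightarrow> 'a" where
  "upair x y = setof (\<lambda>t. t = x \<or> t = y)"

lemma mem_upair [simp]: "t \<epsilon> upair x y \<longleftrightarrow> t = x \<or> t = y" and isS_upair [simp]: "isS (upair x y)"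
  unfolding upair_def using mem_setof[OF small_upair] isS_setof[OF small_upair] by blast+

lemma small_Union: "small (\<lambda>z. \<exists>t. z \<epsilon> t \<and> t \<epsilon> x)"
proof (cases "isS x")
  case True
  then show ?thesis unfolding small_def by (rule union_ax)
next
  case False
  then have "(\<lambda>z. \<exists>t. z \<epsilon> t \<and> t \<epsilon> x) = (\<lambda>_. False)" using mem_isS by blast
  then show ?thesis using small_False by simp
qed

lemma small_or:
  assumes "small P" "small R"
  shows "small (\<lambda>t. P t \<or> R t)"
proof -
  let ?u = "upair (setof P) (setof R)"
  have "(\<lambda>z. \<exists>t. z \<epsilon> t \<and> t \<epsilon> ?u) = (\<lambda>t. P t \<or> R t)"
    by (rule ext) (simp add: conj_disj_distribL ex_disj_distrib mem_setof assms)
  then show ?thesis using small_Union[of ?u] by simp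
qed

lemma small_insert: "small (\<lambda>t. t \<epsilon> x \<or> t = y)"
  using small_or[OF small_mem small_upair[of y y], of x] by simp

lemma small_Pow: "small (\<lambda>t. isS t \<and> (\<forall>z. z \<epsilon> t \<longrightarrow> z \<epsilon> x))"
proof -
  let ?x = "setof (\<lambda>t. t \<epsilon> x)"
  have "isS ?x" "\<And>t. t \<epsilon> ?x \<longleftrightarrow> t \<epsilon> x" by (simp_all add: isS_setof mem_setof small_mem)
  then show ?thesis unfolding small_def using power_ax[of ?x] by simp
qed

lemma small_repl:
  assumes "dp (\<lambda>\<rho>. R (\<rho> 0) (\<rho> (Suc 0)))"
    and "\<And>x y y'. x \<epsilon> u \<Longrightarrow> R x y \<Longrightarrow> R x y' \<Longrightarrow> y = y'"
  shows "small (\<lambda>y. \<exists>x. x \<epsilon> u \<and> R x y)"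
proof (cases "isS u")
  case True
  from repl_ax[OF this assms] show ?thesis by (simp add: small_def)
next
  case False
  then have "(\<lambda>y. \<exists>x. x \<epsilon> u \<and> R x y) = (\<lambda>_. False)" using mem_isS by blast
  then show ?thesis using small_False by simp
qed

lemma small_image:
  assumes "dfun g"
  shows "small (\<lambda>y. \<exists>x. x \<epsilon> u \<and> y = g x)"
  by (rule small_repl, intro dpI dfun_dt[OF assms]) simp

text \<open>Foundation for the subset cut out by \<open>P\<close>: the form in which least ordinals
  and least counterexamples are obtained.\<close>

lemma found:
  assumes "dp (\<lambda>\<rho>. P (\<rho> 0))" "t \<epsilon> x" "P t"
  shows "\<exists>y. y \<epsilon> x \<and> P y \<and> (\<forall>z. z \<epsilon> y \<longrightarrow> z \<epsilon> x \<longrightarrow> \<not> P z)"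
proof -
  have "small (\<lambda>t. t \<epsilon> x \<and> P t)"
    by (rule small_subset[of _ x], intro dpI assms(1)) blast
  note * = mem_setof[OF this]
  have "t \<epsilon> setof (\<lambda>t. t \<epsilon> x \<and> P t)" using assms * by simp
  from found_ax[OF this] show ?thesis unfolding * by blast
qed

lemma mem_irrefl: "\<not> x \<epsilon> x"
  using found_ax[of x "upair x x"] by auto

lemma mem_asym: "x \<epsilon> y \<Longrightarrow> \<not> y \<epsilon> x"
  using found_ax[of x "upair x y"] by auto

lemma mem_cycle3: "x \<epsilon> y \<Longrightarrow> y \<epsilon> z \<Longrightarrow> \<not> z \<epsilon> x"
  using found_ax[of x "setof (\<lambda>t. t \<epsilon> upair x y \<or> t = z)"]
  unfolding mem_setof[OF small_insert] by auto


subsection \<open>Pairs, functions and equipollence\<close>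

text \<open>The following predicates repeat the formulas \<open>emptyu\<close>, \<open>oneu\<close>,
  \<open>succu\<close> and so on connective by connective, so that evaluating such a formula is mere
  unfolding. The lemmas ending in \<open>_iff\<close> then trade them for terms.\<close>

definition is_empty :: "'a \<Rightarrow> bool" where
  "is_empty e \<longleftrightarrow> isS e \<and> (\<forall>t. \<not> t \<epsilon> e)"

definition is_one :: "'a \<Rightarrow> bool" where
  "is_one x \<longleftrightarrow> isS x \<and> (\<forall>t. t \<epsilon> x \<longleftrightarrow> is_empty t)"

definition is_succ :: "'a \<Rightarrow> 'a \<Rightarrow> bool" where
  "is_succ w y \<longleftrightarrow> isS w \<and> (\<forall>t. t \<epsilon> w \<longleftrightarrow> t \<epsilon> y \<or> t = y)"

definition is_upair :: "'a \<Rightarrow> 'a \<Rightarrow> 'a \<Rightarrow> bool" where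
  "is_upair p x y \<longleftrightarrow> isS p \<and> (\<forall>t. t \<epsilon> p \<longleftrightarrow> t = x \<or> t = y)"

definition is_opair :: "'a \<Rightarrow> 'a \<Rightarrow> 'a \<Rightarrow> bool" where
  "is_opair p x y \<longleftrightarrow> isS p \<and> (\<forall>t. t \<epsilon> p \<longleftrightarrow> is_upair t x x \<or> is_upair t x y)"

definition is_app :: "'a \<Rightarrow> 'a \<Rightarrow> 'a \<Rightarrow> bool" where
  "is_app f x y \<longleftrightarrow> (\<exists>p. is_opair p x y \<and> p \<epsilon> f)"

definition is_fun :: "'a \<Rightarrow> 'a \<Rightarrow> 'a \<Rightarrow> bool" where
  "is_fun f a b \<longleftrightarrow> isS f \<and>
     (\<forall>p. p \<epsilon> f \<longrightarrow> (\<exists>x. \<exists>y. x \<epsilon> a \<and> y \<epsilon> b \<and> is_opair p x y)) \<and>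
     (\<forall>x. x \<epsilon> a \<longrightarrow> (\<exists>y. \<forall>z. is_app f x z \<longleftrightarrow> z = y))"

definition is_bij :: "'a \<Rightarrow> 'a \<Rightarrow> 'a \<Rightarrow> bool" where
  "is_bij f a b \<longleftrightarrow> is_fun f a b \<and>
     (\<forall>y. y \<epsilon> b \<longrightarrow> (\<exists>x. \<forall>z. is_app f z y \<longleftrightarrow> z = x))"

definition eqpoll :: "'a \<Rightarrow> 'a \<Rightarrow> bool" where
  "eqpoll a b \<longleftrightarrow> isS a \<and> isS b \<and> (\<exists>f. is_bij f a b)"

definition emp :: 'a where
  "emp = setof (\<lambda>_. False)"

definition succ :: "'a \<Rightarrow> 'a" where
  "succ y = setof (\<lambda>t. t \<epsilon> y \<or> t = y)"

definition opair :: "'a \<Rightarrow> 'a \<Rightarrow> 'a" where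
  "opair x y = upair (upair x x) (upair x y)"

lemma mem_emp [simp]: "\<not> t \<epsilon> emp" and isS_emp [simp]: "isS emp"
  by (simp_all add: emp_def mem_setof isS_setof small_False)

lemma mem_succ [simp]: "t \<epsilon> succ y \<longleftrightarrow> t \<epsilon> y \<or> t = y" and isS_succ [simp]: "isS (succ y)"
  by (simp_all add: succ_def mem_setof isS_setof small_insert)

lemma is_empty_iff: "is_empty e \<longleftrightarrow> e = emp"
  unfolding is_empty_def by (auto intro: ext_ax)

lemma is_upair_iff: "is_upair p x y \<longleftrightarrow> p = upair x y"
  unfolding is_upair_def by (auto intro: ext_ax)

lemma is_opair_iff: "is_opair p x y \<longleftrightarrow> p = opair x y"
  unfolding is_opair_def is_upair_iff opair_def by (auto intro: ext_ax)

lemma is_succ_iff: "is_succ w y \<longleftrightarrow> w = succ y"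
  unfolding is_succ_def by (auto intro: ext_ax)

lemma is_one_iff: "is_one x \<longleftrightarrow> x = succ emp"
  unfolding is_one_def is_empty_iff by (auto intro: ext_ax)

lemma upair_inject: "upair x y = upair x z \<Longrightarrow> y = z"
  by (metis mem_upair)

lemma opair_inject [simp]: "opair x y = opair x' y' \<longleftrightarrow> x = x' \<and> y = y'"
proof
  assume *: "opair x y = opair x' y'"
  then have "upair x x \<epsilon> opair x' y'" "upair x' x' \<epsilon> opair x y"
    by (metis mem_upair opair_def)+
  then have "x = x'" unfolding opair_def by (metis mem_upair)
  then show "x = x' \<and> y = y'"
    using * upair_inject unfolding opair_def by blast
qed simp

lemma is_app_iff: "is_app f x y \<longleftrightarrow> opair x y \<epsilon> f"
  by (simp add: is_app_def is_opair_iff)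

lemma dt_succ [dpI]: "dt t \<Longrightarrow> dt (\<lambda>\<rho>. succ (t \<rho>))"
  by (rule dt_comp1) (unfold succ_def, intro dpI)

lemma dt_upair [dpI]: "dt t \<Longrightarrow> dt s \<Longrightarrow> dt (\<lambda>\<rho>. upair (t \<rho>) (s \<rho>))"
  by (rule dt_comp2) (unfold upair_def, intro dpI)

lemma dt_opair [dpI]: "dt t \<Longrightarrow> dt s \<Longrightarrow> dt (\<lambda>\<rho>. opair (t \<rho>) (s \<rho>))"
  by (rule dt_comp2) (unfold opair_def, intro dpI)

lemma dp_is_fun [dpI]: "dt t \<Longrightarrow> dt s \<Longrightarrow> dt u \<Longrightarrow> dp (\<lambda>\<rho>. is_fun (t \<rho>) (s \<rho>) (u \<rho>))"
  by (rule dp_comp3) (unfold is_fun_def is_opair_iff is_app_iff, intro dpI)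

lemma dp_eqpoll [dpI]: "dt t \<Longrightarrow> dt s \<Longrightarrow> dp (\<lambda>\<rho>. eqpoll (t \<rho>) (s \<rho>))"
  by (rule dp_comp2) (unfold eqpoll_def is_bij_def is_app_iff, intro dpI)

section \<open>Definable functions and equipollence\<close>

lemma is_fun_image:
  assumes g: "dfun g" and ab: "\<And>x. x \<epsilon> a \<Longrightarrow> g x \<epsilon> b"
  obtains f where "is_fun f a b" "\<And>x y. is_app f x y \<longleftrightarrow> x \<epsilon> a \<and> y = g x"
proof -
  let ?f = "setof (\<lambda>p. \<exists>x. x \<epsilon> a \<and> p = opair x (g x))"
  have "dfun (\<lambda>x. opair x (g x))" unfolding dfun_def by (intro dpI dfun_dt[OF g])
  then have *: "small (\<lambda>p. \<exists>x. x \<epsilon> a \<and> p = opair x (g x))" by (rule small_image)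
  show thesis
    by (rule that[of ?f])
      (auto simp: is_fun_def is_app_iff is_opair_iff mem_setof[OF *] isS_setof[OF *] ab)
qed

text \<open>With \<open>eqpollE\<close> this exchanges bijections that are sets of the model for
  definable functions between the external sets \<open>elts a\<close> and \<open>elts b\<close>,
  where \<open>bij_betw\<close> and its lemmas apply.\<close>

lemma eqpollI:
  assumes "isS a" "isS b" and g: "dfun g" and bij: "bij_betw g (elts a) (elts b)"
  shows "eqpoll a b"
proof -
  have "g x \<epsilon> b" if "x \<epsilon> a" for x using bij_betwE[OF bij] that by simp
  then obtain f where f: "is_fun f a b" and app: "\<And>x y. is_app f x y \<longleftrightarrow> x \<epsilon> a \<and> y = g x"
    using is_fun_image[OF g] by blast
  have "\<exists>x. \<forall>z. is_app f z y \<longleftrightarrow> z = x" if y: "y \<epsilon> b" for y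
  proof -
    obtain x where x: "x \<epsilon> a" "y = g x"
      using y bij unfolding bij_betw_def by (metis elts_iff imageE)
    then have "z = x" if "z \<epsilon> a" "y = g z" for z
      using that bij unfolding bij_betw_def by (metis elts_iff inj_onD)
    then show ?thesis using x app by blast
  qed
  then show ?thesis using assms f unfolding eqpoll_def is_bij_def by blast
qed

lemma eqpollE:
  assumes "eqpoll a b"
  obtains g where "dfun g" "bij_betw g (elts a) (elts b)"
proof -
  obtain f where f: "is_bij f a b" using assms by (auto simp: eqpoll_def)
  let ?g = "\<lambda>x. the_only (\<lambda>y. opair x y \<epsilon> f)"
  have "dfun ?g" unfolding dfun_def by (intro dpI)
  have "opair x (?g x) \<epsilon> f \<and> (\<forall>z. opair x z \<epsilon> f \<longrightarrow> z = ?g x)" if x: "x \<epsilon> a" for x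
  proof -
    obtain y where y: "\<forall>z. opair x z \<epsilon> f \<longleftrightarrow> z = y"
      using f x unfolding is_bij_def is_fun_def is_app_iff by blast
    then have "?g x = y" by (intro the_only) auto
    then show ?thesis using y by simp
  qed
  note app = this[THEN conjunct1] and uniq = this[THEN conjunct2, rule_format]
  have rng: "x \<epsilon> a \<and> y \<epsilon> b" if "opair x y \<epsilon> f" for x y
    using f that by (auto simp: is_bij_def is_fun_def is_opair_iff dest!: spec[of _ "opair x y"])
  have "bij_betw ?g (elts a) (elts b)"
  proof (rule bij_betwI')
    fix x x' assume "x \<in> elts a" "x' \<in> elts a"
    then have a: "x \<epsilon> a" "x' \<epsilon> a" by simp_all
    show "?g x = ?g x' \<longleftrightarrow> x = x'"
    proof
      assume eq: "?g x = ?g x'"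
      have "?g x \<epsilon> b" using rng app a by blast
      then obtain x0 where "\<forall>z. opair z (?g x) \<epsilon> f \<longleftrightarrow> z = x0"
        using f unfolding is_bij_def is_app_iff by blast
      then show "x = x'" using app a eq by metis
    qed simp
  next
    fix x assume "x \<in> elts a"
    then show "?g x \<in> elts b" using rng[OF app] by simp
  next
    fix y assume "y \<in> elts b"
    then obtain x where "\<forall>z. opair z y \<epsilon> f \<longleftrightarrow> z = x"
      using f \<open>y \<in> elts b\<close> unfolding is_bij_def is_app_iff elts_iff by blast
    then have "opair x y \<epsilon> f" by blast
    then show "\<exists>x\<in>elts a. y = ?g x" using rng uniq by (metis elts_iff)
  qed
  with \<open>dfun ?g\<close> show thesis by (rule that)
qed

lemma dfun_id: "dfun (\<lambda>x. x)"
  unfolding dfun_def by (intro dpI)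

lemma dfun_comp:
  assumes "dfun g" "dfun h"
  shows "dfun (g \<circ> h)"
  unfolding dfun_def comp_def by (intro dfun_dt[OF assms(1)] dfun_dt[OF assms(2)] dpI)

lemma dfun_inverse:
  assumes g: "dfun g" and bij: "bij_betw g (elts a) (elts b)"
  obtains h where "dfun h" "bij_betw h (elts b) (elts a)"
    "\<And>x. x \<epsilon> a \<Longrightarrow> h (g x) = x" "\<And>y. y \<epsilon> b \<Longrightarrow> g (h y) = y"
proof -
  let ?h = "\<lambda>y. the_only (\<lambda>x. x \<epsilon> a \<and> y = g x)"
  have h: "dfun ?h" unfolding dfun_def by (intro dpI dfun_dt[OF g])
  have hg: "?h (g x) = x" if "x \<epsilon> a" for x
    by (rule the_only) (use bij that in \<open>auto simp: bij_betw_def inj_on_def\<close>)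
  have gh: "?h y \<epsilon> a \<and> g (?h y) = y" if y: "y \<epsilon> b" for y
  proof -
    obtain x where x: "x \<epsilon> a" "y = g x"
      using y bij unfolding bij_betw_def by (metis elts_iff imageE)
    then show ?thesis using hg by simp
  qed
  have "bij_betw ?h (elts b) (elts a)"
    by (rule bij_betw_byWitness[where f' = g]) (use hg gh bij in \<open>auto simp: bij_betw_def\<close>)
  with h show thesis using hg gh by (intro that[of ?h]) simp_all
qed

lemma eqpoll_refl: "isS a \<Longrightarrow> eqpoll a a"
  by (rule eqpollI[OF _ _ dfun_id]) (auto simp: bij_betw_def)

lemma eqpoll_isS: "eqpoll a b \<Longrightarrow> isS a \<and> isS b"
  by (simp add: eqpoll_def)

lemma eqpoll_sym:
  assumes "eqpoll a b"
  shows "eqpoll b a"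
proof -
  obtain g where "dfun g" "bij_betw g (elts a) (elts b)" using assms by (rule eqpollE)
  then obtain h where "dfun h" "bij_betw h (elts b) (elts a)" by (rule dfun_inverse)
  then show ?thesis using eqpoll_isS[OF assms] by (blast intro: eqpollI)
qed

lemma eqpoll_trans:
  assumes "eqpoll a b" "eqpoll b c"
  shows "eqpoll a c"
proof -
  obtain g where g: "dfun g" "bij_betw g (elts a) (elts b)" using assms(1) by (rule eqpollE)
  obtain h where h: "dfun h" "bij_betw h (elts b) (elts c)" using assms(2) by (rule eqpollE)
  show ?thesis
    by (rule eqpollI[OF _ _ dfun_comp[OF h(1) g(1)] bij_betw_trans[OF g(2) h(2)]])
      (use eqpoll_isS[OF assms(1)] eqpoll_isS[OF assms(2)] in blast)+
qed

lemma eqpoll_image: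
  assumes g: "dfun g" and inj: "inj_on g (elts a)" and "isS a"
  shows "eqpoll a (setof (\<lambda>y. \<exists>x. x \<epsilon> a \<and> y = g x))"
  by (rule eqpollI[OF assms(3) _ g])
    (use inj in \<open>auto simp: bij_betw_def isS_setof mem_setof small_image[OF g]\<close>)

text \<open>Schroeder--Bernstein in the special case where one of the two injections is an inclusion.\<close>

lemma eqpoll_sandwich:
  assumes g: "dfun g" and inj: "inj_on g (elts a)" and ab: "g ` elts a \<subseteq> elts b"
    and ba: "elts b \<subseteq> elts a" and S: "isS a" "isS b"
  shows "eqpoll a b"
proof -
  \<comment> \<open>\<open>c\<close> is the least subset of \<open>a\<close> that contains
    \<open>a - b\<close> and is closed under \<open>g\<close>. It is an intersection, since
    iterating \<open>g\<close> over the natural numbers would call for infinity.\<close>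
  define K where "K s \<longleftrightarrow> (\<forall>t. t \<epsilon> a \<and> \<not> t \<epsilon> b \<longrightarrow> t \<epsilon> s) \<and> (\<forall>t. t \<epsilon> s \<longrightarrow> g t \<epsilon> s)" for s
  define c where "c = setof (\<lambda>t. t \<epsilon> a \<and> (\<forall>s. K s \<longrightarrow> t \<epsilon> s))"
  have dK: "dp (\<lambda>\<rho>. K (t \<rho>))" if "dt t" for t
    by (rule dp_comp1[OF _ that]) (unfold K_def, intro dpI dfun_dt[OF g])
  have "small (\<lambda>t. t \<epsilon> a \<and> (\<forall>s. K s \<longrightarrow> t \<epsilon> s))"
    by (rule small_subset[of _ a], intro dpI dK) blast
  then have c: "t \<epsilon> c \<longleftrightarrow> t \<epsilon> a \<and> (\<forall>s. K s \<longrightarrow> t \<epsilon> s)" for t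
    unfolding c_def by (rule mem_setof)
  have ga: "g t \<epsilon> b" if "t \<epsilon> a" for t using ab that unfolding elts_def by blast
  have ba': "t \<epsilon> a" if "t \<epsilon> b" for t using ba that unfolding elts_def by blast
  have Kc: "K c" unfolding K_def c using ga ba' by (auto simp: K_def)
  define h where "h = (\<lambda>t. if t \<epsilon> c then g t else t)"
  have "dfun h" unfolding h_def dfun_def by (intro dpI dfun_dt[OF g])
  moreover have "bij_betw h (elts a) (elts b)"
    unfolding bij_betw_def
  proof
    show "inj_on h (elts a)"
      using inj Kc unfolding inj_on_def h_def K_def by (auto split: if_splits)
    show "h ` elts a = elts b"
    proof
      show "h ` elts a \<subseteq> elts b" using ga Kc by (auto simp: h_def K_def)
      show "elts b \<subseteq> h ` elts a"
      proof
        fix s assume "s \<in> elts b"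
        then have s: "s \<epsilon> b" by simp
        show "s \<in> h ` elts a"
        proof (cases "s \<epsilon> c")
          case False
          then have "h s = s" by (simp add: h_def)
          then show ?thesis using ba' s by (metis elts_iff image_eqI)
        next
          case True
          show ?thesis
          proof (rule ccontr)
            assume no: "s \<notin> h ` elts a"
            \<comment> \<open>Removing a value that is not attained leaves a set that still contains
              \<open>a - b\<close> and is closed under \<open>g\<close>, against minimality of
              \<open>c\<close>.\<close>
            let ?s = "setof (\<lambda>t. t \<epsilon> c \<and> t \<noteq> s)"
            have "small (\<lambda>t. t \<epsilon> c \<and> t \<noteq> s)"
              by (rule small_subset[of _ c], intro dpI) blast
            note m = mem_setof[OF this]
            have "g t \<noteq> s" if "t \<epsilon> c" for t
            proof
              assume "g t = s"
              then have "h t = s" "t \<epsilon> a" using that c by (simp_all add: h_def)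
              then show False using no by auto
            qed
            then have "K ?s" using Kc s unfolding K_def m by blast
            then have "s \<epsilon> ?s" using True c by blast
            then show False using m by simp
          qed
        qed
      qed
    qed
  qed
  ultimately show ?thesis using S by (intro eqpollI)
qed

end

subsection \<open>Ordinals and natural numbers\<close>

context zfu0
begin

definition ordinal :: "'a \<Rightarrow> bool" where
  "ordinal x \<longleftrightarrow> isS x \<and>
     (\<forall>y. y \<epsilon> x \<longrightarrow> isS y \<and> (\<forall>z. z \<epsilon> y \<longrightarrow> z \<epsilon> x)) \<and>
     (\<forall>y. \<forall>z. y \<epsilon> x \<and> z \<epsilon> x \<longrightarrow> y \<epsilon> z \<or> y = z \<or> z \<epsilon> y)"

definition natural :: "'a \<Rightarrow> bool" where
  "natural n \<longleftrightarrow> ordinal n \<and>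
     (\<forall>j. j \<epsilon> n \<or> j = n \<longrightarrow> is_empty j \<or> (\<exists>k. is_succ j k))"

lemma dp_ordinal [dpI]: "dt t \<Longrightarrow> dp (\<lambda>\<rho>. ordinal (t \<rho>))"
  by (rule dp_comp1) (unfold ordinal_def, intro dpI)

lemma dp_natural [dpI]: "dt t \<Longrightarrow> dp (\<lambda>\<rho>. natural (t \<rho>))"
  by (rule dp_comp1) (unfold natural_def is_empty_iff is_succ_iff, intro dpI)

lemma ordinal_isS: "ordinal x \<Longrightarrow> isS x"
  by (simp add: ordinal_def)

lemma ordinal_trans: "ordinal x \<Longrightarrow> y \<epsilon> x \<Longrightarrow> z \<epsilon> y \<Longrightarrow> z \<epsilon> x"
  by (auto simp: ordinal_def)

lemma ordinal_compare: "ordinal x \<Longrightarrow> y \<epsilon> x \<Longrightarrow> z \<epsilon> x \<Longrightarrow> y \<epsilon> z \<or> y = z \<or> z \<epsilon> y"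
  unfolding ordinal_def by blast

lemma ordinal_mem:
  assumes x: "ordinal x" and y: "y \<epsilon> x"
  shows "ordinal y"
proof -
  have sub: "z \<epsilon> x" if "z \<epsilon> y" for z using ordinal_trans[OF x y that] .
  have "w \<epsilon> y" if "z \<epsilon> y" "w \<epsilon> z" for z w
  proof -
    have "w \<epsilon> x" using ordinal_trans[OF x sub] that by blast
    then have "w \<epsilon> y \<or> w = y \<or> y \<epsilon> w" using ordinal_compare[OF x _ y] by blast
    then show ?thesis using mem_asym mem_cycle3 that by blast
  qed
  moreover have "isS z" if "z \<epsilon> x" for z using x that by (auto simp: ordinal_def)
  ultimately show ?thesis
    unfolding ordinal_def using sub y ordinal_compare[OF x] by blast
qed

text \<open>A transitive proper subset equals the \<epsilon>-least element of \<open>a\<close>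
  outside it.\<close>

lemma ordinal_subset_mem:
  assumes a: "ordinal a" and c: "isS c" and sub: "\<And>t. t \<epsilon> c \<Longrightarrow> t \<epsilon> a"
    and tr: "\<And>y z. y \<epsilon> c \<Longrightarrow> z \<epsilon> y \<Longrightarrow> z \<epsilon> c" and ne: "c \<noteq> a"
  shows "c \<epsilon> a"
proof -
  obtain t where "t \<epsilon> a" "\<not> t \<epsilon> c" using ext_ax[OF c ordinal_isS[OF a]] sub ne by blast
  then have "\<exists>y. y \<epsilon> a \<and> \<not> y \<epsilon> c \<and> (\<forall>z. z \<epsilon> y \<longrightarrow> z \<epsilon> a \<longrightarrow> \<not> \<not> z \<epsilon> c)"
    by (intro found[where P = "\<lambda>t. \<not> t \<epsilon> c"] dpI)
  then obtain y where y: "y \<epsilon> a" "\<not> y \<epsilon> c" "\<And>z. z \<epsilon> y \<Longrightarrow> z \<epsilon> a \<Longrightarrow> z \<epsilon> c" by blast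
  have "c = y"
  proof (rule ext_ax[OF c])
    show "isS y" using a y by (auto simp: ordinal_def)
    show "z \<epsilon> c \<longleftrightarrow> z \<epsilon> y" for z
      using y sub tr ordinal_trans[OF a] ordinal_compare[OF a] by blast
  qed
  then show ?thesis using y by simp
qed

text \<open>The intersection is transitive; were it different from both ordinals, it would belong to
  both and hence to itself.\<close>

lemma ordinal_linear:
  assumes a: "ordinal a" and b: "ordinal b"
  shows "a \<epsilon> b \<or> a = b \<or> b \<epsilon> a"
proof -
  define c where "c = setof (\<lambda>t. t \<epsilon> a \<and> t \<epsilon> b)"
  have s: "small (\<lambda>t. t \<epsilon> a \<and> t \<epsilon> b)" by (rule small_subset[of _ a], intro dpI) blast
  have c: "t \<epsilon> c \<longleftrightarrow> t \<epsilon> a \<and> t \<epsilon> b" and S: "isS c" for t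
    unfolding c_def by (rule mem_setof[OF s], rule isS_setof[OF s])
  have tr: "z \<epsilon> c" if "y \<epsilon> c" "z \<epsilon> y" for y z
    using that ordinal_trans[OF a] ordinal_trans[OF b] unfolding c by blast
  have "c \<epsilon> a" if "c \<noteq> a"
    by (rule ordinal_subset_mem[OF a S]) (use c tr that in blast)+
  moreover have "c \<epsilon> b" if "c \<noteq> b"
    by (rule ordinal_subset_mem[OF b S]) (use c tr that in blast)+
  moreover have "\<not> c \<epsilon> c" by (rule mem_irrefl)
  ultimately show ?thesis unfolding c by blast
qed

lemma ordinalI:
  assumes "isS x" "\<And>y. y \<epsilon> x \<Longrightarrow> ordinal y" "\<And>y z. y \<epsilon> x \<Longrightarrow> z \<epsilon> y \<Longrightarrow> z \<epsilon> x"
  shows "ordinal x"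
  unfolding ordinal_def using assms ordinal_linear ordinal_isS by blast

lemma ordinal_emp: "ordinal emp"
  by (rule ordinalI) auto

lemma ordinal_succ: "ordinal x \<Longrightarrow> ordinal (succ x)"
  by (rule ordinalI) (auto intro: ordinal_mem ordinal_trans)

lemma ordinal_least:
  assumes P: "dp (\<lambda>\<rho>. P (\<rho> 0))" and a: "ordinal a" "P a"
  shows "\<exists>b. ordinal b \<and> P b \<and> (\<forall>c. c \<epsilon> b \<longrightarrow> \<not> P c)"
proof -
  \<comment> \<open>\<open>found\<close> searches within a set, and \<open>succ a\<close> has
    \<open>a\<close> itself among the candidates.\<close>
  have "a \<epsilon> succ a" by simp
  from found[OF P this a(2)] obtain b where
    b: "b \<epsilon> succ a" "P b" "\<And>z. z \<epsilon> b \<Longrightarrow> z \<epsilon> succ a \<Longrightarrow> \<not> P z" by blast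
  then show ?thesis
    using ordinal_mem[OF ordinal_succ[OF a(1)]] ordinal_trans[OF ordinal_succ[OF a(1)]] by blast
qed

lemma natural_ordinal: "natural n \<Longrightarrow> ordinal n"
  by (simp add: natural_def)

lemma natural_mem: "natural n \<Longrightarrow> k \<epsilon> n \<Longrightarrow> natural k"
  unfolding natural_def by (metis ordinal_mem ordinal_trans)

lemma natural_emp: "natural emp"
  by (simp add: natural_def ordinal_emp is_empty_iff)

lemma natural_succ: "natural n \<Longrightarrow> natural (succ n)"
  unfolding natural_def is_succ_iff by (auto intro: ordinal_succ)

lemma natural_cases: "natural n \<Longrightarrow> n = emp \<or> (\<exists>k. n = succ k)"
  unfolding natural_def is_empty_iff is_succ_iff by blast

text \<open>The witness is \<omega>, obtained as the least ordinal that is not natural.\<close>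

lemma inductive_set_ex:
  assumes "ordinal a" "\<not> natural a"
  shows "\<exists>x. isS x \<and> emp \<epsilon> x \<and> (\<forall>y. y \<epsilon> x \<longrightarrow> succ y \<epsilon> x)"
proof -
  have "dp (\<lambda>\<rho>. \<not> natural (\<rho> 0))" by (intro dpI)
  from ordinal_least[OF this assms] obtain b where
    b: "ordinal b" "\<not> natural b" "\<And>c. c \<epsilon> b \<Longrightarrow> natural c" by blast
  have "emp \<epsilon> b" using ordinal_linear[OF ordinal_emp b(1)] b(2) natural_emp by auto
  moreover have "succ y \<epsilon> b" if y: "y \<epsilon> b" for y
  proof -
    have nat: "natural (succ y)" using b(3)[OF y] by (rule natural_succ)
    have "\<not> b \<epsilon> succ y" using y mem_asym mem_irrefl by auto
    then show ?thesis
      using ordinal_linear[OF natural_ordinal[OF nat] b(1)] b(2) nat by blast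
  qed
  ultimately show ?thesis using ordinal_isS[OF b(1)] by blast
qed

text \<open>A bijection of the union of the family with an ordinal well-orders that union, and the
  selector collects the least element of each member.\<close>

lemma choice_of_ordinals:
  assumes ord: "\<And>x. isS x \<Longrightarrow> \<exists>k. ordinal k \<and> eqpoll x k"
    and ne: "\<And>y. y \<epsilon> x \<Longrightarrow> \<exists>t. t \<epsilon> y"
    and dj: "\<And>y z t. y \<epsilon> x \<Longrightarrow> z \<epsilon> x \<Longrightarrow> t \<epsilon> y \<Longrightarrow> t \<epsilon> z \<Longrightarrow> y = z"
  shows "\<exists>u. isS u \<and> (\<forall>y. y \<epsilon> x \<longrightarrow> (\<exists>v. \<forall>t. t \<epsilon> y \<and> t \<epsilon> u \<longleftrightarrow> t = v))"
proof -
  let ?U = "setof (\<lambda>z. \<exists>t. z \<epsilon> t \<and> t \<epsilon> x)"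
  note U = mem_setof[OF small_Union[of x]]
  obtain k where k: "ordinal k" and "eqpoll ?U k" using ord isS_setof[OF small_Union] by blast
  then obtain g where g: "dfun g" and bij: "bij_betw g (elts ?U) (elts k)" by (blast elim: eqpollE)
  have gk: "g t \<epsilon> k" if "y \<epsilon> x" "t \<epsilon> y" for t y
  proof -
    have "t \<epsilon> ?U" unfolding U using that by blast
    then show ?thesis using bij_betwE[OF bij] by simp
  qed
  have inj: "s = t" if "g s = g t" "y \<epsilon> x" "t \<epsilon> y" "s \<epsilon> y" for s t y
  proof -
    have "t \<epsilon> ?U" "s \<epsilon> ?U" unfolding U using that by blast+
    then show ?thesis using bij that(1) unfolding bij_betw_def inj_on_def by simp
  qed
  \<comment> \<open>Stated without naming the member of \<open>x\<close> that contains
    \<open>t\<close>, so that one predicate defines the selector for the whole family; disjointness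
    makes that member unique.\<close>
  define least where
    "least t \<longleftrightarrow> (\<forall>y s. y \<epsilon> x \<longrightarrow> t \<epsilon> y \<longrightarrow> s \<epsilon> y \<longrightarrow> s \<noteq> t \<longrightarrow> g t \<epsilon> g s)" for t
  have s: "small (\<lambda>t. t \<epsilon> ?U \<and> least t)"
    unfolding least_def by (rule small_subset[of _ ?U], intro dpI dfun_dt[OF g]) blast
  let ?u = "setof (\<lambda>t. t \<epsilon> ?U \<and> least t)"
  have "\<exists>v. \<forall>t. t \<epsilon> y \<and> t \<epsilon> ?u \<longleftrightarrow> t = v" if y: "y \<epsilon> x" for y
  proof -
    obtain t where "t \<epsilon> y" using ne y by blast
    then have t: "g t \<epsilon> k" "\<exists>s. s \<epsilon> y \<and> g s = g t" using gk y by blast+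
    have "dp (\<lambda>\<rho>. \<exists>s. s \<epsilon> y \<and> g s = \<rho> 0)" by (intro dpI dfun_dt[OF g])
    from found[where P = "\<lambda>b. \<exists>s. s \<epsilon> y \<and> g s = b", OF this t] obtain v where
      v: "v \<epsilon> y" and least_v: "\<And>s. s \<epsilon> y \<Longrightarrow> g s \<epsilon> k \<Longrightarrow> \<not> g s \<epsilon> g v" by blast
    have vs: "g v \<epsilon> g s" if "s \<epsilon> y" "s \<noteq> v" for s
      using ordinal_compare[OF k gk[OF y v] gk[OF y that(1)]] least_v[OF that(1) gk[OF y that(1)]]
        inj[OF _ y v that(1)] that(2) by auto
    have "least v" unfolding least_def using vs dj[OF y _ v] by blast
    moreover have "v \<epsilon> ?U" unfolding U using v y by blast
    moreover have "t = v" if "t \<epsilon> y" "least t" for t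
      using that y v least_v[OF that(1) gk[OF y that(1)]] unfolding least_def by blast
    ultimately show ?thesis unfolding mem_setof[OF s] using v by blast
  qed
  then show ?thesis using isS_setof[OF s] by blast
qed


subsection \<open>Cardinals\<close>

definition cardinal :: "'a \<Rightarrow> bool" where
  "cardinal k \<longleftrightarrow> ordinal k \<and> \<not> (\<exists>a. a \<epsilon> k \<and> eqpoll a k)"

definition card_of :: "'a \<Rightarrow> 'a \<Rightarrow> bool" where
  "card_of x k \<longleftrightarrow> cardinal k \<and> eqpoll x k"

definition is_add :: "'a \<Rightarrow> 'a \<Rightarrow> 'a \<Rightarrow> bool" where
  "is_add k l j \<longleftrightarrow> (\<exists>a. \<exists>b. \<exists>c. eqpoll a k \<and> eqpoll b l \<and>
     \<not> (\<exists>t. t \<epsilon> a \<and> t \<epsilon> b) \<and>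
     isS c \<and> (\<forall>t. t \<epsilon> c \<longleftrightarrow> t \<epsilon> a \<or> t \<epsilon> b) \<and> card_of c j)"

definition is_pow2 :: "'a \<Rightarrow> 'a \<Rightarrow> bool" where
  "is_pow2 k l \<longleftrightarrow> (\<exists>i. \<exists>j. \<exists>p. is_one i \<and> is_succ j i \<and>
     isS p \<and> (\<forall>f. f \<epsilon> p \<longleftrightarrow> is_fun f k j) \<and> card_of p l)"

lemma dp_card_of [dpI]: "dt t \<Longrightarrow> dt s \<Longrightarrow> dp (\<lambda>\<rho>. card_of (t \<rho>) (s \<rho>))"
  by (rule dp_comp2) (unfold card_of_def cardinal_def, intro dpI)

lemma card_of_unique:
  assumes "card_of x k" "card_of x l"
  shows "k = l"
proof -
  have "eqpoll k l" using assms eqpoll_sym eqpoll_trans unfolding card_of_def by blast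
  moreover have "eqpoll l k" using eqpoll_sym[OF calculation] .
  ultimately show ?thesis
    using assms ordinal_linear unfolding card_of_def cardinal_def by blast
qed

end

section \<open>Well-ordering and cardinality under choice and infinity\<close>

locale zfu = zfu0 +
  assumes choice_ax: "isS x \<Longrightarrow> (\<And>y. y \<epsilon> x \<Longrightarrow> isS y \<and> (\<exists>t. t \<epsilon> y)) \<Longrightarrow>
    (\<And>y z. y \<epsilon> x \<Longrightarrow> z \<epsilon> x \<Longrightarrow> (\<exists>t. t \<epsilon> y \<and> t \<epsilon> z) \<Longrightarrow> y = z) \<Longrightarrow>
    \<exists>u. isS u \<and> (\<forall>y. y \<epsilon> x \<longrightarrow> (\<exists>v. \<forall>t. t \<epsilon> y \<and> t \<epsilon> u \<longleftrightarrow> t = v))"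
    and infinity_ax: "\<exists>x. emp \<epsilon> x \<and> (\<forall>y. y \<epsilon> x \<longrightarrow> isS y \<longrightarrow> succ y \<epsilon> x)"
begin

text \<open>The axiom speaks of disjoint families only. Pairing every element of a nonempty subset
  of \<open>x\<close> with that subset makes the family of these subsets disjoint.\<close>

lemma choice_function:
  "\<exists>ch. dfun ch \<and> (\<forall>y. (\<exists>t. t \<epsilon> y) \<longrightarrow> (\<forall>t. t \<epsilon> y \<longrightarrow> t \<epsilon> x) \<longrightarrow> ch y \<epsilon> y)"
proof -
  let ?Pow = "setof (\<lambda>t. isS t \<and> (\<forall>z. z \<epsilon> t \<longrightarrow> z \<epsilon> x))"
  have sP: "small (\<lambda>y. y \<epsilon> ?Pow \<and> (\<exists>t. t \<epsilon> y))"
    by (rule small_subset[of _ ?Pow], intro dpI) blast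
  let ?P = "setof (\<lambda>y. y \<epsilon> ?Pow \<and> (\<exists>t. t \<epsilon> y))"
  have P: "y \<epsilon> ?P \<longleftrightarrow> (\<forall>z. z \<epsilon> y \<longrightarrow> z \<epsilon> x) \<and> (\<exists>t. t \<epsilon> y)" for y
    using mem_setof[OF sP, of y] mem_setof[OF small_Pow[of x], of y] mem_isS[of _ y] by blast
  define tag where "tag y = setof (\<lambda>p. \<exists>t. t \<epsilon> y \<and> p = opair y t)" for y
  have "dfun (opair y)" for y unfolding dfun_def by (intro dpI)
  note st = small_image[OF this]
  have tag: "p \<epsilon> tag y \<longleftrightarrow> (\<exists>t. t \<epsilon> y \<and> p = opair y t)" for p y
    unfolding tag_def by (rule mem_setof[OF st])
  have dtag: "dfun tag" unfolding dfun_def tag_def by (intro dpI)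
  let ?X = "setof (\<lambda>z. \<exists>y. y \<epsilon> ?P \<and> z = tag y)"
  have X: "z \<epsilon> ?X \<longleftrightarrow> (\<exists>y. y \<epsilon> ?P \<and> z = tag y)" for z
    by (rule mem_setof[OF small_image[OF dtag]])
  have "\<exists>u. isS u \<and> (\<forall>y. y \<epsilon> ?X \<longrightarrow> (\<exists>v. \<forall>t. t \<epsilon> y \<and> t \<epsilon> u \<longleftrightarrow> t = v))"
  proof (rule choice_ax)
    show "isS ?X" by (rule isS_setof[OF small_image[OF dtag]])
    show "isS z \<and> (\<exists>t. t \<epsilon> z)" if z: "z \<epsilon> ?X" for z
    proof -
      obtain y where y: "y \<epsilon> ?P" "z = tag y" using z X by blast
      then obtain t where "t \<epsilon> y" using P by blast
      then have "opair y t \<epsilon> z" using y tag by blast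
      then show ?thesis using mem_isS by blast
    qed
    show "z = z'" if z: "z \<epsilon> ?X" "z' \<epsilon> ?X" "\<exists>t. t \<epsilon> z \<and> t \<epsilon> z'" for z z'
      using z unfolding X tag by (metis opair_inject tag)
  qed
  then obtain u where u: "\<And>z. z \<epsilon> ?X \<Longrightarrow> \<exists>v. \<forall>t. t \<epsilon> z \<and> t \<epsilon> u \<longleftrightarrow> t = v" by blast
  let ?ch = "\<lambda>y. the_only (\<lambda>t. t \<epsilon> y \<and> opair y t \<epsilon> u)"
  have "?ch y \<epsilon> y" if y: "\<exists>t. t \<epsilon> y" "\<forall>t. t \<epsilon> y \<longrightarrow> t \<epsilon> x" for y
  proof -
    have "tag y \<epsilon> ?X" using y P X by blast
    from u[OF this] obtain v where v: "\<And>t. t \<epsilon> tag y \<and> t \<epsilon> u \<longleftrightarrow> t = v" by blast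
    then obtain t where t: "t \<epsilon> y" "v = opair y t" using tag by blast
    have "s = t" if "s \<epsilon> y" "opair y s \<epsilon> u" for s
      using that v[of "opair y s"] t unfolding tag by auto
    moreover have "opair y t \<epsilon> u" using v t by blast
    ultimately have "?ch y = t" using t by (intro the_only) blast+
    then show ?thesis using t by simp
  qed
  moreover have "dfun ?ch" unfolding dfun_def by (intro dpI)
  ultimately show ?thesis by blast
qed

text \<open>
  Zermelo's theorem: with \<open>ch\<close> a choice function on the nonempty subsets of \<open>x\<close>, an attempt is
  a set function on an ordinal whose value at \<open>b\<close> is chosen among the elements of \<open>x\<close> which are
  not values at members of \<open>b\<close>. Attempts agree, and their union is a bijection onto \<open>x\<close> since it
  could be extended otherwise.
\<close>

lemma eqpoll_ordinal:
  assumes "isS x"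
  shows "\<exists>k. ordinal k \<and> eqpoll x k"
proof -
  obtain ch where dch: "dfun ch" and ch: "\<And>y. \<exists>t. t \<epsilon> y \<Longrightarrow> \<forall>t. t \<epsilon> y \<longrightarrow> t \<epsilon> x \<Longrightarrow> ch y \<epsilon> y"
    using choice_function[of x] by blast
  define rem where "rem g b = setof (\<lambda>t. t \<epsilon> x \<and> \<not> (\<exists>c. c \<epsilon> b \<and> opair c t \<epsilon> g))" for g b
  define attempt where "attempt a g \<longleftrightarrow> ordinal a \<and> (\<forall>b. b \<epsilon> a \<longrightarrow>
    (\<exists>s. s \<epsilon> rem g b) \<and> (\<forall>t. opair b t \<epsilon> g \<longleftrightarrow> t = ch (rem g b)))" for a g
  \<comment> \<open>\<open>val\<close> is the union of all attempts, and \<open>left\<close> is to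
    it what \<open>rem\<close> is to a single attempt; \<open>rem_left\<close> identifies the two on
    the domain of an attempt.\<close>
  define val where "val b t \<longleftrightarrow> (\<exists>a g. attempt a g \<and> b \<epsilon> a \<and> opair b t \<epsilon> g)" for b t
  define left where "left b = setof (\<lambda>t. t \<epsilon> x \<and> \<not> (\<exists>c. c \<epsilon> b \<and> val c t))" for b
  have drem: "dt (\<lambda>\<rho>. rem (s \<rho>) (t \<rho>))" if "dt s" "dt t" for s t
    by (rule dt_comp2[OF _ that]) (unfold rem_def, intro dpI)
  have dattempt: "dp (\<lambda>\<rho>. attempt (s \<rho>) (t \<rho>))" if "dt s" "dt t" for s t
    by (rule dp_comp2[OF _ that]) (unfold attempt_def, intro dpI drem dfun_dt[OF dch])
  have dval: "dp (\<lambda>\<rho>. val (s \<rho>) (t \<rho>))" if "dt s" "dt t" for s t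
    by (rule dp_comp2[OF _ that]) (unfold val_def, intro dpI dattempt)
  have rem: "t \<epsilon> rem g b \<longleftrightarrow> t \<epsilon> x \<and> \<not> (\<exists>c. c \<epsilon> b \<and> opair c t \<epsilon> g)" for t g b
    unfolding rem_def by (rule mem_setof, rule small_subset[of _ x], intro dpI) blast
  have left: "t \<epsilon> left b \<longleftrightarrow> t \<epsilon> x \<and> \<not> (\<exists>c. c \<epsilon> b \<and> val c t)" for t b
    unfolding left_def by (rule mem_setof, rule small_subset[of _ x], intro dpI dval) blast
  have agree: "opair b t \<epsilon> g \<longleftrightarrow> opair b t \<epsilon> g'"
    if a: "attempt a g" "attempt a' g'" and b: "b \<epsilon> a" "b \<epsilon> a'" for a g a' g' b t
  proof (rule ccontr)
    let ?P = "\<lambda>b. b \<epsilon> a' \<and> (\<exists>t. opair b t \<epsilon> g \<longleftrightarrow> \<not> opair b t \<epsilon> g')"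
    assume "\<not> (opair b t \<epsilon> g \<longleftrightarrow> opair b t \<epsilon> g')"
    then have P: "?P b" using b by blast
    have "dp (\<lambda>\<rho>. ?P (\<rho> 0))" by (intro dpI)
    from found[where P = ?P, OF this b(1) P] obtain c where
      c: "c \<epsilon> a" "?P c" and least: "\<And>z. z \<epsilon> c \<Longrightarrow> z \<epsilon> a \<Longrightarrow> \<not> ?P z" by blast
    have "opair z s \<epsilon> g \<longleftrightarrow> opair z s \<epsilon> g'" if "z \<epsilon> c" for z s
    proof -
      have "z \<epsilon> a" "z \<epsilon> a'" using a c that ordinal_trans unfolding attempt_def by blast+
      then show ?thesis using least[OF that] by blast
    qed
    \<comment> \<open>Equal values below \<open>c\<close> leave the same elements over, so the
      choices at \<open>c\<close> coincide.\<close>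
    then have "rem g c = rem g' c" unfolding rem_def by (metis (no_types, lifting))
    then have "\<forall>s. opair c s \<epsilon> g \<longleftrightarrow> opair c s \<epsilon> g'" using a c unfolding attempt_def by simp
    then show False using c by blast
  qed
  have val_iff: "val b t \<longleftrightarrow> opair b t \<epsilon> g" if "attempt a g" "b \<epsilon> a" for a g b t
    unfolding val_def using agree that by blast
  have rem_left: "rem g b = left b" if a: "attempt a g" "b \<epsilon> a" for a g b
  proof -
    have "c \<epsilon> a" if "c \<epsilon> b" for c using a that ordinal_trans unfolding attempt_def by blast
    then have "(c \<epsilon> b \<and> opair c t \<epsilon> g) = (c \<epsilon> b \<and> val c t)" for c t using val_iff[OF a(1)] by blast
    then show ?thesis unfolding rem_def left_def by simp
  qed
  have val: "ordinal b \<and> (\<exists>s. s \<epsilon> left b) \<and> t = ch (left b) \<and> (\<forall>c. c \<epsilon> b \<longrightarrow> (\<exists>s. val c s))"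
    if v: "val b t" for b t
  proof -
    obtain a g where a: "attempt a g" "b \<epsilon> a" "opair b t \<epsilon> g" using v unfolding val_def by blast
    then have o: "ordinal a" unfolding attempt_def by blast
    have "val c (ch (rem g c))" if "c \<epsilon> b" for c
    proof -
      have "c \<epsilon> a" using ordinal_trans[OF o a(2) that] .
      then show ?thesis using val_iff[OF a(1)] a(1) unfolding attempt_def by blast
    qed
    then show ?thesis
      using a rem_left[OF a(1,2)] ordinal_mem[OF o a(2)] unfolding attempt_def by metis
  qed
  have val_left: "t \<epsilon> left b" if "val b t" for b t
    using val[OF that] ch[of "left b"] left by blast
  have val_inj: "b = c" if v: "val b t" "val c t" for b c t
    using ordinal_linear[of b c] val[OF v(1)] val[OF v(2)] val_left[OF v(1)] val_left[OF v(2)] v left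
    by blast
  define dom where "dom = setof (\<lambda>b. \<exists>t. t \<epsilon> x \<and> val b t)"
  \<comment> \<open>The domain of the union is a set by replacement from \<open>x\<close>, since by
    \<open>val_inj\<close> an element of \<open>x\<close> determines the ordinal at which it is
    chosen. This forces the recursion to stop.\<close>
  have sB: "small (\<lambda>b. \<exists>t. t \<epsilon> x \<and> val b t)"
    by (rule small_repl, intro dval dpI) (rule val_inj)
  have B: "b \<epsilon> dom \<longleftrightarrow> (\<exists>t. val b t)" for b
    unfolding dom_def mem_setof[OF sB] using val_left left by blast
  have domS: "isS dom" unfolding dom_def by (rule isS_setof[OF sB])
  have oB: "ordinal dom"
  proof (rule ordinalI[OF domS])
    show "ordinal b" if "b \<epsilon> dom" for b
      using that val unfolding B by blast
    show "c \<epsilon> dom" if b: "b \<epsilon> dom" and c: "c \<epsilon> b" for b c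
    proof -
      obtain t where "val b t" using b unfolding B by blast
      then obtain s where "val c s" using val c by blast
      then show ?thesis using B by blast
    qed
  qed
  define h where "h b = ch (left b)" for b
  have dh: "dfun h" unfolding dfun_def h_def left_def by (intro dval dpI dfun_dt[OF dch])
  have valB: "val b t \<longleftrightarrow> b \<epsilon> dom \<and> t = h b" for b t
    unfolding B h_def using val by blast
  have onto: "\<exists>b. b \<epsilon> dom \<and> t = h b" if t: "t \<epsilon> x" for t
  proof (rule ccontr)
    assume "\<not> ?thesis"
    then have t': "t \<epsilon> left dom" using t valB left by blast
    have ne: "\<exists>s. s \<epsilon> left b" if "b \<epsilon> succ dom" for b
      using that B val t' unfolding mem_succ by blast
    have "h b \<epsilon> x" if "b \<epsilon> succ dom" for b
      unfolding h_def using ch[of "left b"] ne[OF that] left by blast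
    then obtain g where g: "\<And>b y. is_app g b y \<longleftrightarrow> b \<epsilon> succ dom \<and> y = h b"
      using is_fun_image[OF dh, of "succ dom" x] by blast
    have "rem g b = left b" if b: "b \<epsilon> succ dom" for b
    proof -
      have "c \<epsilon> dom" if "c \<epsilon> b" for c
        using b that ordinal_trans[OF oB] unfolding mem_succ by blast
      then have "(c \<epsilon> b \<and> opair c s \<epsilon> g) = (c \<epsilon> b \<and> val c s)" for c s
        using g[unfolded is_app_iff mem_succ] valB[of c s] by blast
      then show ?thesis unfolding rem_def left_def by simp
    qed
    then have "attempt (succ dom) g"
      unfolding attempt_def using ordinal_succ[OF oB] ne g[unfolded is_app_iff h_def] by simp
    moreover have "opair dom (h dom) \<epsilon> g" using g[of dom "h dom"] unfolding is_app_iff by simp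
    \<comment> \<open>The longer attempt would make \<open>dom\<close> a member of itself.\<close>
    ultimately have "val dom (h dom)" using val_iff[of "succ dom" g dom "h dom"] by simp
    then show False using valB mem_irrefl by blast
  qed
  have "bij_betw h (elts dom) (elts x)"
  proof (rule bij_betwI')
    fix b c assume "b \<in> elts dom" "c \<in> elts dom"
    then have "val b (h b)" "val c (h c)" using valB by simp_all
    then show "h b = h c \<longleftrightarrow> b = c" using val_inj[of b "h b" c] by auto
  next
    fix b assume "b \<in> elts dom"
    then have "val b (h b)" using valB by simp
    then show "h b \<in> elts x" using val_left left by simp
  next
    fix t assume "t \<in> elts x"
    then show "\<exists>b\<in>elts dom. t = h b" using onto[of t] unfolding Bex_def elts_iff by simp
  qed
  then have "eqpoll dom x" using domS assms dh by (intro eqpollI)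
  then show ?thesis using oB eqpoll_sym by blast
qed

lemma card_of_ex:
  assumes "isS x"
  shows "\<exists>k. card_of x k"
proof -
  obtain a where a: "ordinal a" "eqpoll x a" using eqpoll_ordinal[OF assms] by blast
  have "dp (\<lambda>\<rho>. eqpoll x (\<rho> 0))" by (intro dpI)
  from ordinal_least[OF this a] obtain k where
    k: "ordinal k" "eqpoll x k" "\<And>c. c \<epsilon> k \<Longrightarrow> \<not> eqpoll x c" by blast
  have "\<not> eqpoll c k" if "c \<epsilon> k" for c
    using k(3)[OF that] eqpoll_trans[OF k(2) eqpoll_sym] by blast
  then show ?thesis using k unfolding card_of_def cardinal_def by blast
qed

text \<open>The interpretation of \<open>qc\<close>. By Q18, it is zero for urelements.\<close>

definition crd :: "'a \<Rightarrow> 'a" where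
  "crd x = (if isS x then the_only (card_of x) else emp)"

lemma dt_crd [dpI]: "dt t \<Longrightarrow> dt (\<lambda>\<rho>. crd (t \<rho>))"
  by (rule dt_comp1) (unfold crd_def, intro dpI)

lemma card_of_crd: "isS x \<Longrightarrow> card_of x (crd x)"
  using card_of_ex card_of_unique the_only unfolding crd_def by metis

lemma crd_eq: "card_of x k \<Longrightarrow> crd x = k"
  using card_of_crd card_of_unique eqpoll_isS unfolding card_of_def by blast

lemma cardinal_crd: "isS x \<Longrightarrow> cardinal (crd x)"
  and eqpoll_crd: "isS x \<Longrightarrow> eqpoll x (crd x)"
  using card_of_crd by (auto simp: card_of_def)

lemma ordinal_crd: "isS x \<Longrightarrow> ordinal (crd x)"
  using cardinal_crd by (auto simp: cardinal_def)

section \<open>Order and arithmetic of cardinalities\<close>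

lemma crd_subset_ex:
  assumes x: "isS x" and b: "cardinal b" "b \<epsilon> crd x \<or> b = crd x"
  shows "\<exists>y. isS y \<and> (\<forall>t. t \<epsilon> y \<longrightarrow> t \<epsilon> x) \<and> crd y = b"
proof -
  obtain g where g: "dfun g" and bij: "bij_betw g (elts (crd x)) (elts x)"
    using eqpoll_sym[OF eqpoll_crd[OF x]] by (rule eqpollE)
  have sub: "elts b \<subseteq> elts (crd x)"
    using b(2) ordinal_trans[OF ordinal_crd[OF x]] by auto
  let ?y = "setof (\<lambda>y. \<exists>i. i \<epsilon> b \<and> y = g i)"
  have "inj_on g (elts b)" using bij sub by (auto simp: bij_betw_def intro: inj_on_subset)
  moreover have "isS b" using b(1) ordinal_isS by (simp add: cardinal_def)
  ultimately have "eqpoll b ?y" using g by (intro eqpoll_image)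
  then have "crd ?y = b" using b(1) eqpoll_sym by (intro crd_eq) (simp add: card_of_def)
  moreover have "t \<epsilon> x" if t: "t \<epsilon> ?y" for t
  proof -
    obtain i where "i \<epsilon> b" "t = g i" using t unfolding mem_setof[OF small_image[OF g]] by blast
    then show ?thesis using bij_betwE[OF bij] sub by auto
  qed
  ultimately show ?thesis using isS_setof[OF small_image[OF g]] by blast
qed

text \<open>Otherwise \<open>crd y\<close> is a member and hence a subset of \<open>crd x\<close>,
  while the inclusion of \<open>x\<close> in \<open>y\<close> induces an injection of
  \<open>crd x\<close> into \<open>crd y\<close>. By \<open>eqpoll_sandwich\<close> they are
  equipollent, although \<open>crd x\<close> is a cardinal.\<close>

lemma crd_mono:
  assumes x: "isS x" and y: "isS y" and sub: "\<And>t. t \<epsilon> x \<Longrightarrow> t \<epsilon> y"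
  shows "crd x \<epsilon> crd y \<or> crd x = crd y"
proof (rule ccontr)
  assume "\<not> ?thesis"
  then have mem: "crd y \<epsilon> crd x" using ordinal_linear[OF ordinal_crd[OF x] ordinal_crd[OF y]] by blast
  obtain q where q: "dfun q" "bij_betw q (elts (crd x)) (elts x)"
    using eqpoll_sym[OF eqpoll_crd[OF x]] by (rule eqpollE)
  obtain p where p: "dfun p" "bij_betw p (elts y) (elts (crd y))"
    using eqpoll_crd[OF y] by (rule eqpollE)
  have xy: "elts x \<subseteq> elts y" using sub by auto
  have "inj_on p (elts x)" "p ` elts x \<subseteq> elts (crd y)"
    using p(2) xy by (auto simp: bij_betw_def intro: inj_on_subset)
  then have "inj_on (p \<circ> q) (elts (crd x))" "(p \<circ> q) ` elts (crd x) \<subseteq> elts (crd y)"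
    using q(2) by (auto simp: bij_betw_def intro: comp_inj_on)
  moreover have "elts (crd y) \<subseteq> elts (crd x)"
    using mem ordinal_trans[OF ordinal_crd[OF x]] by auto
  ultimately have "eqpoll (crd x) (crd y)"
    using ordinal_isS[OF ordinal_crd] x y by (intro eqpoll_sandwich[OF dfun_comp[OF p(1) q(1)]])
  then show False using eqpoll_sym mem cardinal_crd[OF x] unfolding cardinal_def by blast
qed

text \<open>A least counterexample is a successor \<open>succ k\<close>; once the values are
  rearranged to avoid \<open>k\<close>, its restriction makes \<open>k\<close> a smaller
  counterexample.\<close>

lemma pigeonhole:
  assumes "natural n" "eqpoll n b" "\<And>t. t \<epsilon> b \<Longrightarrow> t \<epsilon> n"
  shows "b = n"
proof (rule ccontr)
  assume "b \<noteq> n"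
  let ?P = "\<lambda>n. natural n \<and> (\<exists>b. eqpoll n b \<and> (\<forall>t. t \<epsilon> b \<longrightarrow> t \<epsilon> n) \<and> b \<noteq> n)"
  have dP: "dp (\<lambda>\<rho>. ?P (\<rho> 0))" by (intro dpI)
  have "?P n" using assms \<open>b \<noteq> n\<close> by blast
  from ordinal_least[where P = ?P, OF dP natural_ordinal[OF assms(1)] this] obtain n b where
    n: "natural n" and b: "eqpoll n b" "\<And>t. t \<epsilon> b \<Longrightarrow> t \<epsilon> n" "b \<noteq> n"
    and least: "\<And>k. k \<epsilon> n \<Longrightarrow> \<not> ?P k" by blast
  have S: "isS n" "isS b" using eqpoll_isS[OF b(1)] by blast+
  obtain d where d: "d \<epsilon> n" "\<not> d \<epsilon> b" using ext_ax[OF S(2,1)] b by blast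
  then obtain k where k: "n = succ k" using natural_cases[OF n] by auto
  obtain g where g: "dfun g" and bij: "bij_betw g (elts n) (elts b)" using b(1) by (rule eqpollE)
  have gb: "g t \<epsilon> b" if "t \<epsilon> n" for t using bij_betwE[OF bij] that by simp
  have inj: "g s = g t \<longleftrightarrow> s = t" if "s \<epsilon> n" "t \<epsilon> n" for s t
    using bij that unfolding bij_betw_def inj_on_def by auto
  have kn: "k \<epsilon> n" and lt: "\<And>t. t \<epsilon> k \<Longrightarrow> t \<epsilon> n \<and> t \<noteq> k" using k mem_irrefl by auto
  \<comment> \<open>An argument in \<open>k\<close> that \<open>g\<close> sends to \<open>k\<close>
    takes over the value \<open>g k\<close>, so no value of \<open>h\<close> on \<open>k\<close>
    equals \<open>k\<close>.\<close>
  define h where "h t = (if g t = k then g k else g t)" for t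
  have dh: "dfun h" unfolding dfun_def h_def by (intro dpI dfun_dt[OF g])
  have nk: "natural k" using natural_mem[OF n kn] .
  have hk: "h t \<epsilon> k \<and> h t \<epsilon> b" if t: "t \<epsilon> k" for t
  proof -
    have "h t \<epsilon> b" using gb lt[OF t] kn by (simp add: h_def)
    moreover have "h t \<noteq> k" using inj[OF kn, of t] lt[OF t] by (auto simp: h_def)
    ultimately show ?thesis using b(2)[of "h t"] k by auto
  qed
  have "inj_on h (elts k)"
  proof (rule inj_onI)
    fix s t assume "s \<in> elts k" "t \<in> elts k" and eq: "h s = h t"
    then have *: "s \<epsilon> n" "t \<epsilon> n" "s \<noteq> k" "t \<noteq> k" using lt by simp_all
    then have ne: "g s \<noteq> g k" "g t \<noteq> g k" using inj[OF _ kn] by blast+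
    have "g s = g t"
    proof (cases "g s = k")
      case True
      then have "h t = g k" using eq by (simp add: h_def)
      then have "g t = k" using ne(2) unfolding h_def by (metis (full_types))
      with True show ?thesis by (rule trans[OF _ sym])
    next
      case False
      then have "h t = g s" using eq by (simp add: h_def)
      then show ?thesis using ne(1) unfolding h_def by (metis (full_types))
    qed
    then show "s = t" using inj[OF *(1,2)] by blast
  qed
  then have "eqpoll k (setof (\<lambda>y. \<exists>x. x \<epsilon> k \<and> y = h x))" (is "eqpoll k ?b")
    using dh ordinal_isS[OF natural_ordinal[OF nk]] by (intro eqpoll_image)
  moreover have b': "y \<epsilon> ?b \<longleftrightarrow> (\<exists>x. x \<epsilon> k \<and> y = h x)" for y
    by (rule mem_setof[OF small_image[OF dh]])
  \<comment> \<open>If \<open>k\<close> is in \<open>b\<close>, then \<open>d\<close> lies in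
    \<open>k\<close> and is missed. Otherwise \<open>h\<close> agrees with \<open>g\<close> on
    \<open>k\<close>, and \<open>g k\<close> is missed.\<close>
  moreover have "?b \<noteq> k"
  proof
    assume eq: "?b = k"
    show False
    proof (cases "k \<epsilon> b")
      case True
      then have "d \<epsilon> k" using d k by auto
      then have "d \<epsilon> ?b" unfolding eq .
      then obtain t where "t \<epsilon> k" "d = h t" unfolding b' by (elim exE conjE)
      then show False using hk[of t] d(2) by simp
    next
      case False
      then have "g k \<epsilon> k" using gb[OF kn] b(2)[OF gb[OF kn]] k by auto
      then have "g k \<epsilon> ?b" unfolding eq .
      then obtain t where t: "t \<epsilon> k" "g k = h t" unfolding b' by (elim exE conjE)
      then have "g t \<epsilon> b" using gb lt by blast
      then have "h t = g t" using False unfolding h_def by metis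
      with t(2) have "g k = g t" by (rule trans)
      then show False using inj[OF kn] lt[OF t(1)] by simp
    qed
  qed
  moreover have "y \<epsilon> k" if "y \<epsilon> ?b" for y
    using that hk unfolding b' by (elim exE conjE) simp
  ultimately have "\<exists>b. eqpoll k b \<and> (\<forall>t. t \<epsilon> b \<longrightarrow> t \<epsilon> k) \<and> b \<noteq> k"
    by (intro exI[of _ ?b] conjI allI impI)
  with nk have "natural k \<and> (\<exists>b. eqpoll k b \<and> (\<forall>t. t \<epsilon> b \<longrightarrow> t \<epsilon> k) \<and> b \<noteq> k)"
    by (rule conjI)
  then show False using least[OF kn] by (rule notE[rotated])
qed

text \<open>If the cardinalities agreed, a bijection from \<open>y\<close> onto \<open>crd x\<close>
  would map \<open>x\<close> onto a subset equipollent to \<open>crd x\<close>. By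
  \<open>pigeonhole\<close> this subset is all of \<open>crd x\<close>, so \<open>x\<close> exhausts
  \<open>y\<close>.\<close>

lemma crd_strict_mono:
  assumes x: "isS x" and y: "isS y" and sub: "\<And>t. t \<epsilon> x \<Longrightarrow> t \<epsilon> y" and ne: "x \<noteq> y"
    and fin: "natural (crd x)"
  shows "crd x \<epsilon> crd y"
proof (rule ccontr)
  assume "\<not> ?thesis"
  then have eq: "crd y = crd x" using crd_mono[OF x y sub] by simp
  obtain p where p: "dfun p" "bij_betw p (elts y) (elts (crd x))"
    using eqpoll_crd[OF y] unfolding eq by (rule eqpollE)
  let ?b = "setof (\<lambda>z. \<exists>t. t \<epsilon> x \<and> z = p t)"
  have b: "z \<epsilon> ?b \<longleftrightarrow> (\<exists>t. t \<epsilon> x \<and> z = p t)" for z by (rule mem_setof[OF small_image[OF p(1)]])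
  have "inj_on p (elts x)" using p(2) sub by (auto simp: bij_betw_def inj_on_def)
  then have "eqpoll x ?b" using p(1) x by (intro eqpoll_image)
  then have "eqpoll (crd x) ?b" using eqpoll_crd[OF x] eqpoll_sym eqpoll_trans by blast
  moreover have "t \<epsilon> crd x" if "t \<epsilon> ?b" for t
    using that bij_betwE[OF p(2)] sub unfolding b by auto
  ultimately have *: "?b = crd x" by (rule pigeonhole[OF fin])
  have "t \<epsilon> x" if t: "t \<epsilon> y" for t
  proof -
    have "p t \<epsilon> ?b" unfolding * using bij_betwE[OF p(2)] t by simp
    then obtain s where s: "s \<epsilon> x" "p t = p s" unfolding b by blast
    then have "t = s" using p(2) t sub unfolding bij_betw_def inj_on_def by simp
    then show ?thesis using s by simp
  qed
  then show False using ext_ax[OF x y] sub ne by blast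
qed

lemma crd_is_add:
  assumes "isS x" "isS y" "isS w" "\<not> (\<exists>t. t \<epsilon> x \<and> t \<epsilon> y)" "\<And>t. t \<epsilon> w \<longleftrightarrow> t \<epsilon> x \<or> t \<epsilon> y"
  shows "is_add (crd x) (crd y) (crd w)"
  unfolding is_add_def using assms eqpoll_crd card_of_crd by blast

text \<open>Subsets of \<open>x\<close> correspond to their characteristic functions. These are
  moved along a bijection \<open>e\<close> of \<open>x\<close> with \<open>crd x\<close>, because
  \<open>is_pow2\<close> counts functions on the cardinal itself.\<close>

lemma crd_is_pow2:
  assumes x: "isS x" and p: "isS p" "\<And>t. t \<epsilon> p \<longleftrightarrow> isS t \<and> (\<forall>z. z \<epsilon> t \<longrightarrow> z \<epsilon> x)"
  shows "is_pow2 (crd x) (crd p)"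
proof -
  let ?k = "crd x" and ?one = "succ emp" and ?two = "succ (succ emp)"
  have ne: "emp \<noteq> ?one" using mem_succ[of emp emp] by (metis mem_emp)
  obtain e where e: "dfun e" "bij_betw e (elts x) (elts ?k)"
    using eqpoll_crd[OF x] by (rule eqpollE)
  obtain e' where e': "dfun e'" "bij_betw e' (elts ?k) (elts x)"
    "\<And>t. t \<epsilon> x \<Longrightarrow> e' (e t) = t" "\<And>i. i \<epsilon> ?k \<Longrightarrow> e (e' i) = i"
    by (rule dfun_inverse[OF e]) blast
  have ek: "e t \<epsilon> ?k" if "t \<epsilon> x" for t using bij_betwE[OF e(2)] that by simp
  have ex: "e' i \<epsilon> x" if "i \<epsilon> ?k" for i using bij_betwE[OF e'(2)] that by simp
  define chi where "chi s i = (if e' i \<epsilon> s then ?one else emp)" for s i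
  define h where "h s = setof (\<lambda>p. \<exists>i. i \<epsilon> ?k \<and> p = opair i (chi s i))" for s
  have dh: "dfun h" unfolding dfun_def h_def chi_def by (intro dpI dfun_dt[OF e'(1)])
  have "dfun (\<lambda>i. opair i (chi s i))" for s
    unfolding dfun_def chi_def by (intro dpI dfun_dt[OF e'(1)])
  note sm = small_image[OF this]
  have h: "q \<epsilon> h s \<longleftrightarrow> (\<exists>i. i \<epsilon> ?k \<and> q = opair i (chi s i))" and hS: "isS (h s)" for q s
    unfolding h_def by (rule mem_setof[OF sm], rule isS_setof[OF sm])
  have app: "opair i j \<epsilon> h s \<longleftrightarrow> i \<epsilon> ?k \<and> j = chi s i" for i j s unfolding h by auto
  let ?F = "setof (\<lambda>z. \<exists>s. s \<epsilon> p \<and> z = h s)"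
  have F: "z \<epsilon> ?F \<longleftrightarrow> (\<exists>s. s \<epsilon> p \<and> z = h s)" and FS: "isS ?F" for z
    by (rule mem_setof[OF small_image[OF dh]], rule isS_setof[OF small_image[OF dh]])
  have "bij_betw h (elts p) (elts ?F)"
    unfolding bij_betw_def
  proof
    show "inj_on h (elts p)"
    proof (rule inj_onI)
      fix s s' assume "s \<in> elts p" "s' \<in> elts p" and eq: "h s = h s'"
      then have s: "isS s" "\<And>t. t \<epsilon> s \<Longrightarrow> t \<epsilon> x" and s': "isS s'" "\<And>t. t \<epsilon> s' \<Longrightarrow> t \<epsilon> x"
        by (auto simp: p(2))
      have "t \<epsilon> s \<longleftrightarrow> t \<epsilon> s'" if t: "t \<epsilon> x" for t
      proof -
        have "chi s (e t) = chi s' (e t)" using app[of "e t"] ek[OF t] eq by metis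
        then show ?thesis using ne e'(3)[OF t] by (auto simp: chi_def split: if_splits)
      qed
      then show "s = s'" using ext_ax[OF s(1) s'(1)] s(2) s'(2) by blast
    qed
    show "h ` elts p = elts ?F" by (auto simp: F)
  qed
  then have "eqpoll p ?F" using p(1) FS dh by (intro eqpollI)
  then have "card_of ?F (crd p)"
    using cardinal_crd[OF p(1)] eqpoll_crd[OF p(1)] eqpoll_sym eqpoll_trans
    unfolding card_of_def by blast
  moreover have "f \<epsilon> ?F \<longleftrightarrow> is_fun f ?k ?two" for f
  proof
    assume "f \<epsilon> ?F"
    then obtain s where f: "f = h s" using F by blast
    show "is_fun f ?k ?two"
      unfolding f is_fun_def is_app_iff is_opair_iff app
      using hS h by (auto simp: chi_def)
  next
    assume f: "is_fun f ?k ?two"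
    let ?s = "setof (\<lambda>t. t \<epsilon> x \<and> opair (e t) ?one \<epsilon> f)"
    have ss: "small (\<lambda>t. t \<epsilon> x \<and> opair (e t) ?one \<epsilon> f)"
      by (rule small_subset[of _ x], intro dpI dfun_dt[OF e(1)]) blast
    have s: "?s \<epsilon> p" unfolding p(2) mem_setof[OF ss] using isS_setof[OF ss] by blast
    have rng: "\<exists>i j. i \<epsilon> ?k \<and> (j = emp \<or> j = ?one) \<and> q = opair i j" if "q \<epsilon> f" for q
      using f that unfolding is_fun_def is_opair_iff by (metis mem_succ mem_emp)
    have val: "opair i j \<epsilon> f \<longleftrightarrow> j = chi ?s i" if i: "i \<epsilon> ?k" for i j
    proof -
      obtain y where y: "\<And>z. opair i z \<epsilon> f \<longleftrightarrow> z = y"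
        using f i unfolding is_fun_def is_app_iff by blast
      have "y = emp \<or> y = ?one" using rng[of "opair i y"] y by auto
      moreover have "e' i \<epsilon> ?s \<longleftrightarrow> y = ?one"
        unfolding mem_setof[OF ss] using ex[OF i] e'(4)[OF i] y by auto
      ultimately show ?thesis using y by (auto simp: chi_def)
    qed
    have "f = h ?s"
    proof (rule ext_ax)
      show "isS f" using f by (simp add: is_fun_def)
      show "isS (h ?s)" by (rule hS)
      show "q \<epsilon> f \<longleftrightarrow> q \<epsilon> h ?s" for q
      proof
        assume q: "q \<epsilon> f"
        then obtain i j where ij: "i \<epsilon> ?k" "q = opair i j" using rng by blast
        then have "j = chi ?s i" using q val[OF ij(1)] by blast
        then show "q \<epsilon> h ?s" unfolding h using ij by (intro exI[of _ i] conjI) simp_all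
      next
        assume "q \<epsilon> h ?s"
        then obtain i where i: "i \<epsilon> ?k" "q = opair i (chi ?s i)" unfolding h by (elim exE conjE)
        then show "q \<epsilon> f" using val[OF i(1)] by simp
      qed
    qed
    then show "f \<epsilon> ?F" unfolding F using s by blast
  qed
  ultimately show ?thesis
    unfolding is_pow2_def is_one_iff is_succ_iff using FS by blast
qed

lemma crd_emp_iff: "isS x \<Longrightarrow> crd x = emp \<longleftrightarrow> x = emp"
proof
  assume x: "isS x" "crd x = emp"
  obtain g where "bij_betw g (elts x) (elts emp)"
    using eqpoll_crd[OF x(1)] unfolding x(2) by (rule eqpollE)
  then have "elts x = {}" by (simp add: elts_def bij_betw_def)
  then show "x = emp" using x(1) by (intro ext_ax) (auto simp: elts_def)
next
  assume "x = emp"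
  moreover have "card_of emp emp"
    by (simp add: card_of_def cardinal_def ordinal_emp eqpoll_refl)
  ultimately show "crd x = emp" using crd_eq by blast
qed

lemma crd_singleton: "crd (upair v v) = succ emp"
proof (rule crd_eq)
  have "\<not> eqpoll emp (succ emp)"
  proof
    assume "eqpoll emp (succ emp)"
    then obtain g where "bij_betw g (elts emp) (elts (succ emp))" by (rule eqpollE)
    then have "elts (succ emp) = {}" by (simp add: elts_def bij_betw_def)
    then show False by (auto simp: elts_def)
  qed
  then have "cardinal (succ emp)"
    unfolding cardinal_def using ordinal_succ[OF ordinal_emp] by auto
  moreover have "dfun (\<lambda>_. emp)" unfolding dfun_def by (intro dpI)
  then have "eqpoll (upair v v) (succ emp)"
    by (intro eqpollI) (auto simp: bij_betw_def inj_on_def)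
  ultimately show "card_of (upair v v) (succ emp)" by (simp add: card_of_def)
qed

end

section \<open>Semantics of formulas with named variables\<close>

text \<open>\<open>lift d x\<close> says that the term \<open>x\<close>, used at depth \<open>d\<close> or deeper, denotes the same
  object at all these depths.\<close>

definition lift :: "nat \<Rightarrow> 't::fo_term dtm \<Rightarrow> bool" where
  "lift d x \<longleftrightarrow> (\<forall>e\<ge>d. x (Suc e) = tsubst shift (x e))"

named_theorems sem

lemma lift_fv [sem]: "lift d (fv i)"
  by (simp add: lift_def fv_def tsubst_var)

lemma lift_bound [sem]: "k < d \<Longrightarrow> lift d (\<lambda>e. var (e - Suc k))"
  by (auto simp: lift_def tsubst_var Suc_diff_Suc)

lemma lift_Suc [sem]: "lift d x \<Longrightarrow> lift (Suc d) x"
  by (simp add: lift_def)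

lemma lift_qc [sem]: "lift d x \<Longrightarrow> lift d (qc x)"
  by (simp add: lift_def qc_def tsubst_qtm_def)

lemma eval_lift:
  assumes "evaluation ev" "lift d x"
  shows "ev (case_nat a \<rho>) (x (Suc d)) = ev \<rho> (x d)"
    "ev (case_nat b (case_nat a \<rho>)) (x (Suc (Suc d))) = ev \<rho> (x d)"
    "ev (case_nat c' (case_nat b (case_nat a \<rho>))) (x (Suc (Suc (Suc d)))) = ev \<rho> (x d)"
proof -
  have *: "ev (case_nat a \<rho>) (tsubst shift t) = ev \<rho> t" for a \<rho> t
    by (simp add: evaluation_tsubst[OF assms(1)] evaluation_var[OF assms(1)])
  show "ev (case_nat a \<rho>) (x (Suc d)) = ev \<rho> (x d)"
    "ev (case_nat b (case_nat a \<rho>)) (x (Suc (Suc d))) = ev \<rho> (x d)"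
    "ev (case_nat c' (case_nat b (case_nat a \<rho>))) (x (Suc (Suc (Suc d)))) = ev \<rho> (x d)"
    using assms(2) by (simp_all add: lift_def *)
qed

lemma sat_dNot [sem]: "sat ev I J \<rho> ((\<^bold>\<not> F) d) = (\<not> sat ev I J \<rho> (F d))"
  and sat_dOr [sem]: "sat ev I J \<rho> ((F \<^bold>\<or> G) d) = (sat ev I J \<rho> (F d) \<or> sat ev I J \<rho> (G d))"
  and sat_dAnd [sem]: "sat ev I J \<rho> ((F \<^bold>\<and> G) d) = (sat ev I J \<rho> (F d) \<and> sat ev I J \<rho> (G d))"
  and sat_dImp [sem]: "sat ev I J \<rho> ((F \<^bold>\<longrightarrow> G) d) = (sat ev I J \<rho> (F d) \<longrightarrow> sat ev I J \<rho> (G d))"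
  and sat_dIff [sem]: "sat ev I J \<rho> ((F \<^bold>\<longleftrightarrow> G) d) = (sat ev I J \<rho> (F d) \<longleftrightarrow> sat ev I J \<rho> (G d))"
  by (auto simp: dNot_def dOr_def dAnd_def dImp_def dIff_def)

lemma sat_dAll [sem]: "sat ev I J \<rho> ((dAll P) d) =
    (\<forall>a. sat ev I J (case_nat a \<rho>) (P (\<lambda>e. var (e - Suc d)) (Suc d)))"
  and sat_dEx [sem]: "sat ev I J \<rho> ((dEx P) d) =
    (\<exists>a. sat ev I J (case_nat a \<rho>) (P (\<lambda>e. var (e - Suc d)) (Suc d)))"
  by (simp_all add: dAll_def dEx_def dNot_def)

lemma sat_pr1: "sat ev I J \<rho> (pr1 p x d) = I p (ev \<rho> (x d))"
  and sat_pr2: "sat ev I J \<rho> (pr2 r x y d) = J r (ev \<rho> (x d)) (ev \<rho> (y d))"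
  by (simp_all add: pr1_def pr2_def)

lemma sat_inst [sem]:
  assumes ev: "evaluation ev"
  shows "sat ev I J \<rho> (inst A ts d) =
    sat ev I J (foldr case_nat (map (\<lambda>t. ev \<rho> (t d)) ts) (\<lambda>i. \<rho> (d + i))) A"
proof -
  have "(\<lambda>i. ev \<rho> (if i < length ts then (ts ! i) d else fv (i - length ts) d)) =
      foldr case_nat (map (\<lambda>t. ev \<rho> (t d)) ts) (\<lambda>i. \<rho> (d + i))"
  proof (induction ts)
    case Nil
    show ?case by (rule HOL.ext) (simp add: fv_def evaluation_var[OF ev])
  next
    case (Cons t ts)
    show ?case
      by (rule HOL.ext) (simp add: fun_cong[OF Cons.IH, symmetric] split: nat.split)
  qed
  then show ?thesis by (simp add: inst_def sat_subst[OF ev])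
qed


subsection \<open>Definability by formulas\<close>

text \<open>The even variables are the arguments, and the odd ones enumerate the domain as parameters.\<close>

definition mix :: "(nat \<Rightarrow> 'a::countable) \<Rightarrow> nat \<Rightarrow> 'a" where
  "mix \<rho> i = (if even i then \<rho> (i div 2) else from_nat (i div 2))"

lemma mix_arg [simp]: "mix \<rho> (2 * i) = \<rho> i"
  and mix_par [simp]: "mix \<rho> (Suc (2 * to_nat a)) = a"
  and mix_0 [simp]: "mix \<rho> 0 = \<rho> 0"
  by (simp_all add: mix_def)

locale fo_structure =
  fixes ev :: "(nat \<Rightarrow> 'a::countable) \<Rightarrow> 't::fo_term \<Rightarrow> 'a"
    and I :: "'p \<Rightarrow> 'a \<Rightarrow> bool" and J :: "'r \<Rightarrow> 'a \<Rightarrow> 'a \<Rightarrow> bool"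
  assumes evaluation: "evaluation ev"
begin

definition def_pred :: "((nat \<Rightarrow> 'a) \<Rightarrow> bool) \<Rightarrow> bool" where
  "def_pred P \<longleftrightarrow> (\<exists>A. \<forall>\<rho>. P \<rho> \<longleftrightarrow> sat ev I J (mix \<rho>) A)"

definition def_term :: "((nat \<Rightarrow> 'a) \<Rightarrow> 'a) \<Rightarrow> bool" where
  "def_term t \<longleftrightarrow> (\<exists>u. \<forall>\<rho>. t \<rho> = ev (mix \<rho>) u)"

lemmas ev_var [simp] = evaluation_var[OF evaluation]

lemma def_term_var [dpI]: "def_term (\<lambda>\<rho>. \<rho> k)"
  unfolding def_term_def by (rule exI[of _ "var (2 * k)"]) simp

lemma def_term_const [dpI]: "def_term (\<lambda>_. a)"
  unfolding def_term_def by (rule exI[of _ "var (Suc (2 * to_nat a))"]) simp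

lemma def_pred_pr1 [dpI]: "def_term t \<Longrightarrow> def_pred (\<lambda>\<rho>. I p (t \<rho>))"
  unfolding def_term_def def_pred_def by (metis sat.simps(1))

lemma def_pred_pr2 [dpI]: "def_term s \<Longrightarrow> def_term t \<Longrightarrow> def_pred (\<lambda>\<rho>. J r (s \<rho>) (t \<rho>))"
  unfolding def_term_def def_pred_def by (metis sat.simps(2))

lemma def_pred_sat:
  assumes "\<And>i. def_term (\<lambda>\<rho>. t \<rho> i)"
  shows "def_pred (\<lambda>\<rho>. sat ev I J (t \<rho>) A)"
proof -
  from assms obtain u where u: "\<And>i \<rho>. t \<rho> i = ev (mix \<rho>) (u i)"
    unfolding def_term_def by metis
  have "t \<rho> = (\<lambda>i. ev (mix \<rho>) (u i))" for \<rho> by (rule ext) (rule u)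
  then show ?thesis
    unfolding def_pred_def by (intro exI[of _ "subst u A"]) (simp add: sat_subst[OF evaluation])
qed

lemma def_preds: "definable_preds def_pred"
proof
  show "def_pred (\<lambda>_. True)"
    unfolding def_pred_def by (rule exI[of _ "Or undefined (Neg undefined)"]) simp
  show "def_pred (\<lambda>\<rho>. \<not> P \<rho>)" if "def_pred P" for P
    using that unfolding def_pred_def by (metis sat.simps(3))
  show "def_pred (\<lambda>\<rho>. P \<rho> \<or> R \<rho>)" if "def_pred P" "def_pred R" for P R
    using that unfolding def_pred_def by (metis sat.simps(4))
  show ren: "def_pred (\<lambda>\<rho>. P (\<lambda>n. \<rho> (r n)))" if P: "def_pred P" for P r
  proof -
    obtain A where A: "\<And>\<rho>. P \<rho> \<longleftrightarrow> sat ev I J (mix \<rho>) A" using P by (auto simp: def_pred_def)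
    have "def_term (\<lambda>\<rho>. mix (\<lambda>n. \<rho> (r n)) i)" for i
      unfolding mix_def by (cases "even i") (simp_all add: def_term_var def_term_const)
    then show ?thesis unfolding A by (rule def_pred_sat)
  qed
  show "def_pred (\<lambda>\<rho>. P (case_nat a \<rho>))" if P: "def_pred P" for P a
  proof -
    obtain A where A: "\<And>\<rho>. P \<rho> \<longleftrightarrow> sat ev I J (mix \<rho>) A" using P by (auto simp: def_pred_def)
    have "def_term (\<lambda>\<rho>. mix (case_nat a \<rho>) i)" for i
      unfolding mix_def
      by (cases "even i"; cases "i div 2") (simp_all add: def_term_var def_term_const)
    then show ?thesis unfolding A by (rule def_pred_sat)
  qed
  show "def_pred (\<lambda>\<rho>. \<forall>x. H \<rho> x)" if H: "def_pred (\<lambda>\<rho>. H (\<lambda>n. \<rho> (Suc n)) (\<rho> 0))" for H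
  proof -
    obtain A where A: "\<And>\<rho>. H (\<lambda>n. \<rho> (Suc n)) (\<rho> 0) \<longleftrightarrow> sat ev I J (mix \<rho>) A"
      using H by (auto simp: def_pred_def)
    \<comment> \<open>A new first argument moves the other arguments by two places in
      \<open>mix\<close> and the parameters by none, whereas a quantifier moves every variable by
      one; \<open>?u\<close> mediates between the two.\<close>
    let ?u = "\<lambda>i. if i = 0 then var 0 else if even i then var (i - 1) else shift i"
    have "(\<lambda>i. ev (case_nat a (mix \<rho>)) (?u i)) = mix (case_nat a \<rho>)" for a \<rho>
    proof
      fix i
      consider "i = 0" | k where "i = 2 * Suc k" | k where "i = Suc (2 * k)"
        by (metis even_Suc evenE oddE add.commute plus_1_eq_Suc not0_implies_Suc mult_0_right)
      then show "ev (case_nat a (mix \<rho>)) (?u i) = mix (case_nat a \<rho>) i"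
        by cases (simp_all add: mix_def)
    qed
    then have *: "sat ev I J (case_nat a (mix \<rho>)) (subst ?u A) = H \<rho> a" for \<rho> a
      using A[of "case_nat a \<rho>"] by (simp add: sat_subst[OF evaluation])
    show ?thesis
      unfolding def_pred_def by (intro exI[of _ "All (subst ?u A)"] allI) (simp only: sat.simps *)
  qed
qed

sublocale definable_preds def_pred
  by (rule def_preds)

text \<open>The axiom schemas take a formula together with a valuation of its parameters; everything
  after variable 0 of \<open>mix\<close> becomes that valuation.\<close>

lemma def_pred_unary:
  assumes "def_pred (\<lambda>\<rho>. P (\<rho> 0))"
  obtains A \<sigma> where "\<And>x. P x \<longleftrightarrow> sat ev I J (case_nat x \<sigma>) A"
proof -
  obtain A where A: "\<And>\<rho>. P (\<rho> 0) \<longleftrightarrow> sat ev I J (mix \<rho>) A"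
    using assms by (auto simp: def_pred_def)
  let ?\<sigma> = "\<lambda>i. mix (\<lambda>_. undefined) (Suc i)"
  have "mix (case_nat x (\<lambda>_. undefined)) = case_nat x ?\<sigma>" for x :: 'a
    by (rule ext) (auto simp: mix_def split: nat.split)
  then show thesis using A[of "case_nat x (\<lambda>_. undefined)" for x] by (intro that[where A = A and \<sigma> = ?\<sigma>]) simp
qed

lemma def_pred_binary:
  assumes "def_pred (\<lambda>\<rho>. R (\<rho> 0) (\<rho> (Suc 0)))"
  obtains A \<sigma> where "\<And>x y. R x y \<longleftrightarrow> sat ev I J (case_nat x (case_nat y \<sigma>)) A"
proof -
  obtain A where A: "\<And>\<rho>. R (\<rho> 0) (\<rho> (Suc 0)) \<longleftrightarrow> sat ev I J (mix \<rho>) A"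
    using assms by (auto simp: def_pred_def)
  let ?\<sigma> = "mix (\<lambda>_. undefined)"
  \<comment> \<open>The second argument has index 2 in \<open>mix\<close> but index 1 in the
    schemas.\<close>
  let ?u = "\<lambda>i. if i = 0 then var 0 else if i = 2 then var 1 else var (Suc (Suc i))"
  have "(\<lambda>i. ev (case_nat x (case_nat y ?\<sigma>)) (?u i)) =
      mix (case_nat x (case_nat y (\<lambda>_. undefined)))" for x y
  proof
    fix i
    consider "i = 0" | "i = 1" | "i = 2" | k where "i = Suc (Suc (Suc k))"
      by (metis One_nat_def numeral_2_eq_2 not0_implies_Suc)
    then show "ev (case_nat x (case_nat y ?\<sigma>)) (?u i) =
        mix (case_nat x (case_nat y (\<lambda>_. undefined))) i"
      by cases (auto simp: mix_def split: nat.split)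
  qed
  then show thesis
    using A[of "case_nat x (case_nat y (\<lambda>_. undefined))" for x y]
    by (intro that[where \<sigma> = ?\<sigma> and A = "subst ?u A"]) (simp add: sat_subst[OF evaluation])
qed

end


section \<open>Structures for the two languages\<close>

definition uev :: "(nat \<Rightarrow> 'a) \<Rightarrow> nat \<Rightarrow> 'a" where
  "uev \<rho> n = \<rho> n"

lemma evaluation_uev: "evaluation uev"
  by (simp add: evaluation_def uev_def var_nat_def tsubst_nat_def)

primrec uI :: "('a \<Rightarrow> bool) \<Rightarrow> zpred1 \<Rightarrow> 'a \<Rightarrow> bool" where
  "uI isS SetU = isS"

primrec uJ :: "('a \<Rightarrow> 'a \<Rightarrow> bool) \<Rightarrow> ('a \<Rightarrow> 'a \<Rightarrow> bool) \<Rightarrow> zpred2 \<Rightarrow> 'a \<Rightarrow> 'a \<Rightarrow> bool" where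
  "uJ eq mem EqU = eq"
| "uJ eq mem MemU = mem"

lemma sat_S [sem]: "sat uev (uI s) (uJ e f) \<rho> (S x d) = s (\<rho> (x d))"
  and sat_equ [sem]: "sat uev (uI s) (uJ e f) \<rho> ((x =\<^sub>U y) d) = e (\<rho> (x d)) (\<rho> (y d))"
  and sat_memu [sem]: "sat uev (uI s) (uJ e f) \<rho> ((x \<in>\<^sub>U y) d) = f (\<rho> (x d)) (\<rho> (y d))"
  by (simp_all add: S_def equ_def memu_def sat_pr1 sat_pr2 uev_def)

lemma var_nat [sem]: "(var n :: nat) = n"
  by (simp add: var_nat_def)

lemma lift_bound_nat [sem]: "k < d \<Longrightarrow> lift d (\<lambda>e. e - Suc k :: nat)"
  by (auto simp: lift_def tsubst_nat_def var_nat_def)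

lemma lift_nat:
  assumes "lift d x"
  shows "x (Suc d) = Suc (x d)" "x (Suc (Suc d)) = Suc (Suc (x d))"
    "x (Suc (Suc (Suc d))) = Suc (Suc (Suc (x d)))"
  using assms by (simp_all add: lift_def tsubst_nat_def var_nat_def)

lemma sat_inst_uev [sem]: "sat uev I J \<rho> (inst A ts d) =
    sat uev I J (foldr case_nat (map (\<lambda>t. \<rho> (t d)) ts) (\<lambda>i. \<rho> (d + i))) A"
  by (simp only: sat_inst[OF evaluation_uev]) (simp only: uev_def)

lemma sat_subst_uev: "sat uev I J \<rho> (subst \<sigma> A) = sat uev I J (\<lambda>i. \<rho> (\<sigma> i)) A"
  by (simp only: sat_subst[OF evaluation_uev]) (simp only: uev_def)

context zfu0
begin

abbreviation satN :: "(nat \<Rightarrow> 'a) \<Rightarrow> zfm \<Rightarrow> bool" where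
  "satN \<equiv> sat uev (uI isS) (uJ (=) mem)"

lemma satN_emptyu [sem]: "lift d x \<Longrightarrow> satN \<rho> (emptyu x d) = is_empty (\<rho> (x d))"
  by (simp add: emptyu_def is_empty_def sem lift_nat)

lemma satN_oneu [sem]: "lift d x \<Longrightarrow> satN \<rho> (oneu x d) = is_one (\<rho> (x d))"
  by (simp add: oneu_def is_one_def sem lift_nat)

lemma satN_succu [sem]:
  "lift d x \<Longrightarrow> lift d y \<Longrightarrow> satN \<rho> (succu x y d) = is_succ (\<rho> (x d)) (\<rho> (y d))"
  by (simp add: succu_def is_succ_def sem lift_nat)

lemma satN_upairu [sem]: "lift d p \<Longrightarrow> lift d x \<Longrightarrow> lift d y \<Longrightarrow>
    satN \<rho> (upairu p x y d) = is_upair (\<rho> (p d)) (\<rho> (x d)) (\<rho> (y d))"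
  by (simp add: upairu_def is_upair_def sem lift_nat)

lemma satN_opairu [sem]: "lift d p \<Longrightarrow> lift d x \<Longrightarrow> lift d y \<Longrightarrow>
    satN \<rho> (opairu p x y d) = is_opair (\<rho> (p d)) (\<rho> (x d)) (\<rho> (y d))"
  by (simp add: opairu_def is_opair_def sem lift_nat)

lemma satN_appu [sem]: "lift d p \<Longrightarrow> lift d x \<Longrightarrow> lift d y \<Longrightarrow>
    satN \<rho> (appu p x y d) = is_app (\<rho> (p d)) (\<rho> (x d)) (\<rho> (y d))"
  by (simp add: appu_def is_app_def sem lift_nat)

lemma satN_funu [sem]: "lift d p \<Longrightarrow> lift d x \<Longrightarrow> lift d y \<Longrightarrow>
    satN \<rho> (funu p x y d) = is_fun (\<rho> (p d)) (\<rho> (x d)) (\<rho> (y d))"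
  by (simp add: funu_def is_fun_def sem lift_nat)

lemma satN_bijectionu [sem]: "lift d p \<Longrightarrow> lift d x \<Longrightarrow> lift d y \<Longrightarrow>
    satN \<rho> (bijectionu p x y d) = is_bij (\<rho> (p d)) (\<rho> (x d)) (\<rho> (y d))"
  by (simp add: bijectionu_def is_bij_def sem lift_nat)

lemma satN_eqpollu [sem]:
  "lift d x \<Longrightarrow> lift d y \<Longrightarrow> satN \<rho> (eqpollu x y d) = eqpoll (\<rho> (x d)) (\<rho> (y d))"
  by (simp add: eqpollu_def eqpoll_def sem lift_nat)

lemma satN_ordu [sem]: "lift d x \<Longrightarrow> satN \<rho> (ordu x d) = ordinal (\<rho> (x d))"
  by (simp add: ordu_def ordinal_def sem lift_nat)

lemma satN_natu [sem]: "lift d x \<Longrightarrow> satN \<rho> (natu x d) = natural (\<rho> (x d))"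
  by (simp add: natu_def natural_def sem lift_nat)

lemma satN_cardu [sem]: "lift d x \<Longrightarrow> satN \<rho> (cardu x d) = cardinal (\<rho> (x d))"
  by (simp add: cardu_def cardinal_def sem lift_nat)

lemma satN_cardofu [sem]:
  "lift d x \<Longrightarrow> lift d y \<Longrightarrow> satN \<rho> (cardofu x y d) = card_of (\<rho> (x d)) (\<rho> (y d))"
  by (simp add: cardofu_def card_of_def sem lift_nat)

lemma satN_leu [sem]: "satN \<rho> (leu x y d) = (\<rho> (x d) \<epsilon> \<rho> (y d) \<or> \<rho> (x d) = \<rho> (y d))"
  by (simp add: leu_def sem)

lemma satN_lessu [sem]: "satN \<rho> (lessu x y d) \<longleftrightarrow> \<rho> (x d) \<epsilon> \<rho> (y d)"
  by (simp add: lessu_def sem)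

lemma satN_addu [sem]: "lift d x \<Longrightarrow> lift d y \<Longrightarrow> lift d z \<Longrightarrow>
    satN \<rho> (addu x y z d) = is_add (\<rho> (x d)) (\<rho> (y d)) (\<rho> (z d))"
  by (simp add: addu_def is_add_def sem lift_nat)

lemma satN_pow2u [sem]:
  "lift d x \<Longrightarrow> lift d y \<Longrightarrow> satN \<rho> (pow2u x y d) = is_pow2 (\<rho> (x d)) (\<rho> (y d))"
  by (simp add: pow2u_def is_pow2_def sem lift_nat)

end

section \<open>Structures for the language of quasi-set theory\<close>

primrec qev :: "('a \<Rightarrow> 'a) \<Rightarrow> (nat \<Rightarrow> 'a) \<Rightarrow> qtm \<Rightarrow> 'a" where
  "qev c \<rho> (QVar n) = \<rho> n"
| "qev c \<rho> (QC t) = c (qev c \<rho> t)"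

lemma evaluation_qev [sem]: "evaluation (qev c)"
proof -
  have "qev c \<rho> (qsubst \<sigma> t) = qev c (\<lambda>i. qev c \<rho> (\<sigma> i)) t" for \<rho> \<sigma> t
    by (induction t) simp_all
  then show ?thesis by (simp add: evaluation_def var_qtm_def tsubst_qtm_def)
qed

lemma qev_var [sem]: "qev c \<rho> (var n) = \<rho> n"
  and qev_fv [sem]: "qev c \<rho> (fv i d) = \<rho> (d + i)"
  and qev_qc [sem]: "qev c \<rho> (qc x d) = c (qev c \<rho> (x d))"
  by (simp_all add: var_qtm_def fv_def qc_def)

primrec qI :: "('a \<Rightarrow> bool) \<Rightarrow> ('a \<Rightarrow> bool) \<Rightarrow> ('a \<Rightarrow> bool) \<Rightarrow> qpred1 \<Rightarrow> 'a \<Rightarrow> bool" where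
  "qI micro macro zset Micro = micro"
| "qI micro macro zset Macro = macro"
| "qI micro macro zset SetQ = zset"

primrec qJ :: "('a \<Rightarrow> 'a \<Rightarrow> bool) \<Rightarrow> ('a \<Rightarrow> 'a \<Rightarrow> bool) \<Rightarrow> qpred2 \<Rightarrow> 'a \<Rightarrow> 'a \<Rightarrow> bool" where
  "qJ ind mem Indist = ind"
| "qJ ind mem MemQ = mem"

locale qstruct =
  fixes c :: "'a \<Rightarrow> 'a" and micro macro zset :: "'a \<Rightarrow> bool"
    and ind :: "'a \<Rightarrow> 'a \<Rightarrow> bool" (infix "\<simeq>" 50)
    and qmem :: "'a \<Rightarrow> 'a \<Rightarrow> bool" (infix "\<in>\<^sub>q" 50)
begin

abbreviation satQ :: "(nat \<Rightarrow> 'a) \<Rightarrow> qfm \<Rightarrow> bool" where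
  "satQ \<equiv> sat (qev c) (qI micro macro zset) (qJ ind qmem)"

definition qset :: "'a \<Rightarrow> bool" where
  "qset x \<longleftrightarrow> \<not> (micro x \<or> macro x)"

definition isD :: "'a \<Rightarrow> bool" where
  "isD x \<longleftrightarrow> macro x \<or> zset x"

definition eqe :: "'a \<Rightarrow> 'a \<Rightarrow> bool" where
  "eqe x y \<longleftrightarrow> qset x \<and> qset y \<and> (\<forall>z. z \<in>\<^sub>q x \<longleftrightarrow> z \<in>\<^sub>q y) \<or>
     macro x \<and> macro y \<and> (\<forall>z. qset z \<longrightarrow> (x \<in>\<^sub>q z \<longleftrightarrow> y \<in>\<^sub>q z))"

definition qempty :: "'a \<Rightarrow> bool" where
  "qempty x \<longleftrightarrow> qset x \<and> (\<forall>t. \<not> t \<in>\<^sub>q x)"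

definition qsub :: "'a \<Rightarrow> 'a \<Rightarrow> bool" where
  "qsub x y \<longleftrightarrow> (\<forall>z. z \<in>\<^sub>q x \<longrightarrow> z \<in>\<^sub>q y)"

definition qquot :: "'a \<Rightarrow> 'a \<Rightarrow> bool" where
  "qquot w x \<longleftrightarrow> qset w \<and> (\<forall>z. z \<in>\<^sub>q w \<longleftrightarrow>
     qset z \<and> (\<exists>s. s \<in>\<^sub>q x \<and> (\<forall>t. t \<in>\<^sub>q z \<longleftrightarrow> t \<in>\<^sub>q x \<and> t \<simeq> s)))"

lemma satQ_atoms [sem]: "satQ \<rho> (m x d) = micro (qev c \<rho> (x d))"
  "satQ \<rho> (M x d) = macro (qev c \<rho> (x d))" "satQ \<rho> (Z x d) = zset (qev c \<rho> (x d))"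
  "satQ \<rho> ((x \<^bold>\<equiv> y) d) \<longleftrightarrow> qev c \<rho> (x d) \<simeq> qev c \<rho> (y d)"
  "satQ \<rho> ((x \<^bold>\<in> y) d) \<longleftrightarrow> qev c \<rho> (x d) \<in>\<^sub>q qev c \<rho> (y d)"
  by (simp_all add: m_def M_def Z_def indist_def memq_def sat_pr1 sat_pr2)

lemma satQ_Q [sem]: "satQ \<rho> (Q x d) = qset (qev c \<rho> (x d))"
  and satQ_D [sem]: "satQ \<rho> (D x d) = isD (qev c \<rho> (x d))"
  by (simp_all add: Q_def D_def qset_def isD_def sem)

lemma satQ_AllQ [sem]: "satQ \<rho> ((AllQ P) d) =
    (\<forall>a. qset a \<longrightarrow> satQ (case_nat a \<rho>) (P (\<lambda>e. var (e - Suc d)) (Suc d)))"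
  and satQ_ExQ [sem]: "satQ \<rho> ((ExQ P) d) =
    (\<exists>a. qset a \<and> satQ (case_nat a \<rho>) (P (\<lambda>e. var (e - Suc d)) (Suc d)))"
  and satQ_AllD [sem]: "satQ \<rho> ((AllD P) d) =
    (\<forall>a. isD a \<longrightarrow> satQ (case_nat a \<rho>) (P (\<lambda>e. var (e - Suc d)) (Suc d)))"
  by (simp_all add: AllQ_def ExQ_def AllD_def sem)

lemmas qev_lift = eval_lift[OF evaluation_qev]

lemma satQ_E [sem]: "lift d x \<Longrightarrow> satQ \<rho> (E x d) =
    (qset (qev c \<rho> (x d)) \<and> (\<forall>y. y \<in>\<^sub>q qev c \<rho> (x d) \<longrightarrow> qset y))"
  by (simp add: E_def sem qev_lift)

lemma satQ_eqE [sem]: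
  "lift d x \<Longrightarrow> lift d y \<Longrightarrow> satQ \<rho> ((x =\<^sub>E y) d) = eqe (qev c \<rho> (x d)) (qev c \<rho> (y d))"
  by (simp add: eqE_def eqe_def sem qev_lift)

lemma satQ_neqE [sem]:
  "lift d x \<Longrightarrow> lift d y \<Longrightarrow> satQ \<rho> ((x \<noteq>\<^sub>E y) d) = (\<not> eqe (qev c \<rho> (x d)) (qev c \<rho> (y d)))"
  by (simp add: neqE_def sem)

lemma satQ_subq [sem]:
  "lift d x \<Longrightarrow> lift d y \<Longrightarrow> satQ \<rho> ((x \<^bold>\<subseteq> y) d) = qsub (qev c \<rho> (x d)) (qev c \<rho> (y d))"
  by (simp add: subq_def qsub_def sem qev_lift)

lemma satQ_psubq [sem]: "lift d x \<Longrightarrow> lift d y \<Longrightarrow> satQ \<rho> ((x \<^bold>\<subset> y) d) =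
    (qsub (qev c \<rho> (x d)) (qev c \<rho> (y d)) \<and> \<not> eqe (qev c \<rho> (x d)) (qev c \<rho> (y d)))"
  by (simp add: psubq_def sem)

lemma satQ_emptyq [sem]: "lift d x \<Longrightarrow> satQ \<rho> (emptyq x d) = qempty (qev c \<rho> (x d))"
  by (simp add: emptyq_def qempty_def sem qev_lift)

lemma satQ_pairq [sem]: "lift d w \<Longrightarrow> lift d x \<Longrightarrow> lift d y \<Longrightarrow> satQ \<rho> (pairq w x y d) =
    (qset (qev c \<rho> (w d)) \<and> (\<forall>t. t \<in>\<^sub>q qev c \<rho> (w d) \<longleftrightarrow>
      t \<simeq> qev c \<rho> (x d) \<or> t \<simeq> qev c \<rho> (y d)))"
  by (simp add: pairq_def sem qev_lift)

lemma satQ_unq [sem]: "lift d w \<Longrightarrow> lift d x \<Longrightarrow> lift d y \<Longrightarrow> satQ \<rho> (unq w x y d) =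
    (qset (qev c \<rho> (w d)) \<and> (\<forall>t. t \<in>\<^sub>q qev c \<rho> (w d) \<longleftrightarrow>
      t \<in>\<^sub>q qev c \<rho> (x d) \<or> t \<in>\<^sub>q qev c \<rho> (y d)))"
  by (simp add: unq_def sem qev_lift)

lemma satQ_interq [sem]: "lift d w \<Longrightarrow> lift d x \<Longrightarrow> lift d y \<Longrightarrow> satQ \<rho> (interq w x y d) =
    (qset (qev c \<rho> (w d)) \<and> (\<forall>t. t \<in>\<^sub>q qev c \<rho> (w d) \<longleftrightarrow>
      t \<in>\<^sub>q qev c \<rho> (x d) \<and> t \<in>\<^sub>q qev c \<rho> (y d)))"
  by (simp add: interq_def sem qev_lift)

lemma satQ_powq [sem]: "lift d w \<Longrightarrow> lift d x \<Longrightarrow> satQ \<rho> (powq w x d) =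
    (qset (qev c \<rho> (w d)) \<and> (\<forall>t. t \<in>\<^sub>q qev c \<rho> (w d) \<longleftrightarrow>
      qset t \<and> qsub t (qev c \<rho> (x d))))"
  by (simp add: powq_def sem qev_lift)

lemma satQ_quotq [sem]:
  "lift d w \<Longrightarrow> lift d x \<Longrightarrow> satQ \<rho> (quotq w x d) = qquot (qev c \<rho> (w d)) (qev c \<rho> (x d))"
  by (simp add: quotq_def qquot_def sem qev_lift)

lemma satQ_QSim [sem]: "lift d x \<Longrightarrow> lift d y \<Longrightarrow> satQ \<rho> (QSim x y d) =
    ((\<forall>z t. z \<in>\<^sub>q qev c \<rho> (x d) \<and> t \<in>\<^sub>q qev c \<rho> (y d) \<longrightarrow> z \<simeq> t) \<and>
      eqe (c (qev c \<rho> (x d))) (c (qev c \<rho> (y d))))"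
  by (simp add: QSim_def Sim_def sem qev_lift)

lemma satQ_inD [sem]:
  "satQ \<rho> (inD1 F1 x d) = satQ (case_nat (qev c \<rho> (x d)) (\<lambda>i. \<rho> (d + i))) (tr (F1 (fv 0) 0))"
  "satQ \<rho> (inD2 F2 x y d) = satQ (case_nat (qev c \<rho> (x d)) (case_nat (qev c \<rho> (y d))
    (\<lambda>i. \<rho> (d + i)))) (tr (F2 (fv 0) (fv 1) 0))"
  "satQ \<rho> (inD3 F3 x y z d) = satQ (case_nat (qev c \<rho> (x d)) (case_nat (qev c \<rho> (y d))
    (case_nat (qev c \<rho> (z d)) (\<lambda>i. \<rho> (d + i))))) (tr (F3 (fv 0) (fv 1) (fv 2) 0))"
  by (simp_all add: inD1_def inD2_def inD3_def sem)

lemma satQ_Fin [sem]: "satQ \<rho> (Fin x d) =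
    satQ (case_nat (c (qev c \<rho> (x d))) (\<lambda>i. \<rho> (d + i))) (tr (natu (fv 0) 0))"
  by (simp add: Fin_def sem)

lemma satQ_tr [sem]:
  "satQ \<rho> (tr (Pr1 SetU x)) = zset (\<rho> x)"
  "satQ \<rho> (tr (Pr2 EqU x y)) =
    ((macro (\<rho> x) \<and> macro (\<rho> y) \<or> zset (\<rho> x) \<and> zset (\<rho> y)) \<and> eqe (\<rho> x) (\<rho> y))"
  "satQ \<rho> (tr (Pr2 MemU x y)) = (isD (\<rho> x) \<and> zset (\<rho> y) \<and> \<rho> x \<in>\<^sub>q \<rho> y)"
  "satQ \<rho> (tr (All A)) = (\<forall>a. isD a \<longrightarrow> satQ (case_nat a \<rho>) (tr A))"
  by (auto simp: sem isD_def)

end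


section \<open>The structure of quasi-set theory over a universe of ZFU\<close>

context zfu
begin

interpretation qstruct crd "\<lambda>_. False" "\<lambda>x. \<not> isS x" isS "(=)" mem .

lemma qset_iff [simp]: "qset x \<longleftrightarrow> isS x"
  by (simp add: qset_def)

lemma isD_True [simp]: "isD x"
  by (simp add: isD_def)

text \<open>Sets are separated by extensionality, urelements by their singletons.\<close>

lemma eqe_iff [simp]: "eqe x y \<longleftrightarrow> x = y"
proof
  assume "eqe x y"
  then show "x = y"
    unfolding eqe_def qset_iff using ext_ax mem_upair isS_upair by blast
qed (auto simp: eqe_def)

text \<open>Every object is a set or an \<open>M\<close>-atom here, so the bound on quantifiers is
  void, and the conjuncts that \<open>tr\<close> adds to an atomic formula hold whenever that
  formula does.\<close>

lemma satQ_tr_iff: "satQ \<rho> (tr A) = satN \<rho> A"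
proof (induction A arbitrary: \<rho>)
  case (Pr1 p x)
  then show ?case by (cases p) (simp add: satQ_tr uev_def del: tr.simps)
next
  case (Pr2 r x y)
  then show ?case by (cases r) (auto simp: satQ_tr uev_def mem_isS simp del: tr.simps)
next
  case (All A)
  then show ?case by (simp add: satQ_tr del: tr.simps)
qed simp_all

text \<open>The formulas in Q13 and Q27 may contain \<open>qc\<close>; definability of
  \<open>crd\<close> reduces their instances to separation and replacement in the universe of
  ZFU.\<close>

lemma dp_satQ:
  assumes "\<And>i. dt (\<lambda>\<rho>. t \<rho> i)"
  shows "dp (\<lambda>\<rho>. satQ (t \<rho>) A)"
  using assms
proof (induction A arbitrary: t)
  case (Pr1 p u)
  have "dt (\<lambda>\<rho>. qev crd (t \<rho>) u)"
    by (induction u) (simp_all add: Pr1 dt_crd)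
  then show ?case by (cases p) (simp_all add: dp_const dp_not dp_isS)
next
  case (Pr2 r u v)
  have "dt (\<lambda>\<rho>. qev crd (t \<rho>) u)" for u
    by (induction u) (simp_all add: Pr2 dt_crd)
  then show ?case by (cases r) (simp_all add: dp_eq dp_mem)
next
  case (Neg A)
  then show ?case by (simp add: dp_not)
next
  case (Or A B)
  then show ?case by (simp add: dp_or)
next
  case (All A)
  have "dt (\<lambda>\<rho>. case_nat (\<rho> 0) (t (\<lambda>n. \<rho> (Suc n))) i)" for i
    using dt_shift[OF All.prems] by (cases i) (simp_all add: dt_var)
  then have "dp (\<lambda>\<rho>. satQ (case_nat (\<rho> 0) (t (\<lambda>n. \<rho> (Suc n)))) A)" by (rule All.IH)
  then show ?case by (simp add: dp_all[where H = "\<lambda>\<rho> x. satQ (case_nat x (t \<rho>)) A"])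
qed

end

lemma fv_nat [sem]: "(fv i d :: nat) = d + i"
  by (simp add: fv_def var_nat_def)

context zfu
begin

interpretation qstruct crd "\<lambda>_. False" "\<lambda>x. \<not> isS x" isS "(=)" mem .

lemma QST_valid: "B \<in> QST \<Longrightarrow> satQ \<rho> B"
proof (induction arbitrary: \<rho> rule: QST.induct)
  case Q6
  show ?case by (auto simp add: sem intro: mem_isS)
next
  case Q10
  show ?case by (simp add: sem) (rule exI[of _ emp], simp)
next
  case Q12
  have "\<exists>z. isS z \<and> (\<forall>t. t \<epsilon> z \<longleftrightarrow> t = x \<or> t = y)" for x y
    by (rule exI[of _ "upair x y"]) simp
  then show ?case by (simp add: sem)
next
  case (Q13 A)
  have "dp (\<lambda>\<tau>. satQ (case_nat (\<tau> 0) (case_nat x \<rho>)) A)" for x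
    by (intro dp_satQ dt_case_nat dt_var dt_const)
  then show ?case using sep_ax by (simp add: sem)
next
  case Q14
  show ?case using union_ax by (simp add: sem)
next
  case Q15
  show ?case using power_ax by (simp add: sem qsub_def)
next
  case Q16
  obtain x where x: "emp \<epsilon> x" "\<And>y. y \<epsilon> x \<Longrightarrow> isS y \<Longrightarrow> succ y \<epsilon> x"
    using infinity_ax by blast
  then have "isS x" using mem_isS by blast
  moreover have "\<exists>e. qempty e \<and> e \<epsilon> x" using x(1) by (intro exI[of _ emp]) (simp add: qempty_def)
  moreover have "\<exists>s w. (isS s \<and> (\<forall>t. t \<epsilon> s \<longleftrightarrow> t = y)) \<and>
      (isS w \<and> (\<forall>t. t \<epsilon> w \<longleftrightarrow> t \<epsilon> y \<or> t \<epsilon> s)) \<and> w \<epsilon> x" if "y \<epsilon> x" "isS y" for y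
    using x(2)[OF that] by (intro exI[of _ "upair y y"] exI[of _ "succ y"]) simp
  ultimately show ?case by (simp add: sem; blast)
next
  case Q17
  have "\<exists>y. isS y \<and> y \<epsilon> x \<and> (\<exists>w. (isS w \<and> (\<forall>t. t \<epsilon> w \<longleftrightarrow> t \<epsilon> y \<and> t \<epsilon> x)) \<and> qempty w)"
    if x: "isS x" "\<forall>y. y \<epsilon> x \<longrightarrow> isS y" "\<exists>e. qempty e \<and> x \<noteq> e" for x
  proof -
    obtain t where "t \<epsilon> x" using x(1,3) ext_ax unfolding qempty_def qset_iff by blast
    from found_ax[OF this] obtain y where "y \<epsilon> x" "\<forall>z. z \<epsilon> y \<longrightarrow> \<not> z \<epsilon> x" by blast
    then show ?thesis
      using x(2) by (intro exI[of _ y] conjI exI[of _ emp]) (auto simp: qempty_def)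
  qed
  then show ?case by (simp add: sem)
next
  case Q18
  have "is_empty (crd x)" if "\<not> isS x" for x using that by (simp add: crd_def is_empty_iff)
  then show ?case by (simp add: sem satQ_tr_iff)
next
  case Q19a
  show ?case by (simp add: sem satQ_tr_iff cardinal_crd)
next
  case Q19b
  show ?case by (simp add: sem satQ_tr_iff card_of_crd)
next
  case Q20
  have "\<exists>n. is_empty n \<and> crd x \<noteq> n" if "isS x" "\<exists>e. qempty e \<and> x \<noteq> e" for x
  proof -
    have "x \<noteq> emp" using that(2) unfolding qempty_def qset_iff by (auto intro: ext_ax)
    then show ?thesis using crd_emp_iff[OF that(1)] by (simp add: is_empty_iff)
  qed
  then show ?case by (simp add: sem satQ_tr_iff; blast)
next
  case Q21
  show ?case using crd_subset_ex by (simp add: sem satQ_tr_iff qsub_def; blast)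
next
  case Q22
  show ?case using crd_mono by (simp add: sem satQ_tr_iff qsub_def)
next
  case Q23
  show ?case using crd_strict_mono by (simp add: sem satQ_tr_iff qsub_def)
next
  case Q24
  have "\<exists>w. (isS w \<and> (\<forall>t. t \<epsilon> w \<longleftrightarrow> t \<epsilon> x \<or> t \<epsilon> y)) \<and> is_add (crd x) (crd y) (crd w)"
    if "isS x" "isS y" "\<forall>t. t \<epsilon> x \<longrightarrow> \<not> t \<epsilon> y" for x y
  proof -
    have s: "small (\<lambda>t. t \<epsilon> x \<or> t \<epsilon> y)" by (rule small_or[OF small_mem small_mem])
    show ?thesis
      using that isS_setof[OF s] mem_setof[OF s] crd_is_add[of x y "setof (\<lambda>t. t \<epsilon> x \<or> t \<epsilon> y)"]
      by blast
  qed
  then show ?case by (simp add: sem satQ_tr_iff)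
next
  case Q25
  have "\<exists>p. (isS p \<and> (\<forall>t. t \<epsilon> p \<longleftrightarrow> isS t \<and> qsub t x)) \<and> is_pow2 (crd x) (crd p)"
    if x: "isS x" for x
    using power_ax[OF x] crd_is_pow2[OF x] unfolding qsub_def by blast
  then show ?case by (simp add: sem satQ_tr_iff)
next
  \<comment> \<open>Indistinguishability being equality, the classes of a quotient are singletons,
    and singletons related by \<open>QSim\<close> are equal.\<close>
  case Q26
  have "x = y"
    if x: "isS x" "isS y" "qquot a x" "qquot b y"
      and ab: "\<forall>z. z \<epsilon> a \<longrightarrow> (\<exists>t. t \<epsilon> b \<and> (\<forall>u v. u \<epsilon> z \<and> v \<epsilon> t \<longrightarrow> u = v) \<and> crd z = crd t)"
      and ba: "\<forall>t. t \<epsilon> b \<longrightarrow> (\<exists>z. z \<epsilon> a \<and> (\<forall>u v. u \<epsilon> t \<and> v \<epsilon> z \<longrightarrow> u = v) \<and> crd t = crd z)"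
    for x y a b
  proof -
    have quot: "z \<epsilon> w \<longleftrightarrow> (\<exists>s. s \<epsilon> v \<and> z = upair s s)" if "qquot w v" for w v z
    proof -
      have "isS z \<and> (\<forall>t. t \<epsilon> z \<longleftrightarrow> t \<epsilon> v \<and> t = s) \<longleftrightarrow> z = upair s s" if "s \<epsilon> v" for s
      proof
        assume z: "isS z \<and> (\<forall>t. t \<epsilon> z \<longleftrightarrow> t \<epsilon> v \<and> t = s)"
        show "z = upair s s" by (rule ext_ax) (use z \<open>s \<epsilon> v\<close> in auto)
      qed (use that in auto)
      then have "(\<exists>s. s \<epsilon> v \<and> isS z \<and> (\<forall>t. t \<epsilon> z \<longleftrightarrow> t \<epsilon> v \<and> t = s)) \<longleftrightarrow>
          (\<exists>s. s \<epsilon> v \<and> z = upair s s)" by blast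
      then show ?thesis using that unfolding qquot_def qset_iff by blast
    qed
    show ?thesis
    proof (rule ext_ax[OF x(1,2)])
      fix s
      show "s \<epsilon> x \<longleftrightarrow> s \<epsilon> y"
      proof
        assume "s \<epsilon> x"
        then have "upair s s \<epsilon> a" using quot[OF x(3)] by blast
        then obtain t where t: "t \<epsilon> b" "\<forall>u v. u \<epsilon> upair s s \<and> v \<epsilon> t \<longrightarrow> u = v" using ab by blast
        from t(1) obtain r where "r \<epsilon> y" "t = upair r r" using quot[OF x(4)] by blast
        then show "s \<epsilon> y" using t(2)[rule_format, of s r] by simp
      next
        assume "s \<epsilon> y"
        then have "upair s s \<epsilon> b" using quot[OF x(4)] by blast
        then obtain t where t: "t \<epsilon> a" "\<forall>u v. u \<epsilon> upair s s \<and> v \<epsilon> t \<longrightarrow> u = v" using ba by blast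
        from t(1) obtain r where "r \<epsilon> x" "t = upair r r" using quot[OF x(3)] by blast
        then show "s \<epsilon> x" using t(2)[rule_format, of s r] by simp
      qed
    qed
  qed
  then show ?case by (simp add: sem; blast)
next
  case (Q27 A)
  let ?R = "\<lambda>x y. satQ (case_nat x (case_nat y \<rho>)) A"
  have "dp (\<lambda>\<tau>. ?R (\<tau> 0) (\<tau> (Suc 0)))"
    by (intro dp_satQ dt_case_nat dt_var dt_const)
  then have "\<exists>v. isS v \<and> (\<forall>y. y \<epsilon> v \<longleftrightarrow> (\<exists>x. x \<epsilon> u \<and> ?R x y))"
    if "isS u" "\<And>x y y'. ?R x y \<Longrightarrow> ?R x y' \<Longrightarrow> y = y'" for u
    using repl_ax[of u ?R] that by blast
  then show ?case by (simp add: sem; blast)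
next
  case Q28
  have "\<exists>u. isS u \<and> (\<forall>y v. y \<epsilon> x \<and> v \<epsilon> y \<longrightarrow> (\<exists>w. isS w \<and>
      (\<exists>s. (isS s \<and> (\<forall>t. t \<epsilon> s \<longleftrightarrow> t = v)) \<and> qsub w s) \<and> is_one (crd w) \<and>
      (\<exists>a. (isS a \<and> (\<forall>t. t \<epsilon> a \<longleftrightarrow> t \<epsilon> w \<and> t \<epsilon> y)) \<and>
        (isS a \<and> (\<forall>t. t \<epsilon> a \<longleftrightarrow> t \<epsilon> w \<and> t \<epsilon> u)))))" for x
  proof (rule exI[of _ "setof (\<lambda>z. \<exists>t. z \<epsilon> t \<and> t \<epsilon> x)"], intro conjI allI impI)
    show "isS (setof (\<lambda>z. \<exists>t. z \<epsilon> t \<and> t \<epsilon> x))" by (rule isS_setof[OF small_Union])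
    fix y v assume "y \<epsilon> x \<and> v \<epsilon> y"
    \<comment> \<open>The witness \<open>w\<close> is the singleton of \<open>v\<close>. It is
      included in \<open>y\<close> and in the union, so both intersections equal it.\<close>
    then show "\<exists>w. isS w \<and> (\<exists>s. (isS s \<and> (\<forall>t. t \<epsilon> s \<longleftrightarrow> t = v)) \<and> qsub w s) \<and> is_one (crd w) \<and>
      (\<exists>a. (isS a \<and> (\<forall>t. t \<epsilon> a \<longleftrightarrow> t \<epsilon> w \<and> t \<epsilon> y)) \<and>
        (isS a \<and> (\<forall>t. t \<epsilon> a \<longleftrightarrow> t \<epsilon> w \<and> t \<epsilon> setof (\<lambda>z. \<exists>t. z \<epsilon> t \<and> t \<epsilon> x))))"
      by (intro exI[of _ "upair v v"] conjI)
        (auto simp: mem_setof[OF small_Union] qsub_def is_one_iff crd_singleton)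
  qed
  then show ?case by (simp add: sem satQ_tr_iff; blast)
qed (simp_all add: sem)

end

section \<open>From quasi-set theory to ZFU\<close>

subsection \<open>Normal models\<close>

text \<open>Representatives of finitely many classes could be adjoined one by one to form a
  universal set, against Russell's argument. \<open>eq\<close> and \<open>mem\<close> are left open
  so that this serves both a model of ZFU and the classical objects.\<close>

lemma infinite_universe:
  fixes dom :: "'b \<Rightarrow> bool" and eq mem :: "'b \<Rightarrow> 'b \<Rightarrow> bool"
  assumes ex: "\<exists>s. dom s"
    and adjoin: "\<And>s a. dom s \<Longrightarrow> dom a \<Longrightarrow>
      \<exists>s'. dom s' \<and> (\<forall>x. dom x \<longrightarrow> mem x s \<or> eq x a \<longrightarrow> mem x s')"
    and russell: "\<And>s. dom s \<Longrightarrow> \<exists>r. dom r \<and> (\<forall>x. dom x \<longrightarrow> (mem x r \<longleftrightarrow> mem x s \<and> \<not> mem x x))"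
    and F: "finite F" "F \<subseteq> Collect dom"
  shows "\<exists>a. dom a \<and> (\<forall>b\<in>F. \<not> eq a b)"
proof (rule ccontr)
  assume cover: "\<not> ?thesis"
  have "\<exists>s. dom s \<and> (\<forall>x. dom x \<longrightarrow> (\<exists>b\<in>F. eq x b) \<longrightarrow> mem x s)"
    using F
  proof (induction F)
    case empty
    then show ?case using ex by simp
  next
    case (insert a F)
    then obtain s where s: "dom s" "\<And>x. dom x \<Longrightarrow> \<exists>b\<in>F. eq x b \<Longrightarrow> mem x s" by auto
    obtain s' where s': "dom s'" "\<And>x. dom x \<Longrightarrow> mem x s \<or> eq x a \<Longrightarrow> mem x s'"
      using adjoin[OF s(1), of a] insert.prems by auto
    show ?case
    proof (intro exI[of _ s'] conjI allI impI)
      show "dom s'" by (rule s'(1))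
      fix x assume x: "dom x" "\<exists>b\<in>insert a F. eq x b"
      then have "mem x s \<or> eq x a" using s(2) by blast
      then show "mem x s'" using s'(2) x(1) by blast
    qed
  qed
  then obtain s where s: "dom s" "\<And>x. dom x \<Longrightarrow> mem x s" using cover by blast
  obtain r where r: "dom r" "\<And>x. dom x \<Longrightarrow> mem x r \<longleftrightarrow> mem x s \<and> \<not> mem x x"
    using russell[OF s(1)] by blast
  then show False using s(2) by blast
qed

text \<open>Satisfaction quantifies over a whole type, so the quotient by \<open>eq\<close> must be
  given by a type. Having infinitely many classes, it can be numbered by all of \<open>nat\<close>
  without repetition.\<close>

lemma transversal:
  fixes dom :: "'b::countable \<Rightarrow> bool" and eq :: "'b \<Rightarrow> 'b \<Rightarrow> bool"
  assumes refl: "\<And>a. dom a \<Longrightarrow> eq a a"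
    and sym: "\<And>a b. dom a \<Longrightarrow> dom b \<Longrightarrow> eq a b \<Longrightarrow> eq b a"
    and trans: "\<And>a b d. dom a \<Longrightarrow> dom b \<Longrightarrow> dom d \<Longrightarrow> eq a b \<Longrightarrow> eq b d \<Longrightarrow> eq a d"
    and inf: "\<And>F. finite F \<Longrightarrow> F \<subseteq> Collect dom \<Longrightarrow> \<exists>a. dom a \<and> (\<forall>b\<in>F. \<not> eq a b)"
  obtains f :: "nat \<Rightarrow> 'b" where "\<And>n. dom (f n)" "\<And>a. dom a \<Longrightarrow> \<exists>n. eq a (f n)"
    "\<And>i j. eq (f i) (f j) \<longleftrightarrow> i = j"
proof -
  define rep where "rep a = (SOME b. dom b \<and> eq a b)" for a
  have rep: "dom (rep a) \<and> eq a (rep a)" if "dom a" for a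
    unfolding rep_def by (rule someI[of _ a]) (use that refl in blast)
  have rep_eq: "rep a = rep b" if "dom a" "dom b" "eq a b" for a b
  proof -
    have "(dom d \<and> eq a d) = (dom d \<and> eq b d)" for d using that sym trans by blast
    then show ?thesis by (simp add: rep_def)
  qed
  let ?R = "rep ` Collect dom"
  have dR: "dom x" if "x \<in> ?R" for x using that rep by auto
  have "infinite ?R"
  proof
    assume "finite ?R"
    from inf[OF this] dR obtain a where "dom a" "\<forall>b\<in>?R. \<not> eq a b" by blast
    then show False using rep by blast
  qed
  then have bij: "bij_betw (from_nat_into ?R) UNIV ?R"
    by (intro bij_betw_from_nat_into) simp_all
  let ?f = "from_nat_into ?R"
  have fR: "?f n \<in> ?R" for n using bij by (auto simp: bij_betw_def)
  show thesis
  proof (rule that[of ?f])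
    show "dom (?f n)" for n using fR dR by blast
    show "\<exists>n. eq a (?f n)" if a: "dom a" for a
    proof -
      have "rep a \<in> range ?f" using a bij by (auto simp: bij_betw_def)
      then obtain n where "rep a = ?f n" by blast
      then show ?thesis using rep[OF a] by metis
    qed
    show "eq (?f i) (?f j) \<longleftrightarrow> i = j" for i j
    proof
      assume e: "eq (?f i) (?f j)"
      obtain a where a: "dom a" "?f i = rep a" using fR[of i] by auto
      obtain b where b: "dom b" "?f j = rep b" using fR[of j] by auto
      have "eq a b"
        using trans[OF a(1) _ b(1)] trans sym rep[OF a(1)] rep[OF b(1)] e a b by metis
      then have "?f i = ?f j" using a b rep_eq by simp
      then show "i = j" using bij by (auto simp: bij_betw_def inj_def)
    qed (use refl fR dR in blast)
  qed
qed

text \<open>The equality axioms make \<open>eq\<close> a congruence, so truth does not change when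
  objects are replaced by their representatives.\<close>

lemma ZFU_normal_model:
  fixes isS :: "'b::countable \<Rightarrow> bool" and eq mem :: "'b \<Rightarrow> 'b \<Rightarrow> bool"
  assumes valid: "\<And>B \<rho>. B \<in> ZFU \<Longrightarrow> sat uev (uI isS) (uJ eq mem) \<rho> B"
  shows "\<exists>f :: nat \<Rightarrow> 'b. (\<forall>a. \<exists>n. eq a (f n)) \<and>
    (\<forall>\<rho> \<tau> A. (\<forall>i. eq (\<tau> i) (f (\<rho> i))) \<longrightarrow>
      (sat uev (uI (\<lambda>i. isS (f i))) (uJ (=) (\<lambda>i j. mem (f i) (f j))) \<rho> A \<longleftrightarrow>
       sat uev (uI isS) (uJ eq mem) \<tau> A))"
proof -
  let ?sat = "sat uev (uI isS) (uJ eq mem)"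
  note [simp] = sem
  have refl: "eq a a" for a using valid[OF ZFU.eq_refl, of undefined] by simp
  have "eq a b \<longrightarrow> ?sat (case_nat a (case_nat a \<rho>)) A \<longrightarrow> ?sat (case_nat a (case_nat b \<rho>)) A"
    for a b \<rho> A using valid[OF ZFU.eq_subst[of A], of \<rho>] by simp
  \<comment> \<open>Shifting makes the unmarked variable 0 vacuous, so that every occurrence of the
    variable is replaced.\<close>
  from this[where A = "subst shift _"]
  have inv: "?sat (case_nat b \<rho>) A" if "eq a b" "?sat (case_nat a \<rho>) A" for a b \<rho> A
    using that by (simp add: sat_subst_uev)
  have sym: "eq b a" if "eq a b" for a b
    using inv[OF that, of "\<lambda>_. a" "Pr2 EqU 0 1"] refl by (simp add: uev_def)
  have eq_left: "eq b x" if "eq a b" "eq a x" for a b x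
    using inv[OF that(1), of "\<lambda>_. x" "Pr2 EqU 0 1"] that(2) by (simp add: uev_def)
  have mem_left: "mem b x" if "eq a b" "mem a x" for a b x
    using inv[OF that(1), of "\<lambda>_. x" "Pr2 MemU 0 1"] that(2) by (simp add: uev_def)
  have mem_right: "mem x b" if "eq a b" "mem x a" for a b x
    using inv[OF that(1), of "\<lambda>_. x" "Pr2 MemU 1 0"] that(2) by (simp add: uev_def)
  have isS_eq: "isS b" if "eq a b" "isS a" for a b
    using inv[OF that(1), of undefined "Pr1 SetU 0"] that(2) by (simp add: uev_def)
  have trans: "eq a d" if "eq a b" "eq b d" for a b d
    using eq_left[OF sym[OF that(1)] that(2)] .
  have pair: "\<exists>z. isS z \<and> (\<forall>t. mem t z \<longleftrightarrow> eq t x \<or> eq t y)" for x y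
    using valid[OF ZFU.pairing, of undefined] by simp
  have union: "isS x \<Longrightarrow> \<exists>y. isS y \<and> (\<forall>z. mem z y \<longleftrightarrow> (\<exists>t. mem z t \<and> mem t x))" for x
    using valid[OF ZFU.union, of undefined] by simp
  have atoms: "mem x y \<Longrightarrow> isS y" for x y
    using valid[OF ZFU.atoms, of undefined] by auto
  have "\<exists>f :: nat \<Rightarrow> 'b. (\<forall>a. \<exists>n. eq a (f n)) \<and> (\<forall>i j. eq (f i) (f j) \<longleftrightarrow> i = j)"
  proof (rule transversal[where dom = "\<lambda>_. True" and eq = eq])
    fix F :: "'b set"
    assume "finite F"
    then show "\<exists>a. True \<and> (\<forall>b\<in>F. \<not> eq a b)"
    proof (rule infinite_universe[where dom = "\<lambda>_. True" and eq = eq and mem = mem, rotated 3])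
      fix s a
      obtain p where p: "\<And>t. mem t p \<longleftrightarrow> eq t a \<or> eq t a" using pair by blast
      obtain q where q: "isS q" "\<And>t. mem t q \<longleftrightarrow> eq t s \<or> eq t p" using pair by blast
      obtain u where "\<And>z. mem z u \<longleftrightarrow> (\<exists>t. mem z t \<and> mem t q)" using union[OF q(1)] by blast
      then show "\<exists>s'. True \<and> (\<forall>x. True \<longrightarrow> mem x s \<or> eq x a \<longrightarrow> mem x s')"
        using p q(2) refl by blast
    next
      fix s
      show "\<exists>r. True \<and> (\<forall>x. True \<longrightarrow> (mem x r \<longleftrightarrow> mem x s \<and> \<not> mem x x))"
      proof (cases "isS s")
        case True
        then show ?thesis
          using valid[OF ZFU.separation[of "Neg (Pr2 MemU 0 0)"], of undefined] by (auto simp: uev_def)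
      next
        case False
        then show ?thesis using atoms by blast
      qed
    qed simp_all
  qed (use refl sym trans in \<open>blast+\<close>)
  then obtain f :: "nat \<Rightarrow> 'b" where
    f: "\<And>a. \<exists>n. eq a (f n)" "\<And>i j. eq (f i) (f j) \<longleftrightarrow> i = j" by blast
  have "sat uev (uI (\<lambda>i. isS (f i))) (uJ (=) (\<lambda>i j. mem (f i) (f j))) \<rho> A \<longleftrightarrow> ?sat \<tau> A"
    if "\<And>i. eq (\<tau> i) (f (\<rho> i))" for \<rho> \<tau> A
    using that
  proof (induction A arbitrary: \<rho> \<tau>)
    case (Pr1 p x)
    then show ?case using isS_eq sym by (cases p) (simp add: uev_def, blast)
  next
    case (Pr2 r x y)
    have x: "eq (\<tau> x) (f (\<rho> x))" and y: "eq (\<tau> y) (f (\<rho> y))" by (rule Pr2)+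
    show ?case
    proof (cases r)
      case EqU
      have "eq (f (\<rho> x)) (f (\<rho> y)) \<longleftrightarrow> eq (\<tau> x) (\<tau> y)" using x y sym trans by blast
      then show ?thesis by (simp add: EqU f(2) uev_def)
    next
      case MemU
      have "mem (f (\<rho> x)) (f (\<rho> y)) \<longleftrightarrow> mem (\<tau> x) (\<tau> y)"
        using x y sym mem_left mem_right by blast
      then show ?thesis by (simp add: MemU uev_def)
    qed
  next
    case (Neg A)
    show ?case by (simp only: sat.simps Neg.IH[OF Neg.prems])
  next
    case (Or A B)
    show ?case by (simp only: sat.simps Or.IH[OF Or.prems])
  next
    case (All A)
    have *: "sat uev (uI (\<lambda>i. isS (f i))) (uJ (=) (\<lambda>i j. mem (f i) (f j))) (case_nat n \<rho>) A \<longleftrightarrow>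
        ?sat (case_nat a \<tau>) A" if "eq a (f n)" for a n
      by (rule All.IH) (use that All.prems in \<open>simp split: nat.split\<close>)
    show ?case using *[OF refl] * f(1) unfolding sat.simps by meson
  qed
  with f(1) show ?thesis by (intro exI[of _ f]) simp
qed

lemma zfu_of_ZFU_model:
  fixes isS :: "'b::countable \<Rightarrow> bool" and mem :: "'b \<Rightarrow> 'b \<Rightarrow> bool"
  assumes valid: "\<And>B \<rho>. B \<in> ZFU \<Longrightarrow> sat uev (uI isS) (uJ (=) mem) \<rho> B"
  shows "zfu (fo_structure.def_pred uev (uI isS) (uJ (=) mem)) mem isS"
proof -
  interpret fo_structure uev "uI isS" "uJ (=) mem"
    by unfold_locales (rule evaluation_uev)
  note [simp] = sem
  interpret zfu0 def_pred mem isS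
  proof
    show "def_pred (\<lambda>\<rho>. \<rho> i = \<rho> j)" for i j
      using def_pred_pr2[of "\<lambda>\<rho>. \<rho> i" "\<lambda>\<rho>. \<rho> j" EqU] by (simp add: def_term_var)
    show "def_pred (\<lambda>\<rho>. mem (\<rho> i) (\<rho> j))" for i j
      using def_pred_pr2[of "\<lambda>\<rho>. \<rho> i" "\<lambda>\<rho>. \<rho> j" MemU] by (simp add: def_term_var)
    show "def_pred (\<lambda>\<rho>. isS (\<rho> i))" for i
      using def_pred_pr1[of "\<lambda>\<rho>. \<rho> i" SetU] by (simp add: def_term_var)
    show "isS y" if "mem x y" for x y
      using valid[OF ZFU.atoms, of undefined] that by auto
    show "x = y" if "isS x" "isS y" "\<And>z. mem z x \<longleftrightarrow> mem z y" for x y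
      using valid[OF ZFU.extensionality, of undefined] that by simp
    show "\<exists>z. \<forall>t. mem t z \<longleftrightarrow> t = x \<or> t = y" for x y
      using valid[OF ZFU.pairing, of undefined] by simp blast
    show "\<exists>y. isS y \<and> (\<forall>z. mem z y \<longleftrightarrow> (\<exists>t. mem z t \<and> mem t x))" if "isS x" for x
      using valid[OF ZFU.union, of undefined] that by simp
    show "\<exists>y. isS y \<and> (\<forall>t. mem t y \<longleftrightarrow> isS t \<and> (\<forall>z. mem z t \<longrightarrow> mem z x))" if "isS x" for x
      using valid[OF ZFU.power, of undefined] that by simp
    show "\<exists>y. isS y \<and> (\<forall>t. mem t y \<longleftrightarrow> mem t x \<and> P t)"
      if "isS x" and P: "def_pred (\<lambda>\<rho>. P (\<rho> 0))" for x P
    proof -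
      obtain A \<sigma> where A: "\<And>t. P t \<longleftrightarrow> sat uev (uI isS) (uJ (=) mem) (case_nat t \<sigma>) A"
        using def_pred_unary[OF P] by blast
      \<comment> \<open>Variable 1 of the formula in the schema is the set \<open>x\<close> itself,
        to which \<open>P\<close> makes no reference; the parameters move up by one to skip
        it.\<close>
      let ?u = "case_nat 0 (\<lambda>i. Suc (Suc i))"
      have *: "(\<lambda>i. case_nat t (case_nat y \<sigma>) (?u i)) = case_nat t \<sigma>" for t y
        by (rule ext) (simp split: nat.split)
      then show ?thesis
        using valid[OF ZFU.separation[of "subst ?u A"], of \<sigma>] \<open>isS x\<close>
        by (simp add: A sat_subst_uev *)
    qed
    show "\<exists>v. isS v \<and> (\<forall>y. mem y v \<longleftrightarrow> (\<exists>x. mem x u \<and> R x y))"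
      if u: "isS u" and R: "def_pred (\<lambda>\<rho>. R (\<rho> 0) (\<rho> (Suc 0)))"
        and uniq: "\<And>x y y'. mem x u \<Longrightarrow> R x y \<Longrightarrow> R x y' \<Longrightarrow> y = y'" for u R
    proof -
      obtain A \<sigma> where
        A: "\<And>x y. R x y \<longleftrightarrow> sat uev (uI isS) (uJ (=) mem) (case_nat x (case_nat y \<sigma>)) A"
        by (rule def_pred_binary[OF R]) (rule that)
      let ?u = "case_nat 0 (case_nat (Suc 0) (\<lambda>i. Suc (Suc (Suc i))))"
      have *: "(\<lambda>i. case_nat x (case_nat y (case_nat u \<sigma>)) (?u i)) = case_nat x (case_nat y \<sigma>)"
        for x y u
      proof
        fix i
        consider "i = 0" | "i = Suc 0" | j where "i = Suc (Suc j)" by (metis not0_implies_Suc)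
        then show "case_nat x (case_nat y (case_nat u \<sigma>)) (?u i) = case_nat x (case_nat y \<sigma>) i"
          by cases simp_all
      qed
      then show ?thesis
        using valid[OF ZFU.replacement[of "subst ?u A"], of \<sigma>] u uniq
        by (simp add: A sat_subst_uev *; blast)
    qed
    show "\<exists>y. mem y x \<and> (\<forall>z. mem z y \<longrightarrow> \<not> mem z x)" if "mem y x" for x y
    proof -
      have "isS x" using valid[OF ZFU.atoms, of undefined] that by auto
      then show ?thesis using valid[OF ZFU.foundation, of undefined] that by simp blast
    qed
  qed
  show ?thesis
  proof
    show "\<exists>u. isS u \<and> (\<forall>y. mem y x \<longrightarrow> (\<exists>v. \<forall>t. mem t y \<and> mem t u \<longleftrightarrow> t = v))"
      if "isS x" "\<And>y. mem y x \<Longrightarrow> isS y \<and> (\<exists>t. mem t y)"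
        "\<And>y z. mem y x \<Longrightarrow> mem z x \<Longrightarrow> (\<exists>t. mem t y \<and> mem t z) \<Longrightarrow> y = z" for x
      using valid[OF ZFU.choice, of undefined] that by simp
    obtain x where x: "\<exists>e. isS e \<and> (\<forall>t. \<not> mem t e) \<and> mem e x"
      "\<And>y. mem y x \<Longrightarrow> isS y \<Longrightarrow> \<exists>w. isS w \<and> (\<forall>t. mem t w \<longleftrightarrow> mem t y \<or> t = y) \<and> mem w x"
      using valid[OF ZFU.infinity, of undefined] by simp blast
    have "mem emp x" using x(1) is_empty_iff unfolding is_empty_def by metis
    moreover have "mem (succ y) x" if "mem y x" "isS y" for y
      using x(2)[OF that] is_succ_iff unfolding is_succ_def by metis
    ultimately show "\<exists>x. mem emp x \<and> (\<forall>y. mem y x \<longrightarrow> isS y \<longrightarrow> mem (succ y) x)" by blast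
  qed
qed

lemma sat_Alls: "(\<And>\<rho>. sat ev I J \<rho> ((All ^^ n) A)) \<Longrightarrow> sat ev I J \<rho> A"
proof (induction n arbitrary: \<rho>)
  case (Suc n)
  have "sat ev I J \<tau> ((All ^^ n) A)" for \<tau>
  proof -
    have "sat ev I J (case_nat (\<tau> 0) (\<lambda>i. \<tau> (Suc i))) ((All ^^ n) A)"
      using Suc.prems by simp
    moreover have "case_nat (\<tau> 0) (\<lambda>i. \<tau> (Suc i)) = \<tau>"
      by (rule ext) (simp split: nat.split)
    ultimately show ?thesis by simp
  qed
  then show ?case by (rule Suc.IH)
qed simp

section \<open>Reflection of provability\<close>

instance zpred1 :: countable by countable_datatype
instance zpred2 :: countable by countable_datatype
instance qtm :: countable by countable_datatype
instance qpred1 :: countable by countable_datatype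
instance qpred2 :: countable by countable_datatype

lemma tr_reflects_provability:
  assumes "QST \<turnstile> tr (uclose A)"
  shows "ZFU \<turnstile> A"
proof (rule ccontr)
  assume "\<not> ZFU \<turnstile> A"
  then obtain I J \<tau> where valid: "\<And>B \<rho>. B \<in> ZFU \<Longrightarrow> sat tsubst I J \<rho> B"
    and A: "\<not> sat tsubst I J \<tau> A" by (rule completeness) (rule that)
  let ?s = "I SetU" and ?e = "J EqU" and ?mem = "J MemU"
  have eqs: "(tsubst :: (nat \<Rightarrow> nat) \<Rightarrow> nat \<Rightarrow> nat) = uev" "I = uI ?s" "J = uJ ?e ?mem"
  proof -
    show "(tsubst :: (nat \<Rightarrow> nat) \<Rightarrow> nat \<Rightarrow> nat) = uev"
      by (intro ext) (simp add: tsubst_nat_def uev_def)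
    show "I = uI ?s"
    proof
      show "I p = uI ?s p" for p by (cases p) simp
    qed
    show "J = uJ ?e ?mem"
    proof
      show "J r = uJ ?e ?mem r" for r by (cases r) simp_all
    qed
  qed
  have valid': "sat uev (uI ?s) (uJ ?e ?mem) \<rho> B" if "B \<in> ZFU" for B \<rho>
    using valid[OF that] eqs by metis
  obtain f :: "nat \<Rightarrow> nat" where f: "\<forall>a. \<exists>n. ?e a (f n)"
    and sat_f: "\<forall>\<rho> \<tau> A. (\<forall>i. ?e (\<tau> i) (f (\<rho> i))) \<longrightarrow>
      (sat uev (uI (\<lambda>i. ?s (f i))) (uJ (=) (\<lambda>i j. ?mem (f i) (f j))) \<rho> A \<longleftrightarrow>
       sat uev (uI ?s) (uJ ?e ?mem) \<tau> A)"
    using ZFU_normal_model[of ?s ?e ?mem] valid' by blast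
  have refl: "?e a a" for a
    using valid'[OF ZFU.eq_refl, of undefined] by (simp add: sem)
  interpret zfu "fo_structure.def_pred uev (uI (\<lambda>i. ?s (f i))) (uJ (=) (\<lambda>i j. ?mem (f i) (f j)))"
    "\<lambda>i j. ?mem (f i) (f j)" "\<lambda>i. ?s (f i)"
    by (rule zfu_of_ZFU_model)
      (simp add: sat_f[rule_format, where \<tau> = "\<lambda>i. f (_ i)", OF refl] valid')
  interpret qstruct crd "\<lambda>_. False" "\<lambda>x. \<not> ?s (f x)" "\<lambda>i. ?s (f i)" "(=)"
    "\<lambda>i j. ?mem (f i) (f j)" .
  have "satQ \<rho> (tr (uclose A))" for \<rho>
    using assms evaluation_qev QST_valid by (rule soundness)
  then have "satN \<rho> ((All ^^ fvb A) A)" for \<rho> by (simp add: satQ_tr_iff uclose_def)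
  then have N: "satN \<rho> A" for \<rho> by (rule sat_Alls)
  have "?e (\<tau> i) (f (SOME n. ?e (\<tau> i) (f n)))" for i
    using f by (metis someI_ex)
  then obtain \<rho> where "\<forall>i. ?e (\<tau> i) (f (\<rho> i))" by fast
  then have "sat uev (uI ?s) (uJ ?e ?mem) \<tau> A" using sat_f N by blast
  then show False using A eqs by metis
qed

section \<open>From ZFU to quasi-set theory\<close>

subsection \<open>Validity of the axioms of ZFU\<close>

lemma (in zfu0) dp_satN:
  assumes "\<And>i. dt (\<lambda>\<rho>. t \<rho> i)"
  shows "dp (\<lambda>\<rho>. satN (t \<rho>) A)"
  using assms
proof (induction A arbitrary: t)
  case (Pr1 p u)
  then show ?case by (cases p) (simp add: uev_def dp_isS)
next
  case (Pr2 r u v)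
  then show ?case by (cases r) (simp_all add: uev_def dp_eq dp_mem)
next
  case (Neg A)
  then show ?case by (simp add: dp_not)
next
  case (Or A B)
  then show ?case by (simp add: dp_or)
next
  case (All A)
  have "dt (\<lambda>\<rho>. case_nat (\<rho> 0) (t (\<lambda>n. \<rho> (Suc n))) i)" for i
    using dt_shift[OF All.prems] by (cases i) (simp_all add: dt_var)
  then have "dp (\<lambda>\<rho>. satN (case_nat (\<rho> 0) (t (\<lambda>n. \<rho> (Suc n)))) A)" by (rule All.IH)
  then show ?case by (simp add: dp_all[where H = "\<lambda>\<rho> x. satN (case_nat x (t \<rho>)) A"])
qed

lemma (in zfu) ZFU_valid: "B \<in> ZFU \<Longrightarrow> satN \<rho> B"
proof (induction arbitrary: \<rho> rule: ZFU.induct)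
  case atoms
  show ?case by (auto simp add: sem intro: mem_isS)
next
  case extensionality
  show ?case by (auto simp add: sem intro: ext_ax)
next
  case pairing
  have "\<exists>z. isS z \<and> (\<forall>t. t \<epsilon> z \<longleftrightarrow> t = x \<or> t = y)" for x y
    by (rule exI[of _ "upair x y"]) simp
  then show ?case by (simp add: sem)
next
  case union
  show ?case by (simp add: sem union_ax)
next
  case power
  show ?case by (simp add: sem power_ax)
next
  case infinity
  obtain x where x: "emp \<epsilon> x" "\<And>y. y \<epsilon> x \<Longrightarrow> isS y \<Longrightarrow> succ y \<epsilon> x"
    using infinity_ax by blast
  have "isS x" using mem_isS[OF x(1)] .
  moreover have "\<exists>e. isS e \<and> (\<forall>t. \<not> t \<epsilon> e) \<and> e \<epsilon> x" using x(1) by (intro exI[of _ emp]) simp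
  moreover have "\<exists>w. isS w \<and> (\<forall>t. t \<epsilon> w \<longleftrightarrow> t \<epsilon> y \<or> t = y) \<and> w \<epsilon> x" if "y \<epsilon> x" "isS y" for y
    using x(2)[OF that] by (intro exI[of _ "succ y"]) simp
  ultimately show ?case by (simp add: sem; blast)
next
  case (separation A)
  have "dp (\<lambda>\<tau>. satN (case_nat (\<tau> 0) (case_nat x \<rho>)) A)" for x
    by (intro dp_satN dt_case_nat dt_var dt_const)
  then show ?case using sep_ax by (simp add: sem)
next
  case (replacement A)
  let ?R = "\<lambda>u x y. satN (case_nat x (case_nat y (case_nat u \<rho>))) A"
  have "dp (\<lambda>\<tau>. ?R u (\<tau> 0) (\<tau> (Suc 0)))" for u
    by (intro dp_satN dt_case_nat dt_var dt_const)
  then have "\<exists>v. isS v \<and> (\<forall>y. y \<epsilon> v \<longleftrightarrow> (\<exists>x. x \<epsilon> u \<and> ?R u x y))"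
    if "isS u" "\<And>x y y'. x \<epsilon> u \<Longrightarrow> ?R u x y \<Longrightarrow> ?R u x y' \<Longrightarrow> y = y'" for u
    using repl_ax[of u "?R u"] that by blast
  then show ?case by (simp add: sem; blast)
next
  case foundation
  show ?case using found_ax by (simp add: sem; blast)
next
  case choice
  show ?case using choice_ax by (simp add: sem)
qed (simp_all add: sem)


subsection \<open>Models of quasi-set theory\<close>

locale qmodel = qstruct c micro macro zset ind qmem
  for c :: "'a::countable \<Rightarrow> 'a" and micro macro zset :: "'a \<Rightarrow> bool"
    and ind :: "'a \<Rightarrow> 'a \<Rightarrow> bool" (infix "\<simeq>" 50)
    and qmem :: "'a \<Rightarrow> 'a \<Rightarrow> bool" (infix "\<in>\<^sub>q" 50) +
  assumes valid: "B \<in> QST \<Longrightarrow> satQ \<rho> B"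
begin

sublocale fo_structure "qev c" "qI micro macro zset" "qJ ind qmem"
  by unfold_locales (rule evaluation_qev)

lemma dq_micro [dpI]: "def_term t \<Longrightarrow> def_pred (\<lambda>\<rho>. micro (t \<rho>))"
  and dq_macro [dpI]: "def_term t \<Longrightarrow> def_pred (\<lambda>\<rho>. macro (t \<rho>))"
  and dq_zset [dpI]: "def_term t \<Longrightarrow> def_pred (\<lambda>\<rho>. zset (t \<rho>))"
  using def_pred_pr1[of t Micro] def_pred_pr1[of t Macro] def_pred_pr1[of t SetQ] by simp_all

lemma dq_ind [dpI]: "def_term s \<Longrightarrow> def_term t \<Longrightarrow> def_pred (\<lambda>\<rho>. s \<rho> \<simeq> t \<rho>)"
  and dq_mem [dpI]: "def_term s \<Longrightarrow> def_term t \<Longrightarrow> def_pred (\<lambda>\<rho>. s \<rho> \<in>\<^sub>q t \<rho>)"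
  using def_pred_pr2[of s t Indist] def_pred_pr2[of s t MemQ] by simp_all

lemma dq_qc [dpI]: "def_term t \<Longrightarrow> def_term (\<lambda>\<rho>. c (t \<rho>))"
  unfolding def_term_def by (metis qev.simps(2))

text \<open>Terms are shifted syntactically here; describing them by their graphs, as
  \<open>dt\<close> does, would presuppose that equality is definable.\<close>

lemma def_term_shift: "def_term t \<Longrightarrow> def_term (\<lambda>\<rho>. t (\<lambda>n. \<rho> (Suc n)))"
proof -
  assume "def_term t"
  then obtain u where u: "\<And>\<rho>. t \<rho> = qev c (mix \<rho>) u" unfolding def_term_def by blast
  have *: "(\<lambda>i. qev c (mix \<rho>) (if even i then var (i + 2) else var i)) = mix (\<lambda>n. \<rho> (Suc n))"
    for \<rho> by (rule ext) (simp add: mix_def)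
  show ?thesis
    unfolding def_term_def u
    by (rule exI[of _ "tsubst (\<lambda>i. if even i then var (i + 2) else var i) u"])
      (simp only: evaluation_tsubst[OF evaluation] *, simp)
qed

lemma dq_qset [dpI]: "def_term t \<Longrightarrow> def_pred (\<lambda>\<rho>. qset (t \<rho>))"
  unfolding qset_def by (intro dpI)

lemma dq_isD [dpI]: "def_term t \<Longrightarrow> def_pred (\<lambda>\<rho>. isD (t \<rho>))"
  unfolding isD_def by (intro dpI)

lemma dq_qsub [dpI]: "def_term s \<Longrightarrow> def_term t \<Longrightarrow> def_pred (\<lambda>\<rho>. qsub (s \<rho>) (t \<rho>))"
  unfolding qsub_def by (intro dpI def_term_shift[of s] def_term_shift[of t])

lemma dq_qempty [dpI]: "def_term t \<Longrightarrow> def_pred (\<lambda>\<rho>. qempty (t \<rho>))"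
  unfolding qempty_def by (intro dpI def_term_shift[of t])

lemma dq_eqe [dpI]: "def_term s \<Longrightarrow> def_term t \<Longrightarrow> def_pred (\<lambda>\<rho>. eqe (s \<rho>) (t \<rho>))"
  unfolding eqe_def by (intro dpI def_term_shift[of s] def_term_shift[of t])

lemma def_pred_rename2:
  "def_pred (\<lambda>\<rho>. R (\<rho> 0) (\<rho> (Suc 0))) \<Longrightarrow> def_pred (\<lambda>\<rho>. R (\<rho> i) (\<rho> j))"
  using dp_rename[of "\<lambda>\<rho>. R (\<rho> 0) (\<rho> (Suc 0))" "case_nat i (\<lambda>_. j)"] by simp

section \<open>Indistinguishability and extensional identity\<close>

lemma ind_refl: "x \<simeq> x"
  using valid[OF QST.Q1, of undefined] by (simp add: sem)

lemma ind_sym: "x \<simeq> y \<Longrightarrow> y \<simeq> x"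
  using valid[OF QST.Q2, of undefined] by (simp add: sem)

lemma ind_trans:
  assumes "x \<simeq> y" "y \<simeq> z"
  shows "x \<simeq> z"
proof -
  have "\<forall>x y z. x \<simeq> y \<and> y \<simeq> z \<longrightarrow> x \<simeq> z"
    using valid[OF QST.Q3, of undefined] by (simp (no_asm_use) add: sem)
  then show ?thesis using assms by (elim allE impE) (rule conjI)
qed

lemma satQ_eqe:
  assumes "eqe a b" "satQ (case_nat a \<rho>) A"
  shows "satQ (case_nat b \<rho>) A"
proof -
  have "eqe a b \<longrightarrow> satQ (case_nat a (case_nat a \<rho>)) (subst shift A) \<longrightarrow>
      satQ (case_nat a (case_nat b \<rho>)) (subst shift A)"
    using valid[OF QST.Q4[of "subst shift A"], of \<rho>] by (simp add: sem)
  then show ?thesis using assms by (simp add: sat_subst[OF evaluation])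
qed

lemma def_pred_eqe:
  assumes P: "def_pred P" and e: "eqe a b" and a: "P (case_nat a \<rho>)"
  shows "P (case_nat b \<rho>)"
proof -
  obtain A where A: "\<And>\<rho>. P \<rho> \<longleftrightarrow> satQ (mix \<rho>) A" using P unfolding def_pred_def by blast
  have *: "mix (case_nat x \<rho>) = case_nat x (\<lambda>i. mix (case_nat undefined \<rho>) (Suc i))" for x
    by (rule ext) (auto simp: mix_def split: nat.split)
  from a show ?thesis unfolding A *[of a] *[of b] by (rule satQ_eqe[OF e])
qed

lemma eqe_subst: "def_pred (\<lambda>\<rho>. P (\<rho> 0)) \<Longrightarrow> eqe a b \<Longrightarrow> P a \<Longrightarrow> P b"
  using def_pred_eqe[of "\<lambda>\<rho>. P (\<rho> 0)" a b] by simp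

lemma eqe_subst2:
  assumes R: "def_pred (\<lambda>\<rho>. R (\<rho> 0) (\<rho> (Suc 0)))" and e: "eqe a a'" "eqe b b'" and ab: "R a b"
  shows "R a' b'"
proof -
  have "R a' b"
    using def_pred_eqe[OF R e(1), of "\<lambda>_. b"] ab by simp
  then show ?thesis
    using def_pred_eqe[OF def_pred_rename2[OF R, of "Suc 0" 0] e(2), of "\<lambda>_. a'"] by simp
qed

lemma mem_eqe_left: "eqe a b \<Longrightarrow> a \<in>\<^sub>q z \<Longrightarrow> b \<in>\<^sub>q z"
  by (rule eqe_subst[where P = "\<lambda>t. t \<in>\<^sub>q z"]) (intro dpI)

lemma mem_eqe_right: "eqe a b \<Longrightarrow> z \<in>\<^sub>q a \<Longrightarrow> z \<in>\<^sub>q b"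
  by (rule eqe_subst[where P = "\<lambda>t. z \<in>\<^sub>q t"]) (intro dpI)

lemma isD_eqe: "eqe a b \<Longrightarrow> isD a \<Longrightarrow> isD b"
  by (rule eqe_subst[where P = isD]) (intro dpI)

lemma zset_eqe: "eqe a b \<Longrightarrow> zset a \<Longrightarrow> zset b"
  by (rule eqe_subst[where P = zset]) (intro dpI)

lemma eqe_sym: "eqe a b \<Longrightarrow> eqe b a"
  unfolding eqe_def by blast

lemma eqe_trans: "eqe a b \<Longrightarrow> eqe b d \<Longrightarrow> eqe a d"
  unfolding eqe_def qset_def by blast

lemma zset_qset: "zset x \<Longrightarrow> qset x"
  using valid[OF QST.Q7, of undefined] by (simp add: sem)

lemma mem_qset: "x \<in>\<^sub>q y \<Longrightarrow> qset y"
  using valid[OF QST.Q6, of undefined] by (simp add: sem; blast)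

lemma eqe_refl_qset: "qset x \<Longrightarrow> eqe x x"
  unfolding eqe_def by blast

text \<open>Extensional identity is not reflexive on \<open>m\<close>-atoms, to which neither
  disjunct of \<open>eqe\<close> applies; hence the restriction to \<open>isD\<close>.\<close>

lemma eqe_refl: "isD x \<Longrightarrow> eqe x x"
  using zset_qset unfolding eqe_def isD_def by blast

lemma eqe_ind: "eqe x y \<Longrightarrow> x \<simeq> y"
  by (rule eqe_subst[where P = "\<lambda>t. x \<simeq> t"], intro dpI) (assumption, rule ind_refl)

lemma zset_iff: "qset x \<Longrightarrow> zset x \<longleftrightarrow> (\<forall>y. y \<in>\<^sub>q x \<longrightarrow> isD y)"
  using valid[OF QST.Q8, of undefined] by (simp add: sem)

lemma zset_mem: "zset x \<Longrightarrow> y \<in>\<^sub>q x \<Longrightarrow> isD y"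
  using zset_iff zset_qset by blast

lemma isD_qset: "isD x \<Longrightarrow> qset x \<longleftrightarrow> zset x"
  using zset_qset unfolding isD_def qset_def by blast

lemma ind_eqe: "isD x \<Longrightarrow> isD y \<Longrightarrow> x \<simeq> y \<Longrightarrow> eqe x y"
  using valid[OF QST.Q11, of undefined] by (simp add: sem)

lemma qempty_ex: "\<exists>x. qempty x"
  using valid[OF QST.Q10, of undefined] by (simp add: sem qempty_def)

lemma qempty_zset: "qempty x \<Longrightarrow> zset x"
  by (simp add: qempty_def zset_iff)

section \<open>Existence of classical sets\<close>

lemma qsep:
  assumes x: "qset x" and P: "def_pred (\<lambda>\<rho>. P (\<rho> 0))"
  shows "\<exists>y. qset y \<and> (\<forall>t. t \<in>\<^sub>q y \<longleftrightarrow> t \<in>\<^sub>q x \<and> P t)"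
proof -
  obtain A \<sigma> where A: "\<And>t. P t \<longleftrightarrow> satQ (case_nat t \<sigma>) A"
    by (rule def_pred_unary[OF P]) (rule that)
  let ?u = "case_nat (var 0) (\<lambda>i. var (Suc (Suc i)))"
  have *: "(\<lambda>i. qev c (case_nat t (case_nat x \<sigma>)) (?u i)) = case_nat t \<sigma>" for t x
    by (rule ext) (simp split: nat.split)
  show ?thesis
    using valid[OF QST.Q13[of "subst ?u A"], of \<sigma>] x
    by (simp add: sem sat_subst[OF evaluation] * A del: ev_var)
qed

lemma Dsep:
  assumes x: "zset x" and P: "def_pred (\<lambda>\<rho>. P (\<rho> 0))"
  shows "\<exists>y. zset y \<and> (\<forall>t. t \<in>\<^sub>q y \<longleftrightarrow> t \<in>\<^sub>q x \<and> P t)"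
  using qsep[OF zset_qset[OF x] P] zset_iff zset_mem[OF x] by blast

text \<open>The qset \<open>[x, y]\<close> may also contain objects that are not classical. Cutting
  it down to \<open>isD\<close> leaves elements for which Q11 turns indistinguishability into
  extensional identity.\<close>

lemma Dpair:
  assumes "isD x" "isD y"
  shows "\<exists>z. zset z \<and> (\<forall>t. t \<in>\<^sub>q z \<longleftrightarrow> isD t \<and> (eqe t x \<or> eqe t y))"
proof -
  obtain z where z: "qset z" "\<And>t. t \<in>\<^sub>q z \<longleftrightarrow> t \<simeq> x \<or> t \<simeq> y"
    using valid[OF QST.Q12, of undefined] by (simp add: sem; blast)
  have "def_pred (\<lambda>\<rho>. isD (\<rho> 0))" by (intro dpI)
  from qsep[OF z(1) this] obtain w where
    w: "qset w" "\<And>t. t \<in>\<^sub>q w \<longleftrightarrow> t \<in>\<^sub>q z \<and> isD t" by blast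
  have "t \<in>\<^sub>q w \<longleftrightarrow> isD t \<and> (eqe t x \<or> eqe t y)" for t
    unfolding w(2) z(2) using eqe_ind ind_eqe assms by blast
  moreover have "zset w" using zset_iff[OF w(1)] w(2) by blast
  ultimately show ?thesis by blast
qed

text \<open>Q14 requires all elements of the family to be qsets. Dropping the atoms first changes
  nothing in the union, since atoms have no elements.\<close>

lemma Dunion:
  assumes x: "zset x"
  shows "\<exists>y. zset y \<and> (\<forall>z. z \<in>\<^sub>q y \<longleftrightarrow> (\<exists>t. z \<in>\<^sub>q t \<and> t \<in>\<^sub>q x))"
proof -
  have "def_pred (\<lambda>\<rho>. qset (\<rho> 0))" by (intro dpI)
  from qsep[OF zset_qset[OF x] this] obtain w where
    w: "qset w" "\<And>t. t \<in>\<^sub>q w \<longleftrightarrow> t \<in>\<^sub>q x \<and> qset t" by blast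
  obtain y where y: "qset y" "\<And>z. z \<in>\<^sub>q y \<longleftrightarrow> (\<exists>t. z \<in>\<^sub>q t \<and> t \<in>\<^sub>q w)"
  proof -
    have "\<exists>y. qset y \<and> (\<forall>z. z \<in>\<^sub>q y \<longleftrightarrow> (\<exists>t. z \<in>\<^sub>q t \<and> t \<in>\<^sub>q v))"
      if "qset v" "\<forall>y. y \<in>\<^sub>q v \<longrightarrow> qset y" for v
      using valid[OF QST.Q14, of undefined] that by (simp add: sem)
    from this[of w] show ?thesis using w that by blast
  qed
  have "z \<in>\<^sub>q y \<longleftrightarrow> (\<exists>t. z \<in>\<^sub>q t \<and> t \<in>\<^sub>q x)" for z
    unfolding y(2) w(2) using mem_qset by blast
  moreover have "isD z" if z: "z \<in>\<^sub>q t" "t \<in>\<^sub>q x" for z t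
    using zset_mem[OF x z(2)] isD_qset mem_qset[OF z(1)] zset_mem[OF _ z(1)] by blast
  ultimately show ?thesis using zset_iff[OF y(1)] by blast
qed

text \<open>Subqsets of a set are sets, their elements being classical; so Q15 already yields the
  classical power set.\<close>

lemma Dpow:
  assumes x: "zset x"
  shows "\<exists>y. zset y \<and> (\<forall>t. t \<in>\<^sub>q y \<longleftrightarrow> zset t \<and> (\<forall>z. z \<in>\<^sub>q t \<longrightarrow> z \<in>\<^sub>q x))"
proof -
  obtain y where y: "qset y" "\<And>t. t \<in>\<^sub>q y \<longleftrightarrow> qset t \<and> (\<forall>z. z \<in>\<^sub>q t \<longrightarrow> z \<in>\<^sub>q x)"
  proof -
    have "\<exists>y. qset y \<and> (\<forall>t. t \<in>\<^sub>q y \<longleftrightarrow> qset t \<and> (\<forall>z. z \<in>\<^sub>q t \<longrightarrow> z \<in>\<^sub>q x))"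
      using valid[OF QST.Q15, of undefined] zset_qset[OF x] by (simp add: sem qsub_def)
    then show ?thesis using that by blast
  qed
  have *: "t \<in>\<^sub>q y \<longleftrightarrow> zset t \<and> (\<forall>z. z \<in>\<^sub>q t \<longrightarrow> z \<in>\<^sub>q x)" for t
    unfolding y(2) using zset_iff zset_qset zset_mem[OF x] by blast
  moreover have "zset y" unfolding zset_iff[OF y(1)] * isD_def by blast
  ultimately show ?thesis by blast
qed

lemma qfound:
  assumes x: "qset x" "\<And>y. y \<in>\<^sub>q x \<Longrightarrow> qset y" and t: "t \<in>\<^sub>q x"
  shows "\<exists>y. y \<in>\<^sub>q x \<and> (\<forall>z. z \<in>\<^sub>q y \<longrightarrow> \<not> z \<in>\<^sub>q x)"
proof -
  obtain e where e: "qempty e" using qempty_ex by blast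
  have "\<not> eqe x e" using e t mem_eqe_right unfolding qempty_def by blast
  then obtain y w e' where y: "y \<in>\<^sub>q x" "\<And>t. t \<in>\<^sub>q w \<longleftrightarrow> t \<in>\<^sub>q y \<and> t \<in>\<^sub>q x" "qempty e'" "eqe w e'"
  proof -
    have "\<forall>x. qset x \<longrightarrow> (\<forall>y. y \<in>\<^sub>q x \<longrightarrow> qset y) \<and> (\<exists>e. qempty e \<and> \<not> eqe x e) \<longrightarrow>
      (\<exists>y. qset y \<and> y \<in>\<^sub>q x \<and> (\<exists>w e. (qset w \<and>
        (\<forall>t. t \<in>\<^sub>q w \<longleftrightarrow> t \<in>\<^sub>q y \<and> t \<in>\<^sub>q x)) \<and> qempty e \<and> eqe w e))"
      using valid[OF QST.Q17, of undefined] by (simp (no_asm_use) add: sem)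
    then have "\<exists>y. qset y \<and> y \<in>\<^sub>q x \<and> (\<exists>w e. (qset w \<and>
        (\<forall>t. t \<in>\<^sub>q w \<longleftrightarrow> t \<in>\<^sub>q y \<and> t \<in>\<^sub>q x)) \<and> qempty e \<and> eqe w e)"
      using x e \<open>\<not> eqe x e\<close> by blast
    then show ?thesis using that by blast
  qed
  then show ?thesis using mem_eqe_right unfolding qempty_def by blast
qed

text \<open>Q17 covers sets all of whose elements are qsets. Any other element is an atom, which has
  no elements and is itself the required witness.\<close>

lemma Dfound:
  assumes x: "zset x" and t: "t \<in>\<^sub>q x"
  shows "\<exists>y. y \<in>\<^sub>q x \<and> (\<forall>z. z \<in>\<^sub>q y \<longrightarrow> \<not> z \<in>\<^sub>q x)"
proof (cases "\<forall>y. y \<in>\<^sub>q x \<longrightarrow> qset y")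
  case True
  then show ?thesis using qfound[OF zset_qset[OF x] _ t] by blast
next
  case False
  then show ?thesis using mem_qset by blast
qed

text \<open>The qset \<open>[y]\<close> cannot play the part of a singleton, as it contains
  everything indistinguishable from \<open>y\<close>. Its place is taken by the subqset of those
  elements of \<open>y\<close> that are extensionally identical with \<open>y\<close>.\<close>

lemma mem_irrefl_q:
  assumes y: "qset y"
  shows "\<not> y \<in>\<^sub>q y"
proof
  assume yy: "y \<in>\<^sub>q y"
  have "def_pred (\<lambda>\<rho>. eqe (\<rho> 0) y)" by (intro dpI)
  from qsep[OF y this] obtain u where
    u: "qset u" "\<And>t. t \<in>\<^sub>q u \<longleftrightarrow> t \<in>\<^sub>q y \<and> eqe t y" by blast
  have yu: "y \<in>\<^sub>q u" unfolding u(2) using yy eqe_refl_qset[OF y] by blast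
  have "qset t" if "t \<in>\<^sub>q u" for t using that y unfolding u(2) eqe_def qset_def by blast
  from qfound[OF u(1) this yu] obtain v where v: "v \<in>\<^sub>q u" "\<And>z. z \<in>\<^sub>q v \<Longrightarrow> \<not> z \<in>\<^sub>q u" by blast
  then have "y \<in>\<^sub>q v" using mem_eqe_right[OF eqe_sym yy] unfolding u(2) by blast
  then show False using v(2) yu by blast
qed

text \<open>The function of Q27 has to respect indistinguishability. The relation \<open>R\<close> is first extended
  to all objects indistinguishable from an element of \<open>u\<close>, which is possible since such an element
  is unique, and given the value zero elsewhere.\<close>

lemma Drepl:
  assumes u: "zset u" and R: "def_pred (\<lambda>\<rho>. R (\<rho> 0) (\<rho> (Suc 0)))"
    and uniq: "\<And>x y y'. x \<in>\<^sub>q u \<Longrightarrow> isD y \<Longrightarrow> isD y' \<Longrightarrow> R x y \<Longrightarrow> R x y' \<Longrightarrow> eqe y y'"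
  shows "\<exists>v. zset v \<and> (\<forall>y. y \<in>\<^sub>q v \<longleftrightarrow> isD y \<and> (\<exists>x. x \<in>\<^sub>q u \<and> R x y))"
proof -
  define val where "val x y \<longleftrightarrow> (\<exists>a. a \<in>\<^sub>q u \<and> a \<simeq> x \<and> isD y \<and> R a y)" for x y
  define rel where "rel x y \<longleftrightarrow> (\<exists>b. val x b \<and> eqe y b) \<or> \<not> (\<exists>b. val x b) \<and> qempty y" for x y
  have dval: "def_pred (\<lambda>\<rho>. val (\<rho> i) (\<rho> j))" for i j
    unfolding val_def by (intro dpI def_pred_rename2[OF R])
  have drel: "def_pred (\<lambda>\<rho>. rel (\<rho> 0) (\<rho> (Suc 0)))"
    unfolding rel_def by (intro dpI dval)
  have total: "\<exists>y. rel x y" for x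
    using qempty_ex eqe_refl unfolding rel_def val_def by blast
  have val_ind: "val x' y" if "val x y" "x \<simeq> x'" for x x' y
    using that ind_trans unfolding val_def by blast
  have val_uniq: "eqe y y'" if xy: "val x y" "val x y'" for x y y'
  proof -
    obtain a b where a: "a \<in>\<^sub>q u" "a \<simeq> x" "isD y" "R a y" and b: "b \<in>\<^sub>q u" "b \<simeq> x" "isD y'" "R b y'"
      using xy unfolding val_def by blast
    have "eqe b a"
      using ind_eqe zset_mem[OF u] a(1,2) b(1,2) ind_sym ind_trans by blast
    then have "R a y'" using eqe_subst2[OF R _ eqe_refl] b by blast
    then show ?thesis using uniq a b by blast
  qed
  have rel_ind: "y \<simeq> y'" if r: "rel x y" "rel x' y'" "x \<simeq> x'" for x x' y y'
  proof (cases "\<exists>b. val x b")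
    case True
    then obtain b b' where b: "val x b" "eqe y b" "val x' b'" "eqe y' b'"
      using r val_ind unfolding rel_def by blast
    then have "eqe b b'" using val_uniq val_ind r(3) by blast
    then have "eqe y y'" using b(2) eqe_sym[OF b(4)] eqe_trans by blast
    then show ?thesis by (rule eqe_ind)
  next
    case False
    then have "qempty y" "qempty y'" using r val_ind ind_sym unfolding rel_def by blast+
    then have "eqe y y'" unfolding qempty_def eqe_def by blast
    then show ?thesis by (rule eqe_ind)
  qed
  obtain A \<sigma> where A: "\<And>x y. rel x y \<longleftrightarrow> satQ (case_nat x (case_nat y \<sigma>)) A"
    by (rule def_pred_binary[OF drel]) (rule that)
  have "(\<forall>x. \<exists>y. rel x y) \<and> (\<forall>x x' y y'. rel x y \<and> rel x' y' \<and> x \<simeq> x' \<longrightarrow> y \<simeq> y') \<longrightarrow>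
      (\<forall>u. qset u \<longrightarrow> (\<exists>v. qset v \<and> (\<forall>z. z \<in>\<^sub>q v \<longleftrightarrow> (\<exists>w. w \<in>\<^sub>q u \<and> rel w z))))"
    using valid[OF QST.Q27[of A], of \<sigma>] by (simp add: sem A)
  then obtain v where v: "qset v" "\<And>z. z \<in>\<^sub>q v \<longleftrightarrow> (\<exists>w. w \<in>\<^sub>q u \<and> rel w z)"
    using total rel_ind zset_qset[OF u] by blast
  \<comment> \<open>\<open>v\<close> also contains the default value if some element of
    \<open>u\<close> has no classical \<open>R\<close>-value; separation keeps the genuine values
    only.\<close>
  have "def_pred (\<lambda>\<rho>. isD (\<rho> 0) \<and> (\<exists>x. x \<in>\<^sub>q u \<and> R x (\<rho> 0)))"
    by (intro dpI def_pred_rename2[OF R])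
  from qsep[OF v(1) this] obtain w where
    w: "qset w" "\<And>t. t \<in>\<^sub>q w \<longleftrightarrow> t \<in>\<^sub>q v \<and> isD t \<and> (\<exists>x. x \<in>\<^sub>q u \<and> R x t)" by blast
  have "t \<in>\<^sub>q v" if "isD t" "x \<in>\<^sub>q u" "R x t" for t x
    unfolding v(2) rel_def val_def using that ind_refl eqe_refl by blast
  then have "t \<in>\<^sub>q w \<longleftrightarrow> isD t \<and> (\<exists>x. x \<in>\<^sub>q u \<and> R x t)" for t unfolding w(2) by blast
  moreover have "zset w" unfolding zset_iff[OF w(1)] w(2) by blast
  ultimately show ?thesis by blast
qed

lemma D_transversal:
  obtains f :: "nat \<Rightarrow> 'a" where "\<And>n. isD (f n)" "\<And>a. isD a \<Longrightarrow> \<exists>n. eqe a (f n)"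
    "\<And>i j. eqe (f i) (f j) \<longleftrightarrow> i = j"
proof (rule transversal[of isD eqe])
  show "\<exists>a. isD a \<and> (\<forall>b\<in>F. \<not> eqe a b)" if "finite F" "F \<subseteq> Collect isD" for F
  proof (rule infinite_universe[OF _ _ _ that])
    obtain e where "qempty e" using qempty_ex by blast
    then have e: "zset e" by (rule qempty_zset)
    then show "\<exists>s. isD s" unfolding isD_def by blast
    show "\<exists>s'. isD s' \<and> (\<forall>x. isD x \<longrightarrow> x \<in>\<^sub>q s \<or> eqe x a \<longrightarrow> x \<in>\<^sub>q s')" if s: "isD s" "isD a" for s a
    proof -
      obtain p where p: "zset p" "\<And>t. t \<in>\<^sub>q p \<longleftrightarrow> isD t \<and> (eqe t a \<or> eqe t a)"
        using Dpair[OF s(2,2)] by blast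
      then have "isD p" unfolding isD_def by blast
      then obtain q where q: "zset q" "\<And>t. t \<in>\<^sub>q q \<longleftrightarrow> isD t \<and> (eqe t s \<or> eqe t p)"
        using Dpair[OF s(1)] by blast
      obtain w where w: "zset w" "\<And>z. z \<in>\<^sub>q w \<longleftrightarrow> (\<exists>t. z \<in>\<^sub>q t \<and> t \<in>\<^sub>q q)"
        using Dunion[OF q(1)] by blast
      have "s \<in>\<^sub>q q" "p \<in>\<^sub>q q" unfolding q(2) using s(1) \<open>isD p\<close> eqe_refl by blast+
      then show ?thesis using w p(2) unfolding isD_def by blast
    qed
    show "\<exists>r. isD r \<and> (\<forall>x. isD x \<longrightarrow> (x \<in>\<^sub>q r \<longleftrightarrow> x \<in>\<^sub>q s \<and> \<not> x \<in>\<^sub>q x))" if s: "isD s" for s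
    proof (cases "zset s")
      case True
      have "def_pred (\<lambda>\<rho>. \<not> \<rho> 0 \<in>\<^sub>q \<rho> 0)" by (intro dpI)
      from Dsep[OF True this] show ?thesis unfolding isD_def by blast
    next
      case False
      then have "\<not> x \<in>\<^sub>q s" for x using isD_qset[OF s] mem_qset by blast
      then show ?thesis using s by blast
    qed
  qed
qed (use eqe_refl eqe_sym eqe_trans in blast)+

end

subsection \<open>The universe of classical objects\<close>

text \<open>The classical objects modulo extensional identity are represented by natural numbers.\<close>

locale qmodel_classical = qmodel c micro macro zset ind qmem
  for c :: "'a::countable \<Rightarrow> 'a" and micro macro zset :: "'a \<Rightarrow> bool"
    and ind :: "'a \<Rightarrow> 'a \<Rightarrow> bool" (infix "\<simeq>" 50)
    and qmem :: "'a \<Rightarrow> 'a \<Rightarrow> bool" (infix "\<in>\<^sub>q" 50) +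
  fixes f :: "nat \<Rightarrow> 'a"
  assumes f_isD: "isD (f n)"
    and f_onto: "isD a \<Longrightarrow> \<exists>n. eqe a (f n)"
    and f_eq: "eqe (f i) (f j) \<longleftrightarrow> i = j"
begin

definition memN :: "nat \<Rightarrow> nat \<Rightarrow> bool" where
  "memN i j \<longleftrightarrow> zset (f j) \<and> f i \<in>\<^sub>q f j"

definition setN :: "nat \<Rightarrow> bool" where
  "setN i \<longleftrightarrow> zset (f i)"

text \<open>The defining predicate \<open>G\<close> belongs to the whole model, so its quantifiers
  may range over qsets that are not classical. This class is wider than that of the formulas of ZFU
  interpreted by \<open>memN\<close> and \<open>setN\<close>.\<close>

definition dpN :: "((nat \<Rightarrow> nat) \<Rightarrow> bool) \<Rightarrow> bool" where
  "dpN F \<longleftrightarrow> (\<exists>G. def_pred G \<and> (\<forall>\<rho>. F \<rho> \<longleftrightarrow> G (\<lambda>i. f (\<rho> i))))"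

lemma dpNI: "def_pred G \<Longrightarrow> (\<And>\<rho>. F \<rho> \<longleftrightarrow> G (\<lambda>i. f (\<rho> i))) \<Longrightarrow> dpN F"
  unfolding dpN_def by blast

lemma f_case_nat: "(\<lambda>i. f (case_nat n \<rho> i)) = case_nat (f n) (\<lambda>i. f (\<rho> i))"
  by (rule ext) (simp split: nat.split)

lemma setN_ex:
  assumes "zset z"
  obtains k where "setN k" "\<And>i. memN i k \<longleftrightarrow> f i \<in>\<^sub>q z"
proof -
  have "isD z" using assms by (simp add: isD_def)
  then obtain k where k: "eqe z (f k)" using f_onto by blast
  then have "zset (f k)" using zset_eqe assms by blast
  moreover have "f i \<in>\<^sub>q f k \<longleftrightarrow> f i \<in>\<^sub>q z" for i
    using mem_eqe_right[OF k] mem_eqe_right[OF eqe_sym[OF k]] by blast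
  ultimately show thesis using that unfolding setN_def memN_def by blast
qed

lemma D_mem_f: "isD t \<Longrightarrow> t \<in>\<^sub>q z \<Longrightarrow> \<exists>n. eqe t (f n) \<and> f n \<in>\<^sub>q z"
  using f_onto mem_eqe_left by blast

text \<open>A quantifier over numbers becomes one bounded by \<open>isD\<close>, which is harmless
  because definable predicates do not distinguish extensionally identical objects. Equality of
  numbers becomes \<open>eqe\<close> and is thereby definable.\<close>

lemma definability_dpN: "definability dpN"
proof
  show "dpN (\<lambda>_. True)" by (rule dpNI[OF dp_true]) simp
  show "dpN (\<lambda>\<rho>. \<not> F \<rho>)" if "dpN F" for F
    using that dp_not unfolding dpN_def by blast
  show "dpN (\<lambda>\<rho>. F \<rho> \<or> F' \<rho>)" if "dpN F" "dpN F'" for F F'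
    using that dp_or unfolding dpN_def by blast
  show "dpN (\<lambda>\<rho>. \<rho> i = \<rho> j)" for i j
    by (rule dpNI[of "\<lambda>\<rho>. eqe (\<rho> i) (\<rho> j)"], intro dpI) (simp add: f_eq)
  show "dpN (\<lambda>\<rho>. F (\<lambda>n. \<rho> (r n)))" if F: "dpN F" for F r
  proof -
    obtain G where G: "def_pred G" "\<And>\<rho>. F \<rho> \<longleftrightarrow> G (\<lambda>i. f (\<rho> i))"
      using F unfolding dpN_def by blast
    show ?thesis by (rule dpNI[OF dp_rename[OF G(1), of r]]) (rule G(2))
  qed
  show "dpN (\<lambda>\<rho>. F (case_nat a \<rho>))" if F: "dpN F" for F a
  proof -
    obtain G where G: "def_pred G" "\<And>\<rho>. F \<rho> \<longleftrightarrow> G (\<lambda>i. f (\<rho> i))"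
      using F unfolding dpN_def by blast
    show ?thesis by (rule dpNI[OF dp_param[OF G(1), of "f a"]]) (simp add: G(2) f_case_nat)
  qed
  show "dpN (\<lambda>\<rho>. \<forall>x. H \<rho> x)" if H: "dpN (\<lambda>\<rho>. H (\<lambda>n. \<rho> (Suc n)) (\<rho> 0))" for H
  proof -
    obtain G where G: "def_pred G" "\<And>\<rho>. H (\<lambda>n. \<rho> (Suc n)) (\<rho> 0) \<longleftrightarrow> G (\<lambda>i. f (\<rho> i))"
      using H unfolding dpN_def by blast
    have H_G: "H \<rho> x \<longleftrightarrow> G (case_nat (f x) (\<lambda>i. f (\<rho> i)))" for \<rho> x
      using G(2)[of "case_nat x \<rho>"] by (simp add: f_case_nat)
    show ?thesis
    proof (rule dpNI[of "\<lambda>\<rho>. \<forall>a. isD a \<longrightarrow> G (case_nat a \<rho>)"])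
      have "def_pred (\<lambda>\<rho>. isD (\<rho> 0) \<longrightarrow> G \<rho>)" by (intro dpI G(1))
      then show "def_pred (\<lambda>\<rho>. \<forall>a. isD a \<longrightarrow> G (case_nat a \<rho>))"
        by (intro dp_all) (simp add: case_nat_shift)
      fix \<rho>
      have "G (case_nat a (\<lambda>i. f (\<rho> i)))" if x: "\<forall>x. H \<rho> x" and a: "isD a" for a
      proof -
        obtain n where "eqe a (f n)" using f_onto a by blast
        from def_pred_eqe[OF G(1) eqe_sym[OF this]] show ?thesis using x H_G by blast
      qed
      then show "(\<forall>x. H \<rho> x) \<longleftrightarrow> (\<forall>a. isD a \<longrightarrow> G (case_nat a (\<lambda>i. f (\<rho> i))))"
        using H_G f_isD by blast
    qed
  qed
qed

lemma dpN_unary: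
  assumes "dpN (\<lambda>\<rho>. P (\<rho> 0))"
  obtains P' where "def_pred (\<lambda>\<rho>. P' (\<rho> 0))" "\<And>n. P n \<longleftrightarrow> P' (f n)"
proof -
  obtain G where G: "def_pred G" "\<And>\<rho>. P (\<rho> 0) \<longleftrightarrow> G (\<lambda>i. f (\<rho> i))"
    using assms unfolding dpN_def by blast
  show thesis
  proof (rule that[of "\<lambda>a. G (\<lambda>_. a)"])
    show "def_pred (\<lambda>\<rho>. G (\<lambda>_. \<rho> 0))" using dp_rename[OF G(1), of "\<lambda>_. 0"] .
    show "P n \<longleftrightarrow> G (\<lambda>_. f n)" for n using G(2)[of "\<lambda>_. n"] .
  qed
qed

lemma dpN_binary:
  assumes "dpN (\<lambda>\<rho>. R (\<rho> 0) (\<rho> (Suc 0)))"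
  obtains R' where "def_pred (\<lambda>\<rho>. R' (\<rho> 0) (\<rho> (Suc 0)))" "\<And>i j. R i j \<longleftrightarrow> R' (f i) (f j)"
proof -
  obtain G where G: "def_pred G" "\<And>\<rho>. R (\<rho> 0) (\<rho> (Suc 0)) \<longleftrightarrow> G (\<lambda>i. f (\<rho> i))"
    using assms unfolding dpN_def by blast
  show thesis
  proof (rule that[of "\<lambda>a b. G (case_nat a (\<lambda>_. b))"])
    have "(\<lambda>n. \<rho> (case_nat 0 (\<lambda>_. Suc 0) n)) = case_nat (\<rho> 0) (\<lambda>_. \<rho> (Suc 0))" for \<rho> :: "nat \<Rightarrow> 'a"
      by (rule ext) (simp split: nat.split)
    then show "def_pred (\<lambda>\<rho>. G (case_nat (\<rho> 0) (\<lambda>_. \<rho> (Suc 0))))"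
      using dp_rename[OF G(1), of "case_nat 0 (\<lambda>_. Suc 0)"] by simp
    show "R i j \<longleftrightarrow> G (case_nat (f i) (\<lambda>_. f j))" for i j
      using G(2)[of "case_nat i (\<lambda>_. j)"] by (simp add: f_case_nat)
  qed
qed

sublocale N: definability dpN
  by (rule definability_dpN)

sublocale N: zfu0 dpN memN setN
proof
  show "dpN (\<lambda>\<rho>. memN (\<rho> i) (\<rho> j))" for i j
    by (rule dpNI[of "\<lambda>\<rho>. zset (\<rho> j) \<and> \<rho> i \<in>\<^sub>q \<rho> j"], intro dpI) (simp add: memN_def)
  show "dpN (\<lambda>\<rho>. setN (\<rho> i))" for i
    by (rule dpNI[of "\<lambda>\<rho>. zset (\<rho> i)"], intro dpI) (simp add: setN_def)
  show "setN y" if "memN x y" for x y using that by (simp add: memN_def setN_def)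
  show "x = y" if xy: "setN x" "setN y" "\<And>z. memN z x \<longleftrightarrow> memN z y" for x y
  proof -
    have z: "zset (f x)" "zset (f y)" using xy by (simp_all add: setN_def)
    have "t \<in>\<^sub>q f x \<longleftrightarrow> t \<in>\<^sub>q f y" for t
    proof (cases "isD t")
      case True
      then obtain n where n: "eqe t (f n)" using f_onto by blast
      have "t \<in>\<^sub>q w \<longleftrightarrow> f n \<in>\<^sub>q w" for w
        using mem_eqe_left[OF n] mem_eqe_left[OF eqe_sym[OF n]] by blast
      then show ?thesis using xy(3)[of n] z by (simp add: memN_def)
    next
      case False
      then show ?thesis using zset_mem z by blast
    qed
    then have "eqe (f x) (f y)" using zset_qset z unfolding eqe_def by blast
    then show ?thesis by (simp add: f_eq)
  qed
  show "\<exists>z. \<forall>t. memN t z \<longleftrightarrow> t = x \<or> t = y" for x y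
  proof -
    obtain z where z: "zset z" "\<And>t. t \<in>\<^sub>q z \<longleftrightarrow> isD t \<and> (eqe t (f x) \<or> eqe t (f y))"
      using Dpair[OF f_isD f_isD] by blast
    obtain k where "\<And>i. memN i k \<longleftrightarrow> f i \<in>\<^sub>q z" using setN_ex[OF z(1)] by blast
    then show ?thesis using z(2) f_isD f_eq by blast
  qed
  show "\<exists>y. setN y \<and> (\<forall>z. memN z y \<longleftrightarrow> (\<exists>t. memN z t \<and> memN t x))" if x: "setN x" for x
  proof -
    have zx: "zset (f x)" using x by (simp add: setN_def)
    obtain z where z: "zset z" "\<And>i. i \<in>\<^sub>q z \<longleftrightarrow> (\<exists>t. i \<in>\<^sub>q t \<and> t \<in>\<^sub>q f x)"
      using Dunion[OF zx] by blast
    obtain k where k: "setN k" "\<And>i. memN i k \<longleftrightarrow> f i \<in>\<^sub>q z" by (rule setN_ex[OF z(1)]) (rule that)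
    have "f i \<in>\<^sub>q z \<longleftrightarrow> (\<exists>t. memN i t \<and> memN t x)" for i
    proof
      assume "f i \<in>\<^sub>q z"
      then obtain t where t: "f i \<in>\<^sub>q t" "t \<in>\<^sub>q f x" using z(2) by blast
      then have "zset t" using zset_mem[OF zx] isD_qset mem_qset by blast
      moreover obtain n where n: "eqe t (f n)" "f n \<in>\<^sub>q f x"
        using D_mem_f[OF zset_mem[OF zx t(2)] t(2)] by blast
      ultimately show "\<exists>t. memN i t \<and> memN t x"
        using zx zset_eqe[OF n(1)] mem_eqe_right[OF n(1) t(1)] unfolding memN_def by blast
    next
      assume "\<exists>t. memN i t \<and> memN t x"
      then show "f i \<in>\<^sub>q z" unfolding z(2) memN_def by blast
    qed
    then show ?thesis using k by blast
  qed
  show "\<exists>y. setN y \<and> (\<forall>t. memN t y \<longleftrightarrow> setN t \<and> (\<forall>z. memN z t \<longrightarrow> memN z x))" if x: "setN x" for x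
  proof -
    have zx: "zset (f x)" using x by (simp add: setN_def)
    obtain p where p: "zset p" "\<And>t. t \<in>\<^sub>q p \<longleftrightarrow> zset t \<and> (\<forall>z. z \<in>\<^sub>q t \<longrightarrow> z \<in>\<^sub>q f x)"
      using Dpow[OF zx] by blast
    obtain k where k: "setN k" "\<And>i. memN i k \<longleftrightarrow> f i \<in>\<^sub>q p" by (rule setN_ex[OF p(1)]) (rule that)
    have "f t \<in>\<^sub>q p \<longleftrightarrow> setN t \<and> (\<forall>z. memN z t \<longrightarrow> memN z x)" for t
    proof
      assume "f t \<in>\<^sub>q p"
      then show "setN t \<and> (\<forall>z. memN z t \<longrightarrow> memN z x)"
        unfolding p(2) memN_def setN_def using zx by blast
    next
      assume t: "setN t \<and> (\<forall>z. memN z t \<longrightarrow> memN z x)"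
      then have zt: "zset (f t)" by (simp add: setN_def)
      have "z \<in>\<^sub>q f x" if z: "z \<in>\<^sub>q f t" for z
      proof -
        obtain n where n: "eqe z (f n)" "f n \<in>\<^sub>q f t"
          using D_mem_f[OF zset_mem[OF zt z] z] by blast
        then have "f n \<in>\<^sub>q f x" using t zt unfolding memN_def by blast
        then show ?thesis by (rule mem_eqe_left[OF eqe_sym[OF n(1)]])
      qed
      then show "f t \<in>\<^sub>q p" unfolding p(2) using zt by blast
    qed
    then show ?thesis using k by blast
  qed
  show "\<exists>y. setN y \<and> (\<forall>t. memN t y \<longleftrightarrow> memN t x \<and> P t)"
    if x: "setN x" and P: "dpN (\<lambda>\<rho>. P (\<rho> 0))" for x P
  proof -
    have zx: "zset (f x)" using x by (simp add: setN_def)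
    obtain P' where P': "def_pred (\<lambda>\<rho>. P' (\<rho> 0))" "\<And>n. P n \<longleftrightarrow> P' (f n)"
      by (rule dpN_unary[OF P]) (rule that)
    obtain z where z: "zset z" "\<And>t. t \<in>\<^sub>q z \<longleftrightarrow> t \<in>\<^sub>q f x \<and> P' t"
      using Dsep[OF zx P'(1)] by blast
    obtain k where k: "setN k" "\<And>i. memN i k \<longleftrightarrow> f i \<in>\<^sub>q z" by (rule setN_ex[OF z(1)]) (rule that)
    have "memN t k \<longleftrightarrow> memN t x \<and> P t" for t
      using k(2)[of t] z(2)[of "f t"] P'(2)[of t] zx by (simp add: memN_def)
    then show ?thesis using k(1) by blast
  qed
  show "\<exists>v. setN v \<and> (\<forall>y. memN y v \<longleftrightarrow> (\<exists>x. memN x u \<and> R x y))"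
    if u: "setN u" and R: "dpN (\<lambda>\<rho>. R (\<rho> 0) (\<rho> (Suc 0)))"
      and uniq: "\<And>x y y'. memN x u \<Longrightarrow> R x y \<Longrightarrow> R x y' \<Longrightarrow> y = y'" for u R
  proof -
    have zu: "zset (f u)" using u by (simp add: setN_def)
    obtain R' where R': "def_pred (\<lambda>\<rho>. R' (\<rho> 0) (\<rho> (Suc 0)))" "\<And>i j. R i j \<longleftrightarrow> R' (f i) (f j)"
      by (rule dpN_binary[OF R]) (rule that)
    have uniq': "eqe y y'"
      if x: "x \<in>\<^sub>q f u" and y: "isD y" "isD y'" "R' x y" "R' x y'" for x y y'
    proof -
      obtain n where n: "eqe x (f n)" "f n \<in>\<^sub>q f u" using D_mem_f[OF zset_mem[OF zu x] x] by blast
      obtain i j where i: "eqe y (f i)" and j: "eqe y' (f j)" using f_onto y by blast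
      have "R n i" "R n j"
        unfolding R'(2) using eqe_subst2[OF R'(1) n(1) i y(3)] eqe_subst2[OF R'(1) n(1) j y(4)] by blast+
      moreover have "memN n u" using n zu by (simp add: memN_def)
      ultimately have "i = j" using uniq by blast
      then show ?thesis using i eqe_sym[OF j] eqe_trans by blast
    qed
    obtain z where z: "zset z" "\<And>y. y \<in>\<^sub>q z \<longleftrightarrow> isD y \<and> (\<exists>x. x \<in>\<^sub>q f u \<and> R' x y)"
    proof -
      have "\<exists>v. zset v \<and> (\<forall>y. y \<in>\<^sub>q v \<longleftrightarrow> isD y \<and> (\<exists>x. x \<in>\<^sub>q f u \<and> R' x y))"
        by (rule Drepl[OF zu R'(1)]) (rule uniq')
      then show ?thesis using that by blast
    qed
    obtain k where k: "setN k" "\<And>i. memN i k \<longleftrightarrow> f i \<in>\<^sub>q z" by (rule setN_ex[OF z(1)]) (rule that)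
    have "f y \<in>\<^sub>q z \<longleftrightarrow> (\<exists>x. memN x u \<and> R x y)" for y
    proof
      assume "f y \<in>\<^sub>q z"
      then obtain x where x: "x \<in>\<^sub>q f u" "R' x (f y)" using z(2) by blast
      obtain n where n: "eqe x (f n)" "f n \<in>\<^sub>q f u" using D_mem_f[OF zset_mem[OF zu x(1)] x(1)] by blast
      then have "R n y" unfolding R'(2) using eqe_subst2[OF R'(1) n(1) eqe_refl[OF f_isD] x(2)] by blast
      then show "\<exists>x. memN x u \<and> R x y" using n(2) zu unfolding memN_def by blast
    next
      assume "\<exists>x. memN x u \<and> R x y"
      then show "f y \<in>\<^sub>q z" unfolding z(2) R'(2) memN_def using f_isD by blast
    qed
    then show ?thesis using k by blast
  qed
  show "\<exists>y. memN y x \<and> (\<forall>z. memN z y \<longrightarrow> \<not> memN z x)" if x: "memN y x" for x y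
  proof -
    have zx: "zset (f x)" "f y \<in>\<^sub>q f x" using x by (simp_all add: memN_def)
    from Dfound[OF this] obtain t where t: "t \<in>\<^sub>q f x" "\<And>z. z \<in>\<^sub>q t \<Longrightarrow> \<not> z \<in>\<^sub>q f x" by blast
    obtain n where n: "eqe t (f n)" "f n \<in>\<^sub>q f x" using D_mem_f[OF zset_mem[OF zx(1) t(1)] t(1)] by blast
    have "\<not> memN z x" if "memN z n" for z
      using that t(2) mem_eqe_right[OF eqe_sym[OF n(1)]] unfolding memN_def by blast
    then show ?thesis using n(2) zx(1) unfolding memN_def by blast
  qed
qed

text \<open>The hypothesis is limited to the free variables of \<open>A\<close>, since a valuation
  of the whole model may send the others to objects that no \<open>f n\<close> represents.\<close>

lemma satQ_tr_N: "(\<And>i. i < fvb A \<Longrightarrow> eqe (\<tau> i) (f (\<rho> i))) \<Longrightarrow> satQ \<tau> (tr A) \<longleftrightarrow> N.satN \<rho> A"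
proof (induction A arbitrary: \<rho> \<tau>)
  case (Pr1 p x)
  then have x: "eqe (\<tau> x) (f (\<rho> x))" by simp
  have "zset (\<tau> x) \<longleftrightarrow> zset (f (\<rho> x))" using zset_eqe x eqe_sym by blast
  then show ?case by (cases p) (simp add: satQ_tr uev_def setN_def del: tr.simps)
next
  case (Pr2 r x y)
  then have x: "eqe (\<tau> x) (f (\<rho> x))" and y: "eqe (\<tau> y) (f (\<rho> y))" by simp_all
  have D: "isD (\<tau> x)" "isD (\<tau> y)" using isD_eqe[OF eqe_sym] f_isD x y by blast+
  show ?case
  proof (cases r)
    case EqU
    have "eqe (\<tau> x) (\<tau> y) \<longleftrightarrow> eqe (f (\<rho> x)) (f (\<rho> y))"
      using x y eqe_sym eqe_trans by blast
    moreover have "macro (\<tau> x) \<and> macro (\<tau> y) \<or> zset (\<tau> x) \<and> zset (\<tau> y)" if "eqe (\<tau> x) (\<tau> y)"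
      using that D isD_qset[OF D(1)] isD_qset[OF D(2)] unfolding eqe_def by blast
    ultimately show ?thesis unfolding EqU satQ_tr by (simp add: uev_def f_eq) blast
  next
    case MemU
    have "zset (\<tau> y) \<longleftrightarrow> zset (f (\<rho> y))" using zset_eqe y eqe_sym by blast
    moreover have "\<tau> x \<in>\<^sub>q \<tau> y \<longleftrightarrow> f (\<rho> x) \<in>\<^sub>q f (\<rho> y)"
      using x y eqe_sym mem_eqe_left mem_eqe_right by blast
    ultimately show ?thesis unfolding MemU satQ_tr using D by (simp add: uev_def memN_def)
  qed
next
  case (Neg A)
  have "satQ \<tau> (tr A) \<longleftrightarrow> N.satN \<rho> A" by (rule Neg.IH) (simp add: Neg.prems)
  then show ?case by simp
next
  case (Or A B)
  have "satQ \<tau> (tr A) \<longleftrightarrow> N.satN \<rho> A" by (rule Or.IH(1)) (simp add: Or.prems)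
  moreover have "satQ \<tau> (tr B) \<longleftrightarrow> N.satN \<rho> B" by (rule Or.IH(2)) (simp add: Or.prems)
  ultimately show ?case by simp
next
  case (All A)
  have *: "satQ (case_nat a \<tau>) (tr A) \<longleftrightarrow> N.satN (case_nat n \<rho>) A" if "eqe a (f n)" for a n
  proof (rule All.IH)
    fix i assume "i < fvb A"
    then show "eqe (case_nat a \<tau> i) (f (case_nat n \<rho> i))"
      using that All.prems by (cases i) simp_all
  qed
  show ?case
    unfolding satQ_tr sat.simps using * f_onto f_isD eqe_refl by meson
qed

section \<open>Quasi-cardinals as classical cardinals\<close>

lemma satQ_tr_dAnd: "satQ \<rho> (tr ((F \<^bold>\<and> G) d)) \<longleftrightarrow> satQ \<rho> (tr (F d)) \<and> satQ \<rho> (tr (G d))"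
  by (simp add: dAnd_def)

lemma satQ_tr_S: "satQ \<rho> (tr (S x d)) \<longleftrightarrow> zset (\<rho> (x d))"
  by (simp add: S_def pr1_def sem fv_def)

text \<open>That \<open>c x\<close> is a set is read off from the conjunct \<open>S\<close> in the
  translation of \<open>cardu\<close>. Only then does \<open>c x\<close> have a number, through
  which \<open>satQ_tr_N\<close> carries the rest of Q19a over to \<open>N\<close>.\<close>

lemma cardinal_qc:
  assumes x: "qset x"
  obtains n where "eqe (c x) (f n)" "N.cardinal n"
proof -
  have *: "satQ (case_nat (c x) (\<lambda>_. f 0)) (tr (cardu (fv 0) 0))"
    using valid[OF QST.Q19a, of "\<lambda>_. f 0"] x by (simp add: sem)
  then have "zset (c x)"
    by (simp add: cardu_def ordu_def satQ_tr_dAnd satQ_tr_S fv_nat)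
  then obtain n where n: "eqe (c x) (f n)" using f_onto unfolding isD_def by blast
  have "satQ (case_nat (c x) (\<lambda>_. f 0)) (tr (cardu (fv 0) 0)) \<longleftrightarrow>
      N.satN (case_nat n (\<lambda>_. 0)) (cardu (fv 0) 0)"
    by (rule satQ_tr_N) (use n eqe_refl[OF f_isD] in \<open>simp split: nat.split\<close>)
  with * have "N.cardinal n" by (simp add: sem)
  with n show thesis by (rule that)
qed

lemma card_of_ex_N:
  assumes x: "setN i"
  shows "\<exists>j. N.card_of i j"
proof -
  have zx: "zset (f i)" using x by (simp add: setN_def)
  then obtain k where *: "satQ (case_nat (f i) (case_nat k (\<lambda>_. f 0))) (tr (cardofu (fv 0) (fv 1) 0))"
    using valid[OF QST.Q19b, of "\<lambda>_. f 0"] zset_qset by (simp add: sem; blast)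
  then have "zset k"
    by (simp add: cardofu_def cardu_def ordu_def satQ_tr_dAnd satQ_tr_S fv_nat)
  then obtain j where j: "eqe k (f j)" using f_onto unfolding isD_def by blast
  have "satQ (case_nat (f i) (case_nat k (\<lambda>_. f 0))) (tr (cardofu (fv 0) (fv 1) 0)) \<longleftrightarrow>
      N.satN (case_nat i (case_nat j (\<lambda>_. 0))) (cardofu (fv 0) (fv 1) 0)"
    by (rule satQ_tr_N) (use j eqe_refl[OF f_isD] in \<open>simp split: nat.split\<close>)
  with * have "N.card_of i j" by (simp add: sem)
  then show ?thesis by blast
qed

lemma qc_strict_mono:
  assumes x: "qset x" "qset y" "qsub x y" "\<not> eqe x y" and n: "eqe (c x) (f i)" "N.natural i"
    and j: "eqe (c y) (f j)"
  shows "memN i j"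
proof -
  have "satQ (case_nat (c x) (\<lambda>_. f 0)) (tr (natu (fv 0) 0)) \<longleftrightarrow>
      N.satN (case_nat i (\<lambda>_. 0)) (natu (fv 0) 0)"
    by (rule satQ_tr_N) (use n eqe_refl[OF f_isD] in \<open>simp split: nat.split\<close>)
  then have "satQ (case_nat (c x) (\<lambda>_. f 0)) (tr (natu (fv 0) 0))"
    using n(2) by (simp add: sem)
  then have "satQ (case_nat (c x) (case_nat (c y) (\<lambda>_. f 0))) (tr (lessu (fv 0) (fv 1) 0))"
    using valid[OF QST.Q23, of "\<lambda>_. f 0"] x by (simp add: sem)
  moreover have "satQ (case_nat (c x) (case_nat (c y) (\<lambda>_. f 0))) (tr (lessu (fv 0) (fv 1) 0)) \<longleftrightarrow>
      N.satN (case_nat i (case_nat j (\<lambda>_. 0))) (lessu (fv 0) (fv 1) 0)"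
    by (rule satQ_tr_N) (use n j eqe_refl[OF f_isD] in \<open>simp split: nat.split\<close>)
  ultimately show ?thesis by (simp add: sem)
qed

text \<open>
  If all quasi-cardinals were natural numbers, then for \<open>y\<close> in the qset \<open>x\<close> of Q16 the
  quasi-cardinal of \<open>{z \<in> x. y \<subset> z}\<close> would decrease when \<open>y\<close> is replaced by \<open>y \<union> [y]\<close>.
\<close>

lemma nonnatural_ordinal_ex: "\<exists>a. N.ordinal a \<and> \<not> N.natural a"
proof (rule ccontr)
  assume "\<not> ?thesis"
  then have nat: "N.natural a" if "N.ordinal a" for a using that by blast
  have "\<exists>x. qset x \<and> (\<exists>e. qempty e \<and> e \<in>\<^sub>q x) \<and> (\<forall>y. y \<in>\<^sub>q x \<and> qset y \<longrightarrow>
      (\<exists>s w. (qset s \<and> (\<forall>t. t \<in>\<^sub>q s \<longleftrightarrow> t \<simeq> y \<or> t \<simeq> y)) \<and>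
        (qset w \<and> (\<forall>t. t \<in>\<^sub>q w \<longleftrightarrow> t \<in>\<^sub>q y \<or> t \<in>\<^sub>q s)) \<and> w \<in>\<^sub>q x))"
    using valid[OF QST.Q16, of undefined] by (simp add: sem)
  then obtain x e where x: "qset x" and e: "qempty e" "e \<in>\<^sub>q x"
    and next_x: "\<And>y. y \<in>\<^sub>q x \<Longrightarrow> qset y \<Longrightarrow>
      \<exists>w. qset w \<and> w \<in>\<^sub>q x \<and> (\<forall>t. t \<in>\<^sub>q w \<longleftrightarrow> t \<in>\<^sub>q y \<or> t \<simeq> y)" by metis
  define sub where "sub y z \<longleftrightarrow> qset z \<and> qsub y z \<and> \<not> qsub z y" for y z
  define up where "up y u \<longleftrightarrow> qset u \<and> (\<forall>z. z \<in>\<^sub>q u \<longleftrightarrow> z \<in>\<^sub>q x \<and> sub y z)" for y u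
  define rel where "rel a \<longleftrightarrow> (\<exists>y u. y \<in>\<^sub>q x \<and> qset y \<and> up y u \<and> eqe a (c u))" for a
  have up_ex: "\<exists>u. up y u" for y
    unfolding up_def sub_def by (rule qsep[OF x]) (intro dpI)
  have up_card: "\<exists>n. eqe (c u) (f n) \<and> N.ordinal n \<and> N.natural n" if "up y u" for y u
    using cardinal_qc[of u] that nat unfolding up_def N.cardinal_def by metis
  have "def_pred (\<lambda>\<rho>. rel (\<rho> 0))"
    unfolding rel_def up_def sub_def by (intro dpI)
  \<comment> \<open>Although \<open>rel\<close> quantifies over arbitrary qsets, it is admissible in
    \<open>N\<close>; this is what allows a least quasi-cardinal to be taken.\<close>
  then have drel: "dpN (\<lambda>\<rho>. rel (f (\<rho> 0)))" by (rule dpNI) simp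
  obtain u where u: "up e u" using up_ex by blast
  then obtain n where n: "eqe (c u) (f n)" "N.ordinal n" using up_card by blast
  have "rel (f n)" unfolding rel_def using e u eqe_sym[OF n(1)] unfolding qempty_def by blast
  from N.ordinal_least[where P = "\<lambda>n. rel (f n)", OF drel n(2) this] obtain k where
    k: "rel (f k)" and least: "\<And>i. memN i k \<Longrightarrow> \<not> rel (f i)" by blast
  then obtain y u where y: "y \<in>\<^sub>q x" "qset y" "up y u" "eqe (f k) (c u)" unfolding rel_def by blast
  obtain w where w: "qset w" "w \<in>\<^sub>q x" "\<And>t. t \<in>\<^sub>q w \<longleftrightarrow> t \<in>\<^sub>q y \<or> t \<simeq> y"
    using next_x[OF y(1,2)] by blast
  obtain v where v: "up w v" using up_ex by blast
  then obtain i where i: "eqe (c v) (f i)" "N.natural i" using up_card by blast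
  have "y \<in>\<^sub>q w" unfolding w(3) using ind_refl by blast
  then have "sub y w" unfolding sub_def qsub_def using w mem_irrefl_q[OF y(2)] by blast
  moreover have "sub y z" if "sub w z" for z
    using that calculation unfolding sub_def qsub_def by blast
  \<comment> \<open>What lies strictly above \<open>w\<close> lies strictly above \<open>y\<close>.
    But \<open>w\<close> itself is strictly above \<open>y\<close> and not above itself, so an
    element is lost.\<close>
  ultimately have "qsub v u" "w \<in>\<^sub>q u" "\<not> w \<in>\<^sub>q v"
    using y(3) v w(2) unfolding up_def qsub_def by (blast, blast, simp add: sub_def)
  moreover have "\<not> eqe v u" using calculation mem_eqe_right[OF eqe_sym] by blast
  ultimately have "memN i k"
    using v y(3) i eqe_sym[OF y(4)] unfolding up_def by (intro qc_strict_mono[of v u i k]) simp_all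
  moreover have "rel (f i)" unfolding rel_def using w(1,2) v eqe_sym[OF i(1)] by blast
  ultimately show False using least by blast
qed

sublocale N: zfu dpN memN setN
proof
  have eqpoll: "\<exists>k. N.ordinal k \<and> N.eqpoll x k" if "setN x" for x
    using card_of_ex_N[OF that] unfolding N.card_of_def N.cardinal_def by blast
  show "\<exists>u. setN u \<and> (\<forall>y. memN y x \<longrightarrow> (\<exists>v. \<forall>t. memN t y \<and> memN t u \<longleftrightarrow> t = v))"
    if "\<And>y. memN y x \<Longrightarrow> setN y \<and> (\<exists>t. memN t y)"
      "\<And>y z. memN y x \<Longrightarrow> memN z x \<Longrightarrow> \<exists>t. memN t y \<and> memN t z \<Longrightarrow> y = z" for x
    by (rule N.choice_of_ordinals[OF eqpoll]) (use that in blast)+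
  show "\<exists>x. memN N.emp x \<and> (\<forall>y. memN y x \<longrightarrow> setN y \<longrightarrow> memN (N.succ y) x)"
    using nonnatural_ordinal_ex N.inductive_set_ex by blast
qed

text \<open>Truth in \<open>N\<close> carries over to valuations that are classical on the free
  variables of \<open>A\<close>, and the bounded quantifiers in the translated closure produce
  exactly such valuations.\<close>

lemma provable_tr_valid:
  assumes "ZFU \<turnstile> A"
  shows "satQ \<rho> (tr (uclose A))"
proof -
  have N: "N.satN \<sigma> A" for \<sigma>
    using assms evaluation_uev N.ZFU_valid by (rule soundness)
  have "satQ \<rho> (tr A)" if \<rho>: "\<And>i. i < fvb A \<Longrightarrow> isD (\<rho> i)" for \<rho>
  proof -
    have "\<exists>n. i < fvb A \<longrightarrow> eqe (\<rho> i) (f n)" for i using f_onto \<rho> by blast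
    then obtain \<sigma> where "\<And>i. i < fvb A \<Longrightarrow> eqe (\<rho> i) (f (\<sigma> i))" by metis
    then show ?thesis using satQ_tr_N N by blast
  qed
  \<comment> \<open>\<open>k\<close> counts the variables that outer quantifiers have already given
    classical values.\<close>
  moreover have "satQ \<rho> (tr ((All ^^ n) B))"
    if "\<And>\<rho>. (\<And>i. i < k + n \<Longrightarrow> isD (\<rho> i)) \<Longrightarrow> satQ \<rho> (tr B)" "\<And>i. i < k \<Longrightarrow> isD (\<rho> i)" for n k B \<rho>
    using that
  proof (induction n arbitrary: k \<rho>)
    case (Suc n)
    have "satQ (case_nat a \<rho>) (tr ((All ^^ n) B))" if "isD a" for a
    proof (rule Suc.IH[of "Suc k"])
      show "satQ \<rho>' (tr B)" if "\<And>i. i < Suc k + n \<Longrightarrow> isD (\<rho>' i)" for \<rho>'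
        by (rule Suc.prems(1)) (use that in simp)
      show "isD (case_nat a \<rho> i)" if "i < Suc k" for i
        using that \<open>isD a\<close> Suc.prems(2) by (cases i) simp_all
    qed
    then show ?case by (simp add: satQ_tr del: tr.simps)
  qed simp
  ultimately show ?thesis unfolding uclose_def by (metis add_0 not_less_zero)
qed

end

section \<open>Preservation of provability and the equivalence\<close>

lemma tr_preserves_provability:
  assumes "ZFU \<turnstile> A"
  shows "QST \<turnstile> tr (uclose A)"
proof (rule ccontr)
  assume "\<not> QST \<turnstile> tr (uclose A)"
  then obtain I J \<tau> where valid: "\<And>B \<rho>. B \<in> QST \<Longrightarrow> sat tsubst I J \<rho> B"
    and A: "\<not> sat tsubst I J \<tau> (tr (uclose A))" by (rule completeness) (rule that)
  have eqs: "(tsubst :: (nat \<Rightarrow> qtm) \<Rightarrow> qtm \<Rightarrow> qtm) = qev QC"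
    "I = qI (I Micro) (I Macro) (I SetQ)" "J = qJ (J Indist) (J MemQ)"
  proof -
    have "tsubst \<rho> t = qev QC \<rho> t" for \<rho> t
      by (induction t) (simp_all add: tsubst_qtm_def)
    then show "(tsubst :: (nat \<Rightarrow> qtm) \<Rightarrow> qtm \<Rightarrow> qtm) = qev QC" by blast
    show "I = qI (I Micro) (I Macro) (I SetQ)"
    proof
      show "I p = qI (I Micro) (I Macro) (I SetQ) p" for p by (cases p) simp_all
    qed
    show "J = qJ (J Indist) (J MemQ)"
    proof
      show "J r = qJ (J Indist) (J MemQ) r" for r by (cases r) simp_all
    qed
  qed
  interpret qmodel QC "I Micro" "I Macro" "I SetQ" "J Indist" "J MemQ"
    using valid eqs by unfold_locales metis
  obtain f :: "nat \<Rightarrow> qtm" where f: "\<And>n. isD (f n)" "\<And>a. isD a \<Longrightarrow> \<exists>n. eqe a (f n)"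
    "\<And>i j. eqe (f i) (f j) \<longleftrightarrow> i = j"
    by (rule D_transversal) (rule that)
  interpret qmodel_classical QC "I Micro" "I Macro" "I SetQ" "J Indist" "J MemQ" f
    by unfold_locales (use f in blast)+
  have "satQ \<tau> (tr (uclose A))" using assms by (rule provable_tr_valid)
  then show False using A eqs by metis
qed

theorem theorem5:
  fixes A :: zfm
  shows "ZFU \<turnstile> A \<longleftrightarrow> QST \<turnstile> tr (uclose A)"
  using tr_preserves_provability tr_reflects_provability by blast

end
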